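(* Let $\varrho=h^4$ and consider the symmetric indefinite system $$\begin{bmatrix}\mathbf{M}_h&\mathbf{K}_h\\ \mathbf{K}_h&-\varrho^{-1}\mathbf{M}_h\end{bmatrix}\begin{bmatrix}\mathbf{u}\\ \widehat{\mathbf{p}}\end{bmatrix}=\begin{bmatrix}\mathbf{f}\\ \mathbf{0}\end{bmatrix},\qquad \mathbf{f}\in\mathbb{R}^{N_h}.$$ Then the diagonal preconditioner $$\mathcal{P}_{\mathrm{diag},h}=\begin{bmatrix}\mathrm{diag}(\mathbf{M}_h)&\mathbf{0}\\ \mathbf{0}&h^{-4}\,\mathrm{diag}(\mathbf{M}_h)\end{bmatrix}$$ is spectrally equivalent, with constants independent of $h$, to $$\mathcal{P}_h=\begin{bmatrix}\mathbf{M}_h+\varrho^{1/2}\mathbf{K}_h&\mathbf{0}\\ \mathbf{0}&\varrho^{-1}(\mathbf{M}_h+\varrho^{1/2}\mathbf{K}_h)\end{bmatrix},$$ and the MINRES method for the symmetric indefinite system $$\begin{bmatrix}\mathbf{M}_h&\mathbf{K}_h\\ \mathbf{K}_h&-\varrho^{-1}\mathbf{M}_h\end{bmatrix}\begin{bmatrix}\mathbf{u}\\ \widehat{\mathbf{p}}\end{bmatrix}=\begin{bmatrix}\mathbf{f}\\ \mathbf{0}\end{bmatrix}$$ preconditioned by $\mathcal{P}_{\mathrm{diag},h}$ converges with a rate that is independent of $h$, and with asymptotically optimal complexity $\mathcal{O}(N_h\ln\varepsilon^{-1})$ for any fixed relative accuracy $\varepsilon\in(0,1)$.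
   Context: $\Omega\subset\mathbb{R}^d$, $d\in\{1,2,3\}$, is a bounded Lipschitz domain, decomposed admissibly into shape regular, globally quasi-uniform simplices of mesh size $h$. $V_h=\mathrm{span}\{\varphi_k\}_{k=1}^{N_h}\subset H^1_0(\Omega)$ is the space of continuous piecewise linear functions vanishing on $\partial\Omega$, with nodal basis $\varphi_k$; $\mathbf{M}_h[\ell,k]=\int_\Omega\varphi_k\varphi_\ell\,dx$ and $\mathbf{K}_h[\ell,k]=\int_\Omega\nabla\varphi_k\cdot\nabla\varphi_\ell\,dx$. $\mathrm{diag}(\mathbf{M}_h)$ is the diagonal part of $\mathbf{M}_h$. Two families of symmetric positive definite matrices $\mathcal{P}_h,\mathcal{Q}_h$ are spectrally equivalent if there are $h$-independent constants $0<c_1\le c_2$ with $c_1(\mathcal{Q}_h\mathbf{v},\mathbf{v})\le(\mathcal{P}_h\mathbf{v},\mathbf{v})\le c_2(\mathcal{Q}_h\mathbf{v},\mathbf{v})$ for all $\mathbf{v}$. "Converges with a rate independent of $h$" means: there are $C>0$ and $q\in(0,1)$ independent of $h$ such that the $n$-th MINRES residual $\mathbf{r}^n$ satisfies $\|\mathbf{r}^n\|_{\mathcal{P}_{\mathrm{diag},h}^{-1}}\le C q^n\|\mathbf{r}^0\|_{\mathcal{P}_{\mathrm{diag},h}^{-1}}$, where $\|\mathbf{r}\|_{\mathcal{P}^{-1}}=(\mathcal{P}^{-1}\mathbf{r},\mathbf{r})^{1/2}$. Preconditioned MINRES is the Krylov method whose $n$-th iterate minimizes this residual norm over $\mathbf{x}^0$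 plus the $n$-th preconditioned Krylov space. The complexity is the number of arithmetical operations needed to reduce this residual norm by the factor $\varepsilon$, with the constant in $\mathcal{O}$ independent of $h$. "Independent of $h$" allows dependence on $\Omega$ and the mesh-family regularity constants. *)

theory Defs
  imports
    "HOL-Analysis.Analysis"
    "Jordan_Normal_Form.Gauss_Jordan_Elimination"
    "Jordan_Normal_Form.VS_Connect"
begin

section \<open>Lipschitz domains, meshes and linear finite elements\<close>

text \<open>Near every boundary point the set is the strict epigraph, in some direction \<^term>\<open>e\<close>, of a
  Lipschitz function on the hyperplane orthogonal to \<^term>\<open>e\<close>.\<close>

definition lipschitz_domain :: "'a::euclidean_space set \<Rightarrow> bool" where
  "lipschitz_domain \<Omega> \<longleftrightarrow>
     open \<Omega> \<and> connected \<Omega> \<and> \<Omega> \<noteq> {} \<and>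
     (\<forall>x\<in>frontier \<Omega>. \<exists>r>0. \<exists>e g L. norm e = 1 \<and> L-lipschitz_on {z. inner z e = 0} g \<and>
        (\<forall>y\<in>ball x r. y \<in> \<Omega> \<longleftrightarrow> g (y - inner y e *\<^sub>R e) < inner y e))"

text \<open>The nodes \<open>x\<^sub>0, \<dots>\<close> are the vertices inside the domain, in an arbitrary enumeration;
  \<open>hat m k\<close> is the nodal basis function belonging to the \<open>k\<close>-th node.\<close>

record 'a fe_mesh =
  cells :: "'a set set"
  nodes :: "'a list"
  hat :: "nat \<Rightarrow> 'a \<Rightarrow> real"

definition num_dofs :: "'a fe_mesh \<Rightarrow> nat" where
  "num_dofs m = length (nodes m)"

definition mesh_size :: "'a::euclidean_space fe_mesh \<Rightarrow> real" where
  "mesh_size m = Max (diameter ` cells m)"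

definition vertices :: "'a::euclidean_space set set \<Rightarrow> 'a set" where
  "vertices \<T> = (\<Union>T\<in>\<T>. {x. x extreme_point_of T})"

definition admissible_decomposition :: "'a::euclidean_space set \<Rightarrow> 'a set set \<Rightarrow> bool" where
  "admissible_decomposition \<Omega> \<T> \<longleftrightarrow>
     triangulation \<T> \<and> (\<forall>T\<in>\<T>. int DIM('a) simplex T) \<and> \<Union>\<T> = closure \<Omega>"

definition shape_regular :: "real \<Rightarrow> 'a::euclidean_space set set \<Rightarrow> bool" where
  "shape_regular \<sigma> \<T> \<longleftrightarrow> (\<forall>T\<in>\<T>. \<exists>x. cball x (diameter T / \<sigma>) \<subseteq> T)"

definition quasi_uniform :: "real \<Rightarrow> 'a::euclidean_space set set \<Rightarrow> bool" where
  "quasi_uniform \<tau> \<T> \<longleftrightarrow> (\<forall>T\<in>\<T>. \<forall>T'\<in>\<T>. diameter T \<le> \<tau> * diameter T')"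

definition p1_space :: "'a::euclidean_space set \<Rightarrow> 'a set set \<Rightarrow> ('a \<Rightarrow> real) set" where
  "p1_space \<Omega> \<T> =
     {v. continuous_on (closure \<Omega>) v \<and>
         (\<forall>T\<in>\<T>. \<exists>a b. \<forall>x\<in>T. v x = inner a x + b) \<and>
         (\<forall>x\<in>frontier \<Omega>. v x = 0)}"

definition nodal_basis ::
    "'a::euclidean_space set \<Rightarrow> 'a set set \<Rightarrow> 'a list \<Rightarrow> (nat \<Rightarrow> 'a \<Rightarrow> real) \<Rightarrow> bool" where
  "nodal_basis \<Omega> \<T> xs \<phi> \<longleftrightarrow>
     distinct xs \<and> set xs = vertices \<T> \<inter> \<Omega> \<and>
     (\<forall>k<length xs. \<phi> k \<in> p1_space \<Omega> \<T> \<and>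
        (\<forall>l<length xs. \<phi> k (xs ! l) = (if k = l then 1 else 0)))"

text \<open>A statement with constants uniform over this set holds with the same constants for every
  mesh family on \<^term>\<open>\<Omega>\<close> with regularity constants \<^term>\<open>\<sigma>\<close> and \<^term>\<open>\<tau>\<close>.\<close>

definition fe_meshes :: "'a::euclidean_space set \<Rightarrow> real \<Rightarrow> real \<Rightarrow> 'a fe_mesh set" where
  "fe_meshes \<Omega> \<sigma> \<tau> =
     {m. admissible_decomposition \<Omega> (cells m) \<and> shape_regular \<sigma> (cells m) \<and>
         quasi_uniform \<tau> (cells m) \<and> nodal_basis \<Omega> (cells m) (nodes m) (hat m)}"

text \<open>The gradient of a piecewise linear function exists off a null set, where its value is
  irrelevant for the integrals below (the measure is complete).\<close>

definition grad :: "('a::euclidean_space \<Rightarrow> real) \<Rightarrow> 'a \<Rightarrow> 'a" where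
  "grad v x = (THE D. GDERIV v x :> D)"

definition mass_matrix :: "'a::euclidean_space set \<Rightarrow> 'a fe_mesh \<Rightarrow> real mat" where
  "mass_matrix \<Omega> m = Matrix.mat (num_dofs m) (num_dofs m)
     (\<lambda>(l, k). LINT x|lebesgue_on \<Omega>. hat m k x * hat m l x)"

definition stiffness_matrix :: "'a::euclidean_space set \<Rightarrow> 'a fe_mesh \<Rightarrow> real mat" where
  "stiffness_matrix \<Omega> m = Matrix.mat (num_dofs m) (num_dofs m)
     (\<lambda>(l, k). LINT x|lebesgue_on \<Omega>. inner (grad (hat m k) x) (grad (hat m l) x))"

section \<open>Block matrices and spectral equivalence\<close>

definition diag_part :: "real mat \<Rightarrow> real mat" where
  "diag_part A = mat_diag (dim_row A) (\<lambda>i. A $$ (i, i))"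

definition block_diag :: "real mat \<Rightarrow> real mat \<Rightarrow> real mat" where
  "block_diag A B =
     four_block_mat A (0\<^sub>m (dim_row A) (dim_col B)) (0\<^sub>m (dim_row B) (dim_col A)) B"

definition system_matrix :: "real \<Rightarrow> real mat \<Rightarrow> real mat \<Rightarrow> real mat" where
  "system_matrix \<rho> M K = four_block_mat M K K (- (1 / \<rho>) \<cdot>\<^sub>m M)"

definition system_rhs :: "real vec \<Rightarrow> real vec" where
  "system_rhs f = f @\<^sub>v 0\<^sub>v (dim_vec f)"

definition precond :: "real \<Rightarrow> real mat \<Rightarrow> real mat \<Rightarrow> real mat" where
  "precond \<rho> M K = block_diag (M + sqrt \<rho> \<cdot>\<^sub>m K) ((1 / \<rho>) \<cdot>\<^sub>m (M + sqrt \<rho> \<cdot>\<^sub>m K))"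

definition diag_precond :: "real \<Rightarrow> real mat \<Rightarrow> real mat" where
  "diag_precond h M = block_diag (diag_part M) ((1 / h ^ 4) \<cdot>\<^sub>m diag_part M)"

definition spd_mat :: "real mat \<Rightarrow> bool" where
  "spd_mat A \<longleftrightarrow> A \<in> carrier_mat (dim_row A) (dim_row A) \<and> transpose_mat A = A \<and>
     (\<forall>v\<in>carrier_vec (dim_row A). v \<noteq> 0\<^sub>v (dim_row A) \<longrightarrow> scalar_prod (A *\<^sub>v v) v > 0)"

definition spectrally_equivalent :: "'i set \<Rightarrow> ('i \<Rightarrow> real mat) \<Rightarrow> ('i \<Rightarrow> real mat) \<Rightarrow> bool" where
  "spectrally_equivalent I P Q \<longleftrightarrow>
     (\<forall>i\<in>I. spd_mat (P i) \<and> spd_mat (Q i) \<and> dim_row (P i) = dim_row (Q i)) \<and>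
     (\<exists>c\<^sub>1 c\<^sub>2. 0 < c\<^sub>1 \<and> c\<^sub>1 \<le> c\<^sub>2 \<and>
        (\<forall>i\<in>I. \<forall>v\<in>carrier_vec (dim_row (Q i)).
           c\<^sub>1 * scalar_prod (Q i *\<^sub>v v) v \<le> scalar_prod (P i *\<^sub>v v) v \<and>
           scalar_prod (P i *\<^sub>v v) v \<le> c\<^sub>2 * scalar_prod (Q i *\<^sub>v v) v))"

section \<open>Preconditioned MINRES\<close>

definition inv_mat :: "real mat \<Rightarrow> real mat" where
  "inv_mat P = the (mat_inverse P)"

definition inv_norm :: "real mat \<Rightarrow> real vec \<Rightarrow> real" where
  "inv_norm P r = sqrt (scalar_prod (inv_mat P *\<^sub>v r) r)"

definition krylov_space :: "real mat \<Rightarrow> real vec \<Rightarrow> nat \<Rightarrow> real vec set" where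
  "krylov_space B z n =
     LinearCombinations.module.span class_ring (module_vec TYPE(real) (dim_vec z))
       {(B ^\<^sub>m j) *\<^sub>v z |j. j < n}"

definition minres :: "real mat \<Rightarrow> real mat \<Rightarrow> real vec \<Rightarrow> real vec \<Rightarrow> nat \<Rightarrow> real vec" where
  "minres P A b x\<^sub>0 n = arg_min (\<lambda>x. inv_norm P (b - A *\<^sub>v x))
     (\<lambda>x. \<exists>y\<in>krylov_space (inv_mat P * A) (inv_mat P *\<^sub>v (b - A *\<^sub>v x\<^sub>0)) n. x = x\<^sub>0 + y)"

definition minres_residual :: "real mat \<Rightarrow> real mat \<Rightarrow> real vec \<Rightarrow> real vec \<Rightarrow> nat \<Rightarrow> real" where
  "minres_residual P A b x\<^sub>0 n = inv_norm P (b - A *\<^sub>v minres P A b x\<^sub>0 n)"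

section \<open>Counting arithmetical operations\<close>

text \<open>Straight-line programs over the reals. The memory initially holds the input, each instruction
  appends one number to it, and the cost is the number of instructions. There are no free
  constants. \<open>Choose i j k\<close> copies entry \<open>j\<close> if entry \<open>i\<close> is at most zero and entry \<open>k\<close> otherwise.
  Division by zero and access outside the memory abort the computation.\<close>

datatype instr = Add nat nat | Sub nat nat | Mul nat nat | Div nat nat | Choose nat nat nat

definition entry :: "real list \<Rightarrow> nat \<Rightarrow> real option" where
  "entry s i = (if i < length s then Some (s ! i) else None)"

fun step :: "real list \<Rightarrow> instr \<Rightarrow> real option" where
  "step s (Add i j) =
     (case (entry s i, entry s j) of (Some x, Some y) \<Rightarrow> Some (x + y) | _ \<Rightarrow> None)"
| "step s (Sub i j) =
     (case (entry s i, entry s j) of (Some x, Some y) \<Rightarrow> Some (x - y) | _ \<Rightarrow> None)"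
| "step s (Mul i j) =
     (case (entry s i, entry s j) of (Some x, Some y) \<Rightarrow> Some (x * y) | _ \<Rightarrow> None)"
| "step s (Div i j) =
     (case (entry s i, entry s j) of
        (Some x, Some y) \<Rightarrow> if y = 0 then None else Some (x / y) | _ \<Rightarrow> None)"
| "step s (Choose i j k) =
     (case (entry s i, entry s j, entry s k) of
        (Some x, Some y, Some z) \<Rightarrow> Some (if x \<le> 0 then y else z) | _ \<Rightarrow> None)"

fun run :: "real list \<Rightarrow> instr list \<Rightarrow> real list option" where
  "run s [] = Some s"
| "run s (c # cs) = (case step s c of None \<Rightarrow> None | Some x \<Rightarrow> run (s @ [x]) cs)"

text \<open>The program computes \<open>X 0, \<dots>, X n\<close>; the entries of \<open>X k\<close> are found at the memory positions
  listed in \<open>outs k\<close>.\<close>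

definition computes ::
    "instr list \<Rightarrow> (nat \<Rightarrow> nat list) \<Rightarrow> real list \<Rightarrow> nat \<Rightarrow> (nat \<Rightarrow> real vec) \<Rightarrow> bool" where
  "computes prog outs inp n X \<longleftrightarrow>
     (\<exists>s. run inp prog = Some s \<and>
        (\<forall>k\<le>n. map (entry s) (outs k) = map Some (list_of_vec (X k))))"

definition system_input ::
    "real \<Rightarrow> real mat \<Rightarrow> real mat \<Rightarrow> real vec \<Rightarrow> real vec \<Rightarrow> real list" where
  "system_input h M K f x\<^sub>0 =
     concat (mat_to_list M) @ concat (mat_to_list K) @ [h] @ list_of_vec f @ list_of_vec x\<^sub>0"

section \<open>The family of discrete systems\<close>

definition sys :: "'a::euclidean_space set \<Rightarrow> 'a fe_mesh \<Rightarrow> real mat" where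
  "sys \<Omega> m = system_matrix (mesh_size m ^ 4) (mass_matrix \<Omega> m) (stiffness_matrix \<Omega> m)"

definition P_full :: "'a::euclidean_space set \<Rightarrow> 'a fe_mesh \<Rightarrow> real mat" where
  "P_full \<Omega> m = precond (mesh_size m ^ 4) (mass_matrix \<Omega> m) (stiffness_matrix \<Omega> m)"

definition P_diag :: "'a::euclidean_space set \<Rightarrow> 'a fe_mesh \<Rightarrow> real mat" where
  "P_diag \<Omega> m = diag_precond (mesh_size m) (mass_matrix \<Omega> m)"

end

(* The mass matrix, the scaled stiffness matrix h^2 K and diag(M) are compared cell by cell: on a
   simplex T all three forms are equivalent to |T| times the sum of the squared nodal values. The
   lower bound for the mass form comes from shrinking T by the factor 4 towards a maximum point of
   |v|, which keeps |v| above half its maximum; the inverse inequality comes from the ball inscribed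
   in T. After scaling by P_diag, the system is therefore bounded, and testing with (u, -p) bounds it
   from below. The MINRES residual is at most that of a gradient step for the squared operator, which
   contracts every second step. For the operation count, MINRES is realised by three-term recurrences
   for search directions whose images are orthogonal (Orthodir); they never break down for indefinite
   systems until the Krylov space is exhausted, and then every quantity vanishes. *)

theory Submission
  imports Defs
begin

unbundle no vec_syntax and no inner_syntax

section \<open>Costs of straight-line programs\<close>

text \<open>The choice of rho as \<open>h ^ 4\<close> turns sqrt(rho) K into h^2 K, exactly the
  scale at which the inverse inequality bounds stiffness by mass; this is why diag(M) alone controls
  both preconditioners. The weight h^-4 of the second block splits into weights h^2 and h^-2 that
  balance the two couplings through K. Two obstacles shape the operation count. First,
  \<open>minres\<close> is an arbitrary minimiser over the Krylov space, so the program has to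
  reproduce that very vector, and uniqueness has to be proved. Second, a straight-line program
  cannot stop early: its length is fixed before the right-hand side and the initial guess are known,
  while the index at which the Krylov space is exhausted depends on them. The recurrences are
  therefore read with x / 0 = 0, under which they stay valid identities. They are short because P^-1
  A is self-adjoint for the inner product (A u, P^-1 A v), so each step costs a multiple of the
  number of unknowns plus the number of nonzero entries of A. The latter is bounded by packing
  inscribed balls around a node.\<close>

lemma run_append:
  "run s (xs @ ys) = (case run s xs of None \<Rightarrow> None | Some t \<Rightarrow> run t ys)"
  by (induction xs arbitrary: s) (auto split: option.splits)

text \<open>The elements of \<open>V\<close> are intermediate results as functions of the input index \<open>i\<close>; each has a
  memory position that does not depend on \<open>i\<close>. Positions themselves need not be tracked, since
  memory only grows.\<close>

definition slp :: "'i set \<Rightarrow> ('i \<Rightarrow> real list) \<Rightarrow> nat \<Rightarrow> ('i \<Rightarrow> real) set \<Rightarrow> bool" where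
  "slp I inp c V \<longleftrightarrow>
     (\<exists>prog L s. length prog \<le> c \<and> (\<forall>i\<in>I. run (inp i) prog = Some (s i) \<and> length (s i) = L) \<and>
        (\<forall>v\<in>V. \<exists>p<L. \<forall>i\<in>I. s i ! p = v i))"

text \<open>A relative notion of cost: since the available values \<open>U\<close> and the cost so
  far are universally quantified, costs add under composition and nothing computed earlier is
  lost.\<close>

definition gets :: "'i set \<Rightarrow> ('i \<Rightarrow> real) set \<Rightarrow> nat \<Rightarrow> ('i \<Rightarrow> real) set \<Rightarrow> bool" where
  "gets I V k W \<longleftrightarrow> (\<forall>inp c U. V \<subseteq> U \<longrightarrow> slp I inp c U \<longrightarrow> slp I inp (c + k) (U \<union> W))"

lemma slp_mono: "slp I inp c V \<Longrightarrow> c \<le> c' \<Longrightarrow> V' \<subseteq> V \<Longrightarrow> slp I inp c' V'"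
proof -
  assume "slp I inp c V" and le: "c \<le> c'" "V' \<subseteq> V"
  then obtain prog L s where "length prog \<le> c"
    "\<forall>i\<in>I. run (inp i) prog = Some (s i) \<and> length (s i) = L"
    "\<forall>v\<in>V. \<exists>p<L. \<forall>i\<in>I. s i ! p = v i"
    unfolding slp_def by blast
  with le show ?thesis
    unfolding slp_def by (intro exI[of _ prog] exI[of _ L] exI[of _ s]) auto
qed

text \<open>One program serves all of \<open>I\<close>, so the instruction has to be chosen before
  the input \<open>i\<close>. Its result lands at position \<open>L\<close>, which is common to all
  inputs because their memories have equal length.\<close>

lemma slp_instr:
  assumes "slp I inp c V"
    and "\<And>s L. \<forall>i\<in>I. length (s i) = L \<Longrightarrow> \<forall>v\<in>V. \<exists>p<L. \<forall>i\<in>I. s i ! p = v i \<Longrightarrow>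
           \<exists>ins. \<forall>i\<in>I. step (s i) ins = Some (w i)"
  shows "slp I inp (Suc c) (insert w V)"
proof -
  from assms(1) obtain prog L s where prog: "length prog \<le> c"
    "\<forall>i\<in>I. run (inp i) prog = Some (s i) \<and> length (s i) = L"
    and V: "\<forall>v\<in>V. \<exists>p<L. \<forall>i\<in>I. s i ! p = v i"
    unfolding slp_def by blast
  obtain ins where ins: "\<forall>i\<in>I. step (s i) ins = Some (w i)"
    using assms(2)[of s L] prog V by blast
  let ?s = "\<lambda>i. s i @ [w i]"
  have "\<forall>i\<in>I. run (inp i) (prog @ [ins]) = Some (?s i) \<and> length (?s i) = Suc L"
    using prog ins by (simp add: run_append)
  moreover have "\<exists>p<Suc L. \<forall>i\<in>I. ?s i ! p = v i" if v: "v \<in> insert w V" for v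
  proof (cases "v = w")
    case True
    then show ?thesis using prog(2) by (intro exI[of _ L]) (auto simp: nth_append)
  next
    case False
    with v V obtain p where "p < L" "\<forall>i\<in>I. s i ! p = v i" by blast
    then show ?thesis using prog(2) by (intro exI[of _ p]) (auto simp: nth_append)
  qed
  moreover have "length (prog @ [ins]) \<le> Suc c"
    using prog(1) by simp
  ultimately show ?thesis
    unfolding slp_def by (intro exI[of _ "prog @ [ins]"] exI[of _ "Suc L"] exI[of _ ?s]) blast
qed

lemma gets_instr:
  assumes "\<And>s L. \<forall>i\<in>I. length (s i) = L \<Longrightarrow> \<forall>v\<in>V. \<exists>p<L. \<forall>i\<in>I. s i ! p = v i \<Longrightarrow>
           \<exists>ins. \<forall>i\<in>I. step (s i) ins = Some (w i)"
  shows "gets I V 1 {w}"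
  unfolding gets_def
proof (intro allI impI)
  fix inp c U
  assume "V \<subseteq> U" "slp I inp c U"
  then have "slp I inp (Suc c) (insert w U)"
    by (intro slp_instr) (use assms in blast)+
  then show "slp I inp (c + 1) (U \<union> {w})" by simp
qed

lemma gets_add:
  assumes u: "u \<in> V" and v: "v \<in> V"
  shows "gets I V 1 {\<lambda>i. u i + v i}"
proof (rule gets_instr, goal_cases)
  case (1 s L)
  from u 1(2) obtain p where p: "p < L" "\<forall>i\<in>I. s i ! p = u i" by blast
  from v 1(2) obtain q where q: "q < L" "\<forall>i\<in>I. s i ! q = v i" by blast
  from 1(1) p q show ?case by (intro exI[of _ "Add p q"]) (simp add: entry_def)
qed

lemma gets_diff:
  assumes u: "u \<in> V" and v: "v \<in> V"
  shows "gets I V 1 {\<lambda>i. u i - v i}"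
proof (rule gets_instr, goal_cases)
  case (1 s L)
  from u 1(2) obtain p where p: "p < L" "\<forall>i\<in>I. s i ! p = u i" by blast
  from v 1(2) obtain q where q: "q < L" "\<forall>i\<in>I. s i ! q = v i" by blast
  from 1(1) p q show ?case by (intro exI[of _ "Sub p q"]) (simp add: entry_def)
qed

lemma gets_mult:
  assumes u: "u \<in> V" and v: "v \<in> V"
  shows "gets I V 1 {\<lambda>i. u i * v i}"
proof (rule gets_instr, goal_cases)
  case (1 s L)
  from u 1(2) obtain p where p: "p < L" "\<forall>i\<in>I. s i ! p = u i" by blast
  from v 1(2) obtain q where q: "q < L" "\<forall>i\<in>I. s i ! q = v i" by blast
  from 1(1) p q show ?case by (intro exI[of _ "Mul p q"]) (simp add: entry_def)
qed

lemma gets_divide: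
  assumes u: "u \<in> V" and v: "v \<in> V" and nz: "\<And>i. i \<in> I \<Longrightarrow> v i \<noteq> 0"
  shows "gets I V 1 {\<lambda>i. u i / v i}"
proof (rule gets_instr, goal_cases)
  case (1 s L)
  from u 1(2) obtain p where p: "p < L" "\<forall>i\<in>I. s i ! p = u i" by blast
  from v 1(2) obtain q where q: "q < L" "\<forall>i\<in>I. s i ! q = v i" by blast
  from 1(1) p q nz show ?case by (intro exI[of _ "Div p q"]) (simp add: entry_def)
qed

lemma gets_choose:
  assumes u: "u \<in> V" and v: "v \<in> V" and w: "w \<in> V"
  shows "gets I V 1 {\<lambda>i. if u i \<le> 0 then v i else w i}"
proof (rule gets_instr, goal_cases)
  case (1 s L)
  from u 1(2) obtain p where p: "p < L" "\<forall>i\<in>I. s i ! p = u i" by blast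
  from v 1(2) obtain q where q: "q < L" "\<forall>i\<in>I. s i ! q = v i" by blast
  from w 1(2) obtain r where r: "r < L" "\<forall>i\<in>I. s i ! r = w i" by blast
  from 1(1) p q r show ?case by (intro exI[of _ "Choose p q r"]) (simp add: entry_def)
qed

lemma gets_mono: "gets I V k W \<Longrightarrow> V \<subseteq> V' \<Longrightarrow> k \<le> k' \<Longrightarrow> W' \<subseteq> W \<Longrightarrow> gets I V' k' W'"
  unfolding gets_def
proof (intro allI impI, goal_cases)
  case (1 inp c U)
  then have "slp I inp (c + k) (U \<union> W)" by blast
  then show ?case by (rule slp_mono) (use 1 in auto)
qed

lemma gets_refl: "W \<subseteq> V \<Longrightarrow> gets I V 0 W"
  unfolding gets_def by (simp add: sup.absorb1)

lemma gets_trans: "gets I V k W \<Longrightarrow> gets I W l X \<Longrightarrow> gets I V (k + l) X"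
  unfolding gets_def
proof (intro allI impI, goal_cases)
  case (1 inp c U)
  then have "slp I inp (c + k) (U \<union> W)" by blast
  then have "slp I inp (c + k + l) (U \<union> W \<union> X)" using 1 by blast
  then show ?case by (rule slp_mono) auto
qed

lemma gets_keep: "gets I V k W \<Longrightarrow> gets I V k (V \<union> W)"
  unfolding gets_def by (metis Un_assoc sup.absorb1)

text \<open>Membership in \<open>V\<close> is equality of functions on the whole index type, whereas
  identities that need carrier assumptions hold only on \<open>I\<close>. This lemma transfers such
  identities at no cost.\<close>

lemma gets_cong:
  assumes "gets I V k W" and "\<And>w'. w' \<in> W' \<Longrightarrow> \<exists>w\<in>W. \<forall>i\<in>I. w' i = w i"
  shows "gets I V k W'"
  unfolding gets_def
proof (intro allI impI)
  fix inp c U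
  assume "V \<subseteq> U" "slp I inp c U"
  then have "slp I inp (c + k) (U \<union> W)" using assms(1) unfolding gets_def by blast
  then obtain prog L s where *: "length prog \<le> c + k"
    "\<forall>i\<in>I. run (inp i) prog = Some (s i) \<and> length (s i) = L"
    and V: "\<forall>v\<in>U \<union> W. \<exists>p<L. \<forall>i\<in>I. s i ! p = v i"
    unfolding slp_def by blast
  have "\<exists>p<L. \<forall>i\<in>I. s i ! p = v i" if v: "v \<in> U \<union> W'" for v
  proof (cases "v \<in> U")
    case False
    then obtain w where w: "w \<in> W" "\<forall>i\<in>I. v i = w i" using assms(2)[of v] v by blast
    then obtain p where "p < L" "\<forall>i\<in>I. s i ! p = w i" using V by blast
    with w(2) show ?thesis by (intro exI[of _ p]) simp
  qed (use V in blast)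
  then show "slp I inp (c + k) (U \<union> W')"
    unfolding slp_def using * by (intro exI[of _ prog] exI[of _ L] exI[of _ s]) blast
qed

lemma gets_cong_single:
  assumes "gets I V k {w}" "k \<le> k'" "\<And>i. i \<in> I \<Longrightarrow> w' i = w i"
  shows "gets I V k' {w'}"
proof -
  have "gets I V k {w'}"
    by (rule gets_cong[OF assms(1)]) (use assms(3) in auto)
  then show ?thesis
    by (rule gets_mono) (use assms(2) in auto)
qed

lemma gets_Un:
  assumes "gets I V k W" and "gets I V l X"
  shows "gets I V (k + l) (W \<union> X)"
  unfolding gets_def
proof (intro allI impI)
  fix inp c U
  assume U: "V \<subseteq> U" "slp I inp c U"
  then have "slp I inp (c + k) (U \<union> W)" using assms(1) unfolding gets_def by blast
  moreover have "V \<subseteq> U \<union> W" using U by blast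
  ultimately have "slp I inp (c + k + l) (U \<union> W \<union> X)" using assms(2) unfolding gets_def by blast
  then show "slp I inp (c + (k + l)) (U \<union> (W \<union> X))" by (rule slp_mono) auto
qed

lemma gets_UN:
  assumes "finite J" and "\<And>j. j \<in> J \<Longrightarrow> gets I V (k j) (W j)"
  shows "gets I V (sum k J) (\<Union>j\<in>J. W j)"
  using assms
proof (induction J)
  case empty
  show ?case by (simp add: gets_refl)
next
  case (insert j J)
  then show ?case by (simp add: gets_Un)
qed

text \<open>Accumulation starts from the stored zero, so every summand costs one addition; the empty
  sum is that zero itself.\<close>

lemma gets_sum:
  assumes "finite S" and "(\<lambda>i. 0) \<in> V" and "\<And>j. j \<in> S \<Longrightarrow> f j \<in> V"
  shows "gets I V (card S) {\<lambda>i. \<Sum>j\<in>S. f j i}"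
  using assms(1,3)
proof (induction S)
  case empty
  show ?case using assms(2) by (simp add: gets_refl)
next
  case (insert j S)
  let ?t = "\<lambda>i. \<Sum>j\<in>S. f j i"
  have "gets I V (card S) (V \<union> {?t})"
    using insert by (intro gets_keep) blast
  moreover have "gets I (V \<union> {?t}) 1 {\<lambda>i. f j i + ?t i}"
    by (rule gets_add) (use insert in auto)
  ultimately have "gets I V (card S + 1) {\<lambda>i. f j i + ?t i}"
    by (rule gets_trans)
  then show ?case using insert.hyps by simp
qed

lemma gets_sum_mult:
  assumes "finite S" and "(\<lambda>i. 0) \<in> V" and "\<And>j. j \<in> S \<Longrightarrow> f j \<in> V" "\<And>j. j \<in> S \<Longrightarrow> g j \<in> V"
  shows "gets I V (2 * card S) {\<lambda>i. \<Sum>j\<in>S. f j i * g j i}"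
proof -
  let ?W = "\<Union>j\<in>S. {\<lambda>i. f j i * g j i}"
  have "gets I V (\<Sum>j\<in>S. 1) ?W"
  proof (rule gets_UN[OF assms(1)])
    fix j assume "j \<in> S"
    then show "gets I V 1 {\<lambda>i. f j i * g j i}"
      using assms(3,4) by (intro gets_mult)
  qed
  from gets_keep[OF this] have "gets I V (card S) (V \<union> ?W)"
    by simp
  moreover have "gets I (V \<union> ?W) (card S) {\<lambda>i. \<Sum>j\<in>S. f j i * g j i}"
    by (rule gets_sum) (use assms in auto)
  ultimately have "gets I V (card S + card S) {\<lambda>i. \<Sum>j\<in>S. f j i * g j i}"
    by (rule gets_trans)
  then show ?thesis by (simp add: mult_2)
qed

text \<open>The result follows the convention \<open>x / 0 = 0\<close> although the machine aborts on division by zero.\<close>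

lemma gets_safe_divide:
  assumes "u \<in> V" "v \<in> V" "(\<lambda>i. 0) \<in> V" "(\<lambda>i. 1) \<in> V" "\<And>i. i \<in> I \<Longrightarrow> 0 \<le> v i"
  shows "gets I V 3 {\<lambda>i. u i / v i}"
proof -
  \<comment> \<open>Zero denominators become 1 before the division, so the machine does not abort;
    the last \<open>Choose\<close> then replaces the meaningless quotient by 0. Nonnegativity makes
    the test \<open>v i \<le> 0\<close> a test for zero.\<close>
  let ?d = "\<lambda>i. if v i \<le> 0 then 1 else v i"
  let ?q = "\<lambda>i. u i / ?d i"
  have "gets I V 1 (V \<union> {?d})"
    by (rule gets_keep, rule gets_choose) (use assms in auto)
  moreover have "gets I (V \<union> {?d}) 1 ((V \<union> {?d}) \<union> {?q})"
    by (rule gets_keep, rule gets_divide) (use assms in auto)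
  moreover have "gets I ((V \<union> {?d}) \<union> {?q}) 1 {\<lambda>i. if v i \<le> 0 then (\<lambda>i. 0) i else ?q i}"
    by (rule gets_choose) (use assms in auto)
  ultimately have "gets I V (1 + 1 + 1) {\<lambda>i. if v i \<le> 0 then 0 else ?q i}"
    by (rule gets_trans[OF gets_trans])
  then show ?thesis
    by (rule gets_cong_single) (use assms(5) in \<open>auto simp: antisym\<close>)
qed

section \<open>Costs of vector and sparse matrix operations\<close>

definition comps :: "nat \<Rightarrow> ('i \<Rightarrow> real vec) \<Rightarrow> ('i \<Rightarrow> real) set" where
  "comps n X = (\<Union>j\<in>{..<n}. {\<lambda>i. X i $ j})"

lemma comps_subsetD: "comps n X \<subseteq> V \<Longrightarrow> j < n \<Longrightarrow> (\<lambda>i. X i $ j) \<in> V"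
  by (auto simp: comps_def)

lemma gets_comps:
  assumes "\<And>j. j < n \<Longrightarrow> gets I V k {\<lambda>i. X i $ j}"
  shows "gets I V (n * k) (comps n X)"
proof -
  have "gets I V (\<Sum>j<n. k) (comps n X)"
    unfolding comps_def by (rule gets_UN) (use assms in auto)
  then show ?thesis by simp
qed

definition nnz :: "real mat \<Rightarrow> nat" where
  "nnz A = (\<Sum>l<dim_row A. card {k. k < dim_col A \<and> A $$ (l, k) \<noteq> 0})"

text \<open>The matrix does not vary with the input index, so the program may be tailored to its
  sparsity pattern: only nonzero entries are touched, each by one multiplication and one
  addition.\<close>

lemma gets_mult_mat_vec:
  assumes A: "A \<in> carrier_mat n n" and zero: "(\<lambda>i. 0) \<in> V"
    and ent: "\<And>l k. l < n \<Longrightarrow> k < n \<Longrightarrow> A $$ (l, k) \<noteq> 0 \<Longrightarrow> (\<lambda>i. A $$ (l, k)) \<in> V"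
    and X: "comps n X \<subseteq> V" "\<And>i. i \<in> I \<Longrightarrow> X i \<in> carrier_vec n"
  shows "gets I V (2 * nnz A) (comps n (\<lambda>i. A *\<^sub>v X i))"
proof -
  define S where "S l = {k. k < n \<and> A $$ (l, k) \<noteq> 0}" for l
  have fin: "finite (S l)" for l by (simp add: S_def)
  have "gets I V (\<Sum>l<n. 2 * card (S l)) (\<Union>l\<in>{..<n}. {\<lambda>i. (A *\<^sub>v X i) $ l})"
  proof (rule gets_UN)
    fix l assume "l \<in> {..<n}"
    then have l: "l < n" by simp
    have "gets I V (2 * card (S l)) {\<lambda>i. \<Sum>k\<in>S l. (\<lambda>i. A $$ (l, k)) i * (\<lambda>i. X i $ k) i}"
      by (rule gets_sum_mult) (use fin zero ent l comps_subsetD[OF X(1)] in \<open>auto simp: S_def\<close>)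
    then show "gets I V (2 * card (S l)) {\<lambda>i. (A *\<^sub>v X i) $ l}"
    proof (rule gets_cong_single[OF _ order_refl])
      fix i assume "i \<in> I"
      then have "X i \<in> carrier_vec n" using X by blast
      then have "(A *\<^sub>v X i) $ l = (\<Sum>k<n. A $$ (l, k) * X i $ k)"
        using A l by (auto simp: scalar_prod_def atLeast0LessThan)
      also have "\<dots> = (\<Sum>k\<in>S l. A $$ (l, k) * X i $ k)"
        by (intro sum.mono_neutral_right) (auto simp: S_def)
      finally show "(A *\<^sub>v X i) $ l = (\<Sum>k\<in>S l. (\<lambda>i. A $$ (l, k)) i * (\<lambda>i. X i $ k) i)" .
    qed
  qed simp
  then show ?thesis
    using A by (simp add: comps_def nnz_def S_def sum_distrib_left)
qed

lemma gets_scalar_prod: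
  assumes "(\<lambda>i. 0) \<in> V" "comps n X \<subseteq> V" "comps n Y \<subseteq> V" "\<And>i. i \<in> I \<Longrightarrow> Y i \<in> carrier_vec n"
  shows "gets I V (2 * n) {\<lambda>i. X i \<bullet> Y i}"
proof -
  have "gets I V (2 * card {..<n}) {\<lambda>i. \<Sum>k<n. (\<lambda>i. X i $ k) i * (\<lambda>i. Y i $ k) i}"
    by (rule gets_sum_mult) (use assms(1) comps_subsetD[OF assms(2)] comps_subsetD[OF assms(3)] in auto)
  then show ?thesis
  proof (rule gets_cong_single)
    fix i assume "i \<in> I"
    then have "dim_vec (Y i) = n" using assms(4) by auto
    then show "X i \<bullet> Y i = (\<Sum>k<n. (\<lambda>i. X i $ k) i * (\<lambda>i. Y i $ k) i)"
      by (simp add: scalar_prod_def atLeast0LessThan)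
  qed simp
qed

lemma gets_add_smult:
  assumes "comps n X \<subseteq> V" "comps n Y \<subseteq> V" "a \<in> V"
    and "\<And>i. i \<in> I \<Longrightarrow> X i \<in> carrier_vec n" "\<And>i. i \<in> I \<Longrightarrow> Y i \<in> carrier_vec n"
  shows "gets I V (n * 2) (comps n (\<lambda>i. X i + a i \<cdot>\<^sub>v Y i))"
proof (rule gets_comps)
  fix j assume j: "j < n"
  let ?t = "\<lambda>i. a i * Y i $ j"
  have "gets I V 1 (V \<union> {?t})"
    by (rule gets_keep, rule gets_mult) (use assms(3) comps_subsetD[OF assms(2) j] in auto)
  moreover have "gets I (V \<union> {?t}) 1 {\<lambda>i. X i $ j + ?t i}"
    by (rule gets_add) (use comps_subsetD[OF assms(1) j] in auto)
  ultimately have "gets I V (1 + 1) {\<lambda>i. X i $ j + ?t i}"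
    by (rule gets_trans)
  then show "gets I V 2 {\<lambda>i. (X i + a i \<cdot>\<^sub>v Y i) $ j}"
    by (rule gets_cong_single) (use carrier_vecD[OF assms(4)] carrier_vecD[OF assms(5)] j in auto)
qed

lemma gets_diff_smult:
  assumes "comps n X \<subseteq> V" "comps n Y \<subseteq> V" "a \<in> V"
    and "\<And>i. i \<in> I \<Longrightarrow> X i \<in> carrier_vec n" "\<And>i. i \<in> I \<Longrightarrow> Y i \<in> carrier_vec n"
  shows "gets I V (n * 2) (comps n (\<lambda>i. X i - a i \<cdot>\<^sub>v Y i))"
proof (rule gets_comps)
  fix j assume j: "j < n"
  let ?t = "\<lambda>i. a i * Y i $ j"
  have "gets I V 1 (V \<union> {?t})"
    by (rule gets_keep, rule gets_mult) (use assms(3) comps_subsetD[OF assms(2) j] in auto)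
  moreover have "gets I (V \<union> {?t}) 1 {\<lambda>i. X i $ j - ?t i}"
    by (rule gets_diff) (use comps_subsetD[OF assms(1) j] in auto)
  ultimately have "gets I V (1 + 1) {\<lambda>i. X i $ j - ?t i}"
    by (rule gets_trans)
  then show "gets I V 2 {\<lambda>i. (X i - a i \<cdot>\<^sub>v Y i) $ j}"
    by (rule gets_cong_single) (use carrier_vecD[OF assms(4)] carrier_vecD[OF assms(5)] j in auto)
qed

lemma computesI:
  assumes "slp I inp c V" and "\<And>k. k \<le> n \<Longrightarrow> comps d (X k) \<subseteq> V"
    and "\<And>i k. i \<in> I \<Longrightarrow> k \<le> n \<Longrightarrow> X k i \<in> carrier_vec d"
  shows "\<exists>prog outs. length prog \<le> c \<and> (\<forall>i\<in>I. computes prog outs (inp i) n (\<lambda>k. X k i))"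
proof -
  from assms(1) obtain prog L s where prog: "length prog \<le> c"
    and run: "\<And>i. i \<in> I \<Longrightarrow> run (inp i) prog = Some (s i)" "\<And>i. i \<in> I \<Longrightarrow> length (s i) = L"
    and V: "\<forall>v\<in>V. \<exists>p<L. \<forall>i\<in>I. s i ! p = v i"
    unfolding slp_def by blast
  have "\<exists>p<L. \<forall>i\<in>I. s i ! p = X k i $ j" if "k \<le> n" "j < d" for k j
    using bspec[OF V comps_subsetD[OF assms(2)[OF that(1)] that(2)]] by simp
  then obtain pos where pos: "\<And>k j. k \<le> n \<Longrightarrow> j < d \<Longrightarrow> pos k j < L"
    "\<And>k j i. k \<le> n \<Longrightarrow> j < d \<Longrightarrow> i \<in> I \<Longrightarrow> s i ! pos k j = X k i $ j"
    by metis
  define outs where "outs k = map (pos k) [0..<d]" for k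
  have "computes prog outs (inp i) n (\<lambda>k. X k i)" if "i \<in> I" for i
    unfolding computes_def
  proof (intro exI[of _ "s i"] conjI allI impI)
    fix k assume "k \<le> n"
    then show "map (entry (s i)) (outs k) = map Some (list_of_vec (X k i))"
      using carrier_vecD[OF assms(3)[OF that]] pos run(2)[OF that] that
      by (intro nth_equalityI) (auto simp: outs_def entry_def list_of_vec_index)
  qed (use run that in auto)
  with prog show ?thesis by blast
qed

section \<open>MINRES as an orthogonalised direction method\<close>

text \<open>An elementary form of subspace, for which the Krylov space is the least closed set
  containing its generators. Statements about all its elements are then proved by exhibiting a
  closed set, without handling linear combinations.\<close>

definition lin_closed :: "nat \<Rightarrow> real vec set \<Rightarrow> bool" where
  "lin_closed n W \<longleftrightarrow> W \<subseteq> carrier_vec n \<and> 0\<^sub>v n \<in> W \<and>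
     (\<forall>u\<in>W. \<forall>v\<in>W. u + v \<in> W) \<and> (\<forall>c. \<forall>v\<in>W. c \<cdot>\<^sub>v v \<in> W)"

lemma lin_closed_minus:
  assumes "lin_closed n W" "u \<in> W" "v \<in> W"
  shows "u - v \<in> W"
proof -
  have "u - v = u + (-1) \<cdot>\<^sub>v v"
    using assms unfolding lin_closed_def by (intro eq_vecI) auto
  then show ?thesis using assms unfolding lin_closed_def by auto
qed

lemma krylov_space_props:
  assumes B: "B \<in> carrier_mat n n" and z: "z \<in> carrier_vec n"
  shows lin_closed_krylov_space: "lin_closed n (krylov_space B z m)"
    and krylov_space_generator: "j < m \<Longrightarrow> (B ^\<^sub>m j) *\<^sub>v z \<in> krylov_space B z m"
    and krylov_space_least: "lin_closed n W \<Longrightarrow> (\<And>j. j < m \<Longrightarrow> (B ^\<^sub>m j) *\<^sub>v z \<in> W) \<Longrightarrow>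
      krylov_space B z m \<subseteq> W"
proof -
  interpret vec_module "TYPE(real)" n .
  let ?G = "{(B ^\<^sub>m j) *\<^sub>v z |j. j < m}"
  have K: "krylov_space B z m = span ?G"
    using z by (simp add: krylov_space_def)
  have G: "?G \<subseteq> carrier_vec n"
    using B z by (auto intro!: mult_mat_vec_carrier pow_carrier_mat)
  have "submodule class_ring (span ?G) V"
    using G by (rule span_is_submodule)
  then interpret S: submodule class_ring "span ?G" V .
  show "lin_closed n (krylov_space B z m)"
    unfolding K lin_closed_def
    using S.subset S.zero_closed S.m_closed S.smult_closed
    by (auto simp: module_vec_simps)
  show "(B ^\<^sub>m j) *\<^sub>v z \<in> krylov_space B z m" if "j < m"
    unfolding K by (rule set_mp[OF in_own_span[OF G]]) (use that in auto)
  show "krylov_space B z m \<subseteq> W" if W: "lin_closed n W" "\<And>j. j < m \<Longrightarrow> (B ^\<^sub>m j) *\<^sub>v z \<in> W"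
    unfolding K
  proof (rule span_is_subset)
    show "?G \<subseteq> W" using W by auto
    show "submodule class_ring W V"
      using W(1) unfolding lin_closed_def
      by unfold_locales (auto simp: module_vec_simps class_ring_simps)
  qed
qed

lemma symmetric_mult_mat_vec_scalar_prod:
  assumes "C \<in> carrier_mat n n" "transpose_mat C = C" "u \<in> carrier_vec n" "v \<in> carrier_vec n"
  shows "(C *\<^sub>v u) \<bullet> v = u \<bullet> (C *\<^sub>v (v :: real vec))"
  using transpose_vec_mult_scalar[of C n n v u] assms by simp

text \<open>Positivity excludes a kernel vector, so the determinant is nonzero and
  \<open>mat_inverse\<close> does not return \<open>None\<close>; this justifies the
  \<open>the\<close> in \<open>inv_mat\<close>.\<close>

lemma inv_mat_spd:
  assumes P: "P \<in> carrier_mat n n" and spd: "spd_mat P"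
  shows "inv_mat P \<in> carrier_mat n n" "P * inv_mat P = 1\<^sub>m n" "inv_mat P * P = 1\<^sub>m n"
proof -
  have "det P \<noteq> 0"
  proof
    assume "det P = 0"
    then obtain v where v: "v \<in> carrier_vec n" "v \<noteq> 0\<^sub>v n" "P *\<^sub>v v = 0\<^sub>v n"
      using det_0_iff_vec_prod_zero_field[OF P] by blast
    then have "(P *\<^sub>v v) \<bullet> v > 0"
      using spd P unfolding spd_mat_def by auto
    then show False using v by simp
  qed
  then have "P \<in> Units (ring_mat TYPE(real) n ())"
    using P by (rule det_non_zero_imp_unit[rotated])
  then obtain Q where "mat_inverse P = Some Q"
    using mat_inverse(1)[OF P, where b = "()"] by (cases "mat_inverse P") auto
  with mat_inverse(2)[OF P this] show "inv_mat P \<in> carrier_mat n n" "P * inv_mat P = 1\<^sub>m n"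
    "inv_mat P * P = 1\<^sub>m n"
    unfolding inv_mat_def by auto
qed

text \<open>Gram-Schmidt of P^-1 A p against the last two directions, in the inner product (A u,
  P^-1 A v). In the first step \<open>pp\<close> is the zero vector and the second quotient is 0 / 0
  = 0.\<close>

definition next_dir :: "real mat \<Rightarrow> real mat \<Rightarrow> real vec \<Rightarrow> real vec \<Rightarrow> real vec" where
  "next_dir P A p pp =
     (let w = A *\<^sub>v p; s = inv_mat P *\<^sub>v w; t = A *\<^sub>v s; w' = A *\<^sub>v pp; s' = inv_mat P *\<^sub>v w' in
      s - ((t \<bullet> s) / (w \<bullet> s)) \<cdot>\<^sub>v p - ((t \<bullet> s') / (w' \<bullet> s')) \<cdot>\<^sub>v pp)"

definition step_length :: "real mat \<Rightarrow> real mat \<Rightarrow> real vec \<Rightarrow> real vec \<Rightarrow> real" where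
  "step_length P A r p =
     (let w = A *\<^sub>v p; s = inv_mat P *\<^sub>v w in (r \<bullet> s) / (w \<bullet> s))"

fun dirs :: "real mat \<Rightarrow> real mat \<Rightarrow> real vec \<Rightarrow> nat \<Rightarrow> real vec \<times> real vec" where
  "dirs P A r 0 = (inv_mat P *\<^sub>v r, 0\<^sub>v (dim_vec r))"
| "dirs P A r (Suc k) = (next_dir P A (fst (dirs P A r k)) (snd (dirs P A r k)), fst (dirs P A r k))"

text \<open>Every step length uses the initial residual. Since the images of the directions are
  orthogonal, it yields the same coefficients as the current residual would.\<close>

fun orthodir :: "real mat \<Rightarrow> real mat \<Rightarrow> real vec \<Rightarrow> real vec \<Rightarrow> nat \<Rightarrow> real vec" where
  "orthodir P A b x\<^sub>0 0 = x\<^sub>0"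
| "orthodir P A b x\<^sub>0 (Suc k) =
     (let r = b - A *\<^sub>v x\<^sub>0; p = fst (dirs P A r k) in
      orthodir P A b x\<^sub>0 k + step_length P A r p \<cdot>\<^sub>v p)"

text \<open>\<open>A\<close> may be indefinite: with \<open>P\<close> positive definite, a trivial
  kernel of \<open>A\<close> makes \<open>g\<close> below an inner product, namely that of the
  normal equations in the P^-1 norm.\<close>

locale preconditioned_system =
  fixes n :: nat and P A :: "real mat"
  assumes P: "P \<in> carrier_mat n n" and spd: "spd_mat P"
    and A: "A \<in> carrier_mat n n" and symA: "transpose_mat A = A"
    and injA: "\<And>v. v \<in> carrier_vec n \<Longrightarrow> A *\<^sub>v v = 0\<^sub>v n \<Longrightarrow> v = 0\<^sub>v n"
begin

definition "B v = inv_mat P *\<^sub>v (A *\<^sub>v v)"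
definition "g u v = (A *\<^sub>v u) \<bullet> B v"
definition "nrm r = (inv_mat P *\<^sub>v r) \<bullet> r"

lemmas Pi = inv_mat_spd[OF P spd]

lemma symP: "transpose_mat P = P"
  using spd by (simp add: spd_mat_def)

lemma P_Pi: "r \<in> carrier_vec n \<Longrightarrow> P *\<^sub>v (inv_mat P *\<^sub>v r) = r"
  using Pi P by (metis assoc_mult_mat_vec one_mult_mat_vec)

lemma Pi_closed [simp]: "r \<in> carrier_vec n \<Longrightarrow> inv_mat P *\<^sub>v r \<in> carrier_vec n"
  using Pi by simp

lemma A_closed [simp]: "r \<in> carrier_vec n \<Longrightarrow> A *\<^sub>v r \<in> carrier_vec n"
  using A by simp

lemma P_closed [simp]: "r \<in> carrier_vec n \<Longrightarrow> P *\<^sub>v r \<in> carrier_vec n"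
  using P by simp

lemma B_closed [simp]: "r \<in> carrier_vec n \<Longrightarrow> B r \<in> carrier_vec n"
  by (simp add: B_def)

lemma Pi_adj:
  assumes "u \<in> carrier_vec n" "v \<in> carrier_vec n"
  shows "(inv_mat P *\<^sub>v u) \<bullet> v = u \<bullet> (inv_mat P *\<^sub>v v)"
proof -
  have "(inv_mat P *\<^sub>v u) \<bullet> v = (inv_mat P *\<^sub>v u) \<bullet> (P *\<^sub>v (inv_mat P *\<^sub>v v))"
    using assms by (simp add: P_Pi)
  also have "\<dots> = (P *\<^sub>v (inv_mat P *\<^sub>v u)) \<bullet> (inv_mat P *\<^sub>v v)"
    using assms by (intro symmetric_mult_mat_vec_scalar_prod[OF P symP, symmetric]) auto
  finally show ?thesis using assms by (simp add: P_Pi)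
qed

lemma A_adj:
  "u \<in> carrier_vec n \<Longrightarrow> v \<in> carrier_vec n \<Longrightarrow> (A *\<^sub>v u) \<bullet> v = u \<bullet> (A *\<^sub>v v)"
  by (rule symmetric_mult_mat_vec_scalar_prod[OF A symA])

lemma nrm_eq: "r \<in> carrier_vec n \<Longrightarrow> nrm r = (P *\<^sub>v (inv_mat P *\<^sub>v r)) \<bullet> (inv_mat P *\<^sub>v r)"
  unfolding nrm_def by (simp add: P_Pi comm_scalar_prod[of _ n])

lemma P_form_nonneg: "v \<in> carrier_vec n \<Longrightarrow> 0 \<le> (P *\<^sub>v v) \<bullet> v"
  using spd P unfolding spd_mat_def by (cases "v = 0\<^sub>v n") (auto simp: less_imp_le)

lemma nrm_nonneg: "r \<in> carrier_vec n \<Longrightarrow> 0 \<le> nrm r"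
  by (simp add: nrm_eq P_form_nonneg)

lemma nrm_eq_0: "r \<in> carrier_vec n \<Longrightarrow> nrm r = 0 \<Longrightarrow> r = 0\<^sub>v n"
proof -
  assume r: "r \<in> carrier_vec n" "nrm r = 0"
  then have "inv_mat P *\<^sub>v r = 0\<^sub>v n"
    using spd P unfolding spd_mat_def nrm_eq[OF r(1)] by (metis Pi_closed carrier_matD(1) less_irrefl)
  then show ?thesis
    using P_Pi[OF r(1)] P by auto
qed

lemma g_nrm: "v \<in> carrier_vec n \<Longrightarrow> g v v = nrm (A *\<^sub>v v)"
  unfolding g_def nrm_def B_def by (simp add: comm_scalar_prod[of _ n])

lemma g_nonneg: "v \<in> carrier_vec n \<Longrightarrow> 0 \<le> g v v"
  by (simp add: g_nrm nrm_nonneg)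

lemma g_eq_0: "v \<in> carrier_vec n \<Longrightarrow> g v v = 0 \<Longrightarrow> v = 0\<^sub>v n"
  using g_nrm injA nrm_eq_0 by simp

lemma g_sym: "u \<in> carrier_vec n \<Longrightarrow> v \<in> carrier_vec n \<Longrightarrow> g u v = g v u"
  unfolding g_def B_def by (metis A_closed Pi_adj Pi_closed comm_scalar_prod)

lemma B_add: "u \<in> carrier_vec n \<Longrightarrow> v \<in> carrier_vec n \<Longrightarrow> B (u + v) = B u + B v"
  unfolding B_def using A Pi by (simp add: mult_add_distrib_mat_vec)

lemma B_smult: "u \<in> carrier_vec n \<Longrightarrow> B (c \<cdot>\<^sub>v u) = c \<cdot>\<^sub>v B u"
  unfolding B_def using A Pi by (simp add: mult_mat_vec)

lemma B_zero [simp]: "B (0\<^sub>v n) = 0\<^sub>v n"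
proof -
  have "C *\<^sub>v 0\<^sub>v n = 0\<^sub>v n" if "C \<in> carrier_mat n n" for C :: "real mat"
    using that by (intro eq_vecI) auto
  then show ?thesis using A Pi by (simp add: B_def)
qed

lemma g_add: "u \<in> carrier_vec n \<Longrightarrow> v \<in> carrier_vec n \<Longrightarrow> w \<in> carrier_vec n \<Longrightarrow>
    g (u + v) w = g u w + g v w"
  unfolding g_def using A by (simp add: mult_add_distrib_mat_vec add_scalar_prod_distrib[of _ n])

lemma g_minus: "u \<in> carrier_vec n \<Longrightarrow> v \<in> carrier_vec n \<Longrightarrow> w \<in> carrier_vec n \<Longrightarrow>
    g (u - v) w = g u w - g v w"
  unfolding g_def using A by (simp add: mult_minus_distrib_mat_vec minus_scalar_prod_distrib[of _ n])

lemma g_smult: "u \<in> carrier_vec n \<Longrightarrow> w \<in> carrier_vec n \<Longrightarrow> g (c \<cdot>\<^sub>v u) w = c * g u w"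
  unfolding g_def using A by (simp add: mult_mat_vec smult_scalar_prod_distrib[of _ n])

lemma g_zero: "w \<in> carrier_vec n \<Longrightarrow> g (0\<^sub>v n) w = 0"
  using g_add[of "0\<^sub>v n" "0\<^sub>v n" w] by simp

text \<open>Both sides are u and v paired through A P^-1 A P^-1 A, a product that is symmetric as it
  stands. This self-adjointness is the source of the three-term recurrence.\<close>

lemma g_B: "u \<in> carrier_vec n \<Longrightarrow> v \<in> carrier_vec n \<Longrightarrow> g (B u) v = g u (B v)"
proof -
  assume uv: "u \<in> carrier_vec n" "v \<in> carrier_vec n"
  have "g (B u) v = B u \<bullet> (A *\<^sub>v B v)"
    unfolding g_def using uv by (simp add: A_adj)
  also have "\<dots> = (A *\<^sub>v u) \<bullet> B (B v)"
    unfolding B_def[of u] B_def[of "B v"] using uv by (simp add: Pi_adj)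
  finally show ?thesis unfolding g_def .
qed

definition "d r k = fst (dirs P A r k)"
definition "e r k = snd (dirs P A r k)"

lemma d_0: "d r 0 = inv_mat P *\<^sub>v r" and e_0: "r \<in> carrier_vec n \<Longrightarrow> e r 0 = 0\<^sub>v n"
  and e_Suc: "e r (Suc k) = d r k"
  by (auto simp: d_def e_def)

lemma d_Suc:
  "d r (Suc k) = B (d r k) - (g (B (d r k)) (d r k) / g (d r k) (d r k)) \<cdot>\<^sub>v d r k
     - (g (B (d r k)) (e r k) / g (e r k) (e r k)) \<cdot>\<^sub>v e r k"
  by (simp add: d_def e_def next_dir_def g_def B_def Let_def)

lemma d_closed [simp]: "r \<in> carrier_vec n \<Longrightarrow> d r k \<in> carrier_vec n"
  and e_closed [simp]: "r \<in> carrier_vec n \<Longrightarrow> e r k \<in> carrier_vec n"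
proof -
  assume r: "r \<in> carrier_vec n"
  have "d r k \<in> carrier_vec n \<and> e r k \<in> carrier_vec n"
    by (induction k) (use r in \<open>auto simp: d_0 e_0 e_Suc d_Suc\<close>)
  then show "d r k \<in> carrier_vec n" "e r k \<in> carrier_vec n" by auto
qed

lemma B_d:
  assumes "r \<in> carrier_vec n"
  shows "B (d r k) = d r (Suc k) + (g (B (d r k)) (d r k) / g (d r k) (d r k)) \<cdot>\<^sub>v d r k
     + (g (B (d r k)) (e r k) / g (e r k) (e r k)) \<cdot>\<^sub>v e r k"
  (is "_ = _ + ?a \<cdot>\<^sub>v _ + ?b \<cdot>\<^sub>v _")
proof (rule eq_vecI)
  have *: "dim_vec (d r k) = n" "dim_vec (e r k) = n" "dim_vec (B (d r k)) = n" for k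
    using carrier_vecD assms by simp_all
  show "dim_vec (B (d r k)) = dim_vec (d r (Suc k) + ?a \<cdot>\<^sub>v d r k + ?b \<cdot>\<^sub>v e r k)"
    by (simp add: *)
  show "B (d r k) $ i = (d r (Suc k) + ?a \<cdot>\<^sub>v d r k + ?b \<cdot>\<^sub>v e r k) $ i"
    if "i < dim_vec (d r (Suc k) + ?a \<cdot>\<^sub>v d r k + ?b \<cdot>\<^sub>v e r k)" for i
    using that unfolding d_Suc by (simp add: *)
qed

text \<open>If \<open>g v v = 0\<close>, then v is zero and both sides vanish under x / 0 = 0. This
  is how the recurrence survives exhaustion of the Krylov space.\<close>

lemma g_proj: "u \<in> carrier_vec n \<Longrightarrow> v \<in> carrier_vec n \<Longrightarrow> g u v / g v v * g v v = g u v"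
  using g_eq_0[of v] g_sym[of u v] by (cases "g v v = 0") (auto simp: g_zero)

text \<open>The two most recent directions are projected away by construction. For an older
  \<open>d r i\<close>, self-adjointness moves \<open>B\<close> onto \<open>d r i\<close>, whose
  image involves only \<open>d r (Suc i)\<close>, \<open>d r i\<close> and \<open>e r i\<close>; all
  three are orthogonal to \<open>d r k\<close> by induction.\<close>

lemma d_orthogonal:
  assumes r: "r \<in> carrier_vec n"
  shows "i < k \<Longrightarrow> g (d r i) (d r k) = 0"
proof (induction k arbitrary: i rule: less_induct)
  case (less m)
  then obtain k where m: "m = Suc k" by (cases m) auto
  have IH: "g (d r i) (d r j) = 0" if "i \<le> k" "j \<le> k" "i \<noteq> j" for i j
    using that less.IH[of i j] less.IH[of j i] m g_sym[of "d r i" "d r j"] r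
    by (cases "i < j") auto
  define \<alpha> \<beta> where "\<alpha> i = g (B (d r i)) (d r i) / g (d r i) (d r i)"
    and "\<beta> i = g (B (d r i)) (e r i) / g (e r i) (e r i)" for i
  have split: "g (d r m) (d r i) = g (B (d r k)) (d r i) - \<alpha> k * g (d r k) (d r i) - \<beta> k * g (e r k) (d r i)"
    unfolding m d_Suc \<alpha>_def[symmetric] \<beta>_def[symmetric] using r
    by (simp add: g_minus g_smult)
  have "g (d r m) (d r i) = 0"
  proof (cases "i = k")
    case True
    have "g (e r k) (d r k) = 0"
      using IH r by (cases k) (auto simp: e_0 e_Suc g_zero)
    moreover have "\<alpha> k * g (d r k) (d r k) = g (B (d r k)) (d r k)"
      unfolding \<alpha>_def using r by (intro g_proj) auto
    ultimately show ?thesis using split True by simp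
  next
    case False
    then have i: "i < k" using less.prems m by simp
    then obtain j where k: "k = Suc j" by (cases k) auto
    have 1: "g (d r k) (d r i) = 0" using i IH by simp
    show ?thesis
    proof (cases "i = j")
      case True
      have "\<beta> k * g (d r i) (d r i) = g (B (d r k)) (d r i)"
        unfolding \<beta>_def k e_Suc True using r by (intro g_proj) auto
      then show ?thesis using split 1 True k by (simp add: e_Suc)
    next
      case False
      have e: "g (e r i) (d r k) = 0"
        using i IH r by (cases i) (auto simp: e_0 e_Suc g_zero)
      have Bd: "B (d r i) = d r (Suc i) + \<alpha> i \<cdot>\<^sub>v d r i + \<beta> i \<cdot>\<^sub>v e r i"
        unfolding \<alpha>_def \<beta>_def by (rule B_d[OF r])
      have "g (B (d r k)) (d r i) = g (B (d r i)) (d r k)"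
        using g_B[of "d r k" "d r i"] g_sym[of "d r k" "B (d r i)"] r by simp
      also have "\<dots> = g (d r (Suc i)) (d r k) + \<alpha> i * g (d r i) (d r k) + \<beta> i * g (e r i) (d r k)"
        using r by (simp add: Bd g_add g_smult)
      also have "\<dots> = 0" using IH i False k e by simp
      finally show ?thesis using split 1 IH[of j i] i False k by (simp add: e_Suc)
    qed
  qed
  then show ?case using g_sym r by simp
qed

fun corr :: "real vec \<Rightarrow> nat \<Rightarrow> real vec" where
  "corr r 0 = 0\<^sub>v n"
| "corr r (Suc k) = corr r k + step_length P A r (d r k) \<cdot>\<^sub>v d r k"

lemma corr_closed [simp]: "r \<in> carrier_vec n \<Longrightarrow> corr r k \<in> carrier_vec n"
  by (induction k) auto

lemma step_length_eq: "step_length P A r p = (r \<bullet> B p) / g p p"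
  by (simp add: step_length_def g_def B_def Let_def)

text \<open>Thus \<open>corr r k\<close> is the g-orthogonal expansion of the exact correction A^-1
  r, cut off after \<open>k\<close> directions. Along a vanishing direction both sides are
  zero.\<close>

lemma g_corr:
  assumes r: "r \<in> carrier_vec n"
  shows "g (corr r k) (d r j) = (if j < k then r \<bullet> B (d r j) else 0)"
proof (induction k)
  case 0
  then show ?case using r by (simp add: g_zero)
next
  case (Suc k)
  have "r \<bullet> B (d r j) = 0" if "g (d r j) (d r j) = 0"
  proof -
    have "d r j = 0\<^sub>v n" using g_eq_0 that r by simp
    then show ?thesis using r by simp
  qed
  moreover have "g (d r k) (d r j) = 0" if "j \<noteq> k"
    using d_orthogonal[OF r, of j k] d_orthogonal[OF r, of k j] that g_sym[of "d r j" "d r k"] r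
    by (cases "j < k") auto
  ultimately show ?case
    using Suc r by (auto simp: g_add g_smult step_length_eq less_Suc_eq)
qed

section \<open>Krylov spaces and the minimisation property\<close>

abbreviation "kry r m \<equiv> krylov_space (inv_mat P * A) (inv_mat P *\<^sub>v r) m"

definition "gen r j = ((inv_mat P * A) ^\<^sub>m j) *\<^sub>v (inv_mat P *\<^sub>v r)"

lemma PiA: "inv_mat P * A \<in> carrier_mat n n"
  using Pi A by simp

lemma PiA_mult: "v \<in> carrier_vec n \<Longrightarrow> (inv_mat P * A) *\<^sub>v v = B v"
  unfolding B_def using Pi A by simp

lemma gen_closed [simp]: "r \<in> carrier_vec n \<Longrightarrow> gen r j \<in> carrier_vec n"
  unfolding gen_def by (rule mult_mat_vec_carrier[OF pow_carrier_mat[OF PiA]]) simp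

lemma gen_0: "r \<in> carrier_vec n \<Longrightarrow> gen r 0 = inv_mat P *\<^sub>v r"
  unfolding gen_def using PiA Pi by simp

text \<open>Matrix powers unfold with the new factor on the right; the induction over arbitrary
  \<open>v\<close> brings one factor to the outside on the left.\<close>

lemma gen_Suc: "r \<in> carrier_vec n \<Longrightarrow> gen r (Suc j) = B (gen r j)"
proof -
  let ?C = "inv_mat P * A"
  have "(?C ^\<^sub>m Suc j) *\<^sub>v v = B ((?C ^\<^sub>m j) *\<^sub>v v)" if "v \<in> carrier_vec n" for v
    using that
  proof (induction j arbitrary: v)
    case 0
    then show ?case using PiA carrier_matD(1)[OF Pi(1)] by (simp add: PiA_mult)
  next
    case (Suc j)
    have pow: "(?C ^\<^sub>m Suc k) *\<^sub>v v = (?C ^\<^sub>m k) *\<^sub>v (?C *\<^sub>v v)" for k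
      using assoc_mult_mat_vec[OF pow_carrier_mat[OF PiA] PiA Suc.prems] by simp
    have "(?C ^\<^sub>m Suc (Suc j)) *\<^sub>v v = (?C ^\<^sub>m Suc j) *\<^sub>v (?C *\<^sub>v v)"
      by (rule pow)
    also have "\<dots> = B ((?C ^\<^sub>m j) *\<^sub>v (?C *\<^sub>v v))"
      by (rule Suc.IH) (use Suc.prems PiA_mult in simp)
    also have "(?C ^\<^sub>m j) *\<^sub>v (?C *\<^sub>v v) = (?C ^\<^sub>m Suc j) *\<^sub>v v"
      by (rule pow[symmetric])
    finally show ?case .
  qed
  then show "r \<in> carrier_vec n \<Longrightarrow> ?thesis" by (simp add: gen_def)
qed

lemma kry_facts:
  assumes r: "r \<in> carrier_vec n"
  shows lin_closed_kry: "lin_closed n (kry r m)"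
    and gen_kry: "j < m \<Longrightarrow> gen r j \<in> kry r m"
    and kry_least: "lin_closed n W \<Longrightarrow> (\<And>j. j < m \<Longrightarrow> gen r j \<in> W) \<Longrightarrow> kry r m \<subseteq> W"
  using krylov_space_props[OF PiA Pi_closed[OF r]] by (auto simp: gen_def)

lemma kry_closed: "r \<in> carrier_vec n \<Longrightarrow> v \<in> kry r m \<Longrightarrow> v \<in> carrier_vec n"
  using lin_closed_kry unfolding lin_closed_def by blast

lemma kry_mono: "r \<in> carrier_vec n \<Longrightarrow> m \<le> m' \<Longrightarrow> kry r m \<subseteq> kry r m'"
  by (intro kry_least lin_closed_kry gen_kry) auto

text \<open>With minimality of the Krylov space, this reduces claims about images under
  \<open>B\<close> to claims about a preimage that is again a subspace.\<close>

lemma lin_closed_B_vimage: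
  assumes "lin_closed n W"
  shows "lin_closed n {v \<in> carrier_vec n. B v \<in> W}"
  using assms unfolding lin_closed_def by (auto simp: B_add B_smult)

lemma B_kry:
  assumes r: "r \<in> carrier_vec n" and v: "v \<in> kry r m"
  shows "B v \<in> kry r (Suc m)"
proof -
  have "kry r m \<subseteq> {v \<in> carrier_vec n. B v \<in> kry r (Suc m)}"
    using r by (intro kry_least lin_closed_B_vimage lin_closed_kry)
      (auto simp: gen_Suc[symmetric] intro: gen_kry)
  then show ?thesis using v by auto
qed

lemma d_kry:
  assumes r: "r \<in> carrier_vec n"
  shows "d r k \<in> kry r (Suc k) \<and> e r k \<in> kry r (Suc k)"
proof (induction k)
  case 0
  have "0\<^sub>v n \<in> kry r (Suc 0)" using lin_closed_kry[OF r] unfolding lin_closed_def by blast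
  then show ?case using r gen_kry[OF r, of 0 1] by (simp add: d_0 e_0 gen_0)
next
  case (Suc k)
  let ?K = "kry r (Suc (Suc k))"
  have K: "lin_closed n ?K" by (rule lin_closed_kry[OF r])
  have sub: "kry r (Suc k) \<subseteq> ?K" using kry_mono[OF r] by simp
  have "B (d r k) \<in> ?K" "d r k \<in> ?K" "e r k \<in> ?K"
    using Suc B_kry[OF r] sub by auto
  moreover from this have "c \<cdot>\<^sub>v d r k \<in> ?K" "c \<cdot>\<^sub>v e r k \<in> ?K" for c
    using K unfolding lin_closed_def by auto
  ultimately show ?case
    unfolding d_Suc e_Suc by (auto intro!: lin_closed_minus[OF K])
qed

lemma corr_kry:
  assumes r: "r \<in> carrier_vec n"
  shows "corr r k \<in> kry r k"
proof (induction k)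
  case 0
  show ?case using lin_closed_kry[OF r] unfolding lin_closed_def by simp
next
  case (Suc k)
  have "corr r k \<in> kry r (Suc k)" using Suc kry_mono[OF r, of k "Suc k"] by auto
  then show ?case
    using lin_closed_kry[OF r, of "Suc k"] d_kry[OF r, of k] unfolding lin_closed_def by simp
qed

text \<open>The directions span the Krylov space even if some of them are zero, because
  \<open>B_d\<close> expresses \<open>B (d r i)\<close> through its neighbours in every case. So if
  \<open>W\<close> contains the first \<open>Suc m\<close> directions, its preimage under
  \<open>B\<close> contains the first \<open>m\<close>, and the induction continues with that
  preimage.\<close>

lemma gen_in_dirs:
  assumes r: "r \<in> carrier_vec n"
  shows "lin_closed n W \<Longrightarrow> (\<And>i. i < m \<Longrightarrow> d r i \<in> W) \<Longrightarrow> j < m \<Longrightarrow> gen r j \<in> W"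
proof (induction m arbitrary: W j)
  case (Suc m)
  show ?case
  proof (cases "j < m")
    case True
    then show ?thesis using Suc by auto
  next
    case False
    then have j: "j = m" using Suc.prems by simp
    show ?thesis
    proof (cases m)
      case 0
      then show ?thesis using Suc.prems(2)[of 0] j r by (simp add: gen_0 d_0)
    next
      case (Suc m')
      let ?W = "{v \<in> carrier_vec n. B v \<in> W}"
      have "d r i \<in> ?W" if "i < m" for i
      proof -
        have "d r i \<in> W" "d r (Suc i) \<in> W" using Suc.prems(2) that by auto
        moreover have "e r i \<in> W"
          using Suc.prems(1,2) that r by (cases i) (auto simp: e_0 e_Suc lin_closed_def)
        ultimately have "B (d r i) \<in> W"
          using Suc.prems(1) unfolding lin_closed_def by (subst B_d[OF r]) blast
        then show ?thesis using r by simp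
      qed
      then have "gen r m' \<in> ?W"
        using Suc.IH[OF lin_closed_B_vimage[OF Suc.prems(1)], of m'] \<open>m = Suc m'\<close> by auto
      then show ?thesis using j \<open>m = Suc m'\<close> r by (simp add: gen_Suc)
    qed
  qed
qed simp

text \<open>The optimality condition of the least-squares problem. It holds for each direction by
  \<open>g_corr\<close>, and the vectors satisfying it form a subspace, which therefore contains the
  whole Krylov space.\<close>

lemma residual_orthogonal:
  assumes r: "r \<in> carrier_vec n" and v: "v \<in> kry r k"
  shows "(r - A *\<^sub>v corr r k) \<bullet> B v = 0"
proof -
  let ?s = "r - A *\<^sub>v corr r k"
  let ?W = "{v \<in> carrier_vec n. ?s \<bullet> B v = 0}"
  have s: "?s \<in> carrier_vec n" using r by simp
  have W: "lin_closed n ?W"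
    unfolding lin_closed_def using s by (auto simp: B_add B_smult scalar_prod_add_distrib[of _ n])
  have "d r j \<in> ?W" if "j < k" for j
  proof -
    have "?s \<bullet> B (d r j) = r \<bullet> B (d r j) - g (corr r k) (d r j)"
      unfolding g_def using r by (simp add: minus_scalar_prod_distrib[of _ n])
    then show ?thesis using that r by (simp add: g_corr)
  qed
  then have "kry r k \<subseteq> ?W"
    using gen_in_dirs[OF r W] by (intro kry_least[OF r W]) blast
  then show ?thesis using v by blast
qed

lemma nrm_minus:
  assumes "s \<in> carrier_vec n" "w \<in> carrier_vec n"
  shows "nrm (s - A *\<^sub>v w) = nrm s - 2 * (s \<bullet> B w) + g w w"
proof -
  have "nrm (s - A *\<^sub>v w) = (inv_mat P *\<^sub>v s - B w) \<bullet> (s - A *\<^sub>v w)"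
    unfolding nrm_def B_def using assms Pi A by (simp add: mult_minus_distrib_mat_vec)
  also have "\<dots> = (inv_mat P *\<^sub>v s) \<bullet> s - (inv_mat P *\<^sub>v s) \<bullet> (A *\<^sub>v w) - B w \<bullet> s + B w \<bullet> (A *\<^sub>v w)"
    using assms by (simp add: minus_scalar_prod_distrib[of _ n] scalar_prod_minus_distrib[of _ n])
  also have "(inv_mat P *\<^sub>v s) \<bullet> (A *\<^sub>v w) = s \<bullet> B w"
    unfolding B_def using assms by (simp add: Pi_adj)
  also have "B w \<bullet> s = s \<bullet> B w" using assms by (simp add: comm_scalar_prod[of _ n])
  also have "B w \<bullet> (A *\<^sub>v w) = g w w" unfolding g_def using assms by (simp add: comm_scalar_prod[of _ n])
  finally show ?thesis by (simp add: nrm_def)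
qed

lemma pythagoras:
  assumes r: "r \<in> carrier_vec n" and y: "y \<in> kry r k"
  shows "nrm (r - A *\<^sub>v y) = nrm (r - A *\<^sub>v corr r k) + g (y - corr r k) (y - corr r k)"
proof -
  let ?w = "y - corr r k" and ?s = "r - A *\<^sub>v corr r k"
  have yc: "y \<in> carrier_vec n" using kry_closed r y by blast
  have w: "?w \<in> kry r k" using lin_closed_minus[OF lin_closed_kry[OF r] y corr_kry[OF r]] .
  have "r - A *\<^sub>v y = ?s - A *\<^sub>v ?w"
  proof -
    have "A *\<^sub>v ?w = A *\<^sub>v y - A *\<^sub>v corr r k"
      using r yc A by (simp add: mult_minus_distrib_mat_vec)
    then show ?thesis using r yc A by (intro eq_vecI) auto
  qed
  then show ?thesis
    using nrm_minus[of ?s ?w] residual_orthogonal[OF r w] r yc by simp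
qed

lemma orthodir_eq:
  assumes "b \<in> carrier_vec n" "x\<^sub>0 \<in> carrier_vec n"
  shows "orthodir P A b x\<^sub>0 k = x\<^sub>0 + corr (b - A *\<^sub>v x\<^sub>0) k"
proof (induction k)
  case (Suc k)
  let ?r = "b - A *\<^sub>v x\<^sub>0"
  have r: "?r \<in> carrier_vec n" using assms by simp
  show ?case
    using Suc assms(2) r by (simp add: Let_def d_def[symmetric] assoc_add_vec[of _ n])
qed (use assms in auto)

text \<open>\<open>arg_min\<close> is a choice operator, so showing that the candidate is a
  minimiser is not enough. By \<open>pythagoras\<close>, any other minimiser differs from it by a
  vector on which \<open>g\<close> vanishes, that is, by zero.\<close>

lemma minres_eq_orthodir:
  assumes b: "b \<in> carrier_vec n" and x: "x\<^sub>0 \<in> carrier_vec n"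
  shows "minres P A b x\<^sub>0 k = orthodir P A b x\<^sub>0 k"
proof -
  let ?r = "b - A *\<^sub>v x\<^sub>0"
  let ?f = "\<lambda>x. inv_norm P (b - A *\<^sub>v x)"
  let ?Q = "\<lambda>x. \<exists>y\<in>kry ?r k. x = x\<^sub>0 + y"
  have r: "?r \<in> carrier_vec n" using b x by simp
  have res: "b - A *\<^sub>v (x\<^sub>0 + y) = ?r - A *\<^sub>v y" if "y \<in> carrier_vec n" for y
  proof -
    have "A *\<^sub>v (x\<^sub>0 + y) = A *\<^sub>v x\<^sub>0 + A *\<^sub>v y"
      using x that A by (simp add: mult_add_distrib_mat_vec)
    then show ?thesis using b x that A by (intro eq_vecI) auto
  qed
  have f: "?f (x\<^sub>0 + y) = sqrt (nrm (?r - A *\<^sub>v corr ?r k) + g (y - corr ?r k) (y - corr ?r k))"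
    if "y \<in> kry ?r k" for y
    using res[OF kry_closed[OF r that]] pythagoras[OF r that] by (simp add: inv_norm_def nrm_def)
  have zero: "corr ?r k - corr ?r k = 0\<^sub>v n" using r by simp
  have fmin: "?f (x\<^sub>0 + corr ?r k) = sqrt (nrm (?r - A *\<^sub>v corr ?r k))"
    using f[OF corr_kry[OF r]] r by (simp add: zero g_zero)
  have min: "is_arg_min ?f ?Q (x\<^sub>0 + corr ?r k)"
    unfolding is_arg_min_def
  proof (intro conjI notI)
    show "?Q (x\<^sub>0 + corr ?r k)" using corr_kry[OF r] by blast
    assume "\<exists>y. ?Q y \<and> ?f y < ?f (x\<^sub>0 + corr ?r k)"
    then obtain y where y: "y \<in> kry ?r k" "?f (x\<^sub>0 + y) < ?f (x\<^sub>0 + corr ?r k)" by blast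
    have "y \<in> carrier_vec n" using kry_closed[OF r y(1)] .
    then show False
      using y(2) g_nonneg[of "y - corr ?r k"] r unfolding f[OF y(1)] fmin by simp
  qed
  have uniq: "x = x\<^sub>0 + corr ?r k" if "is_arg_min ?f ?Q x" for x
  proof -
    obtain y where y: "y \<in> kry ?r k" "x = x\<^sub>0 + y" using \<open>is_arg_min ?f ?Q x\<close> unfolding is_arg_min_def by blast
    let ?w = "y - corr ?r k"
    have yc: "y \<in> carrier_vec n" using kry_closed[OF r y(1)] .
    then have w: "?w \<in> carrier_vec n" using r by simp
    have "?f x \<le> ?f (x\<^sub>0 + corr ?r k)"
      using \<open>is_arg_min ?f ?Q x\<close> min unfolding is_arg_min_def by (meson not_le)
    then have "g ?w ?w \<le> 0" unfolding y(2) f[OF y(1)] fmin by simp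
    then have "?w = 0\<^sub>v n" using g_eq_0[OF w] g_nonneg[OF w] by simp
    then have "y = corr ?r k"
    proof (intro eq_vecI)
      fix i assume "i < dim_vec (corr ?r k)"
      then have "i < n" using carrier_vecD[OF corr_closed[OF r]] by simp
      then show "y $ i = corr ?r k $ i"
        using arg_cong[OF \<open>?w = 0\<^sub>v n\<close>, of "\<lambda>v. v $ i"] carrier_vecD[OF corr_closed[OF r], of k] by simp
    qed (use carrier_vecD[OF corr_closed[OF r], of k] yc in simp)
    then show ?thesis using y by simp
  qed
  have "minres P A b x\<^sub>0 k = x\<^sub>0 + corr ?r k"
    unfolding minres_def arg_min_def using min uniq by (rule some_equality)
  then show ?thesis using orthodir_eq[OF b x] by simp
qed

end

section \<open>Residual contraction from two-sided bounds on the preconditioned operator\<close>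

context preconditioned_system
begin

lemma minres_residual_eq:
  assumes "b \<in> carrier_vec n" "x\<^sub>0 \<in> carrier_vec n"
  shows "minres_residual P A b x\<^sub>0 k = sqrt (nrm (b - A *\<^sub>v x\<^sub>0 - A *\<^sub>v corr (b - A *\<^sub>v x\<^sub>0) k))"
proof -
  let ?r = "b - A *\<^sub>v x\<^sub>0"
  have "A *\<^sub>v (x\<^sub>0 + corr ?r k) = A *\<^sub>v x\<^sub>0 + A *\<^sub>v corr ?r k"
    using assms A by (simp add: mult_add_distrib_mat_vec)
  then have "b - A *\<^sub>v (x\<^sub>0 + corr ?r k) = ?r - A *\<^sub>v corr ?r k"
    using assms A by (intro eq_vecI) auto
  then show ?thesis
    using assms by (simp add: minres_residual_def minres_eq_orthodir orthodir_eq inv_norm_def nrm_def)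
qed

lemma nrm_corr_le:
  assumes "r \<in> carrier_vec n" "y \<in> kry r k"
  shows "nrm (r - A *\<^sub>v corr r k) \<le> nrm (r - A *\<^sub>v y)"
  using pythagoras[OF assms] g_nonneg[of "y - corr r k"] kry_closed[OF assms] assms(1) by simp

text \<open>The competitor in the Krylov space is a gradient step for the squared preconditioned
  operator, whose spectrum is positive although that of \<^term>\<open>A\<close> is not.\<close>

lemma nrm_corr_two_steps:
  assumes r: "r \<in> carrier_vec n" and C: "0 < C\<^sub>1" "0 < C\<^sub>2"
    and lower: "\<And>v. v \<in> carrier_vec n \<Longrightarrow> C\<^sub>1 * ((P *\<^sub>v v) \<bullet> v) \<le> g v v"
    and upper: "\<And>v. v \<in> carrier_vec n \<Longrightarrow> g v v \<le> C\<^sub>2 * ((P *\<^sub>v v) \<bullet> v)"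
  shows "nrm (r - A *\<^sub>v corr r (Suc (Suc k))) \<le> (1 - C\<^sub>1 / C\<^sub>2) * nrm (r - A *\<^sub>v corr r k)"
proof -
  define s where "s = r - A *\<^sub>v corr r k"
  define u where "u = inv_mat P *\<^sub>v s"
  \<comment> \<open>The reciprocal of the upper bound minimises the quadratic -2 t +
    \<open>C\<^sub>2\<close> t^2 that appears below.\<close>
  define \<omega> where "\<omega> = 1 / C\<^sub>2"
  let ?K = "kry r (Suc (Suc k))"
  have s: "s \<in> carrier_vec n" using r by (simp add: s_def)
  have u: "u \<in> carrier_vec n" using s by (simp add: u_def)
  have K: "lin_closed n ?K" by (rule lin_closed_kry[OF r])
  have "u = gen r 0 - B (corr r k)"
    unfolding u_def s_def B_def using r Pi by (simp add: gen_0 mult_minus_distrib_mat_vec)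
  moreover have "gen r 0 \<in> kry r (Suc k)" "B (corr r k) \<in> kry r (Suc k)"
    using gen_kry[OF r] B_kry[OF r corr_kry[OF r]] by auto
  \<comment> \<open>The preconditioned residual lies one Krylov dimension higher and
    \<open>B u\<close> one further; this is why a contraction takes two steps.\<close>
  ultimately have "u \<in> kry r (Suc k)"
    using lin_closed_minus[OF lin_closed_kry[OF r]] by simp
  then have "\<omega> \<cdot>\<^sub>v B u \<in> ?K" using B_kry[OF r] K unfolding lin_closed_def by blast
  moreover have "corr r k \<in> ?K" using corr_kry[OF r, of k] kry_mono[OF r, of k "Suc (Suc k)"] by auto
  ultimately have y: "corr r k + \<omega> \<cdot>\<^sub>v B u \<in> ?K" using K unfolding lin_closed_def by blast
  have "A *\<^sub>v (corr r k + \<omega> \<cdot>\<^sub>v B u) = A *\<^sub>v corr r k + A *\<^sub>v (\<omega> \<cdot>\<^sub>v B u)"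
    using u r A by (simp add: mult_add_distrib_mat_vec)
  then have "r - A *\<^sub>v (corr r k + \<omega> \<cdot>\<^sub>v B u) = s - A *\<^sub>v (\<omega> \<cdot>\<^sub>v B u)"
    unfolding s_def using r A by (intro eq_vecI) auto
  then have "nrm (r - A *\<^sub>v corr r (Suc (Suc k))) \<le> nrm (s - A *\<^sub>v (\<omega> \<cdot>\<^sub>v B u))"
    using nrm_corr_le[OF r y] by simp
  also have "\<dots> = nrm s - 2 * (s \<bullet> B (\<omega> \<cdot>\<^sub>v B u)) + g (\<omega> \<cdot>\<^sub>v B u) (\<omega> \<cdot>\<^sub>v B u)"
    using s u by (intro nrm_minus) auto
  also have "s \<bullet> B (\<omega> \<cdot>\<^sub>v B u) = \<omega> * (s \<bullet> B (B u))"
    using s u by (simp add: B_smult)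
  also have "s \<bullet> B (B u) = g u u"
  proof -
    have "s \<bullet> B (B u) = u \<bullet> (A *\<^sub>v B u)"
      using Pi_adj[OF s, of "A *\<^sub>v B u"] u by (simp add: B_def[of "B u"] u_def[symmetric])
    then show ?thesis unfolding g_def using u by (simp add: A_adj)
  qed
  also have "g (\<omega> \<cdot>\<^sub>v B u) (\<omega> \<cdot>\<^sub>v B u) = \<omega>\<^sup>2 * g (B u) (B u)"
    using u g_sym[of "B u" "\<omega> \<cdot>\<^sub>v B u"] by (simp add: g_smult power2_eq_square)
  \<comment> \<open>The P-form at \<open>B u\<close> is \<open>g u u\<close>, since P maps
    \<open>B u\<close> to A u. So \<open>upper\<close>, applied to \<open>B u\<close>, bounds the
    squared operator.\<close>
  also have "g (B u) (B u) \<le> C\<^sub>2 * g u u"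
  proof -
    have "P *\<^sub>v B u = A *\<^sub>v u" unfolding B_def using u by (simp add: P_Pi)
    then show ?thesis using upper[of "B u"] u by (simp add: g_def)
  qed
  finally have "nrm (r - A *\<^sub>v corr r (Suc (Suc k))) \<le> nrm s - 2 * (\<omega> * g u u) + \<omega>\<^sup>2 * (C\<^sub>2 * g u u)"
    by (simp add: mult_left_mono)
  also have "\<dots> = nrm s - \<omega> * g u u"
    using C by (simp add: \<omega>_def power2_eq_square)
  also have "\<dots> \<le> nrm s - \<omega> * (C\<^sub>1 * nrm s)"
    using lower[OF u] C nrm_eq[OF s] by (simp add: \<omega>_def u_def divide_right_mono)
  also have "\<dots> = (1 - C\<^sub>1 / C\<^sub>2) * nrm s" by (simp add: \<omega>_def algebra_simps)
  finally show ?thesis by (simp add: s_def)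
qed

text \<open>One square root passes from squared norms to norms, the other from two steps to one. The
  prefactor \<open>1 / q\<close> pays for odd numbers of steps, and
  \<open>C\<^sub>1 < C\<^sub>2\<close> keeps q positive.\<close>

lemma minres_residual_le:
  assumes b: "b \<in> carrier_vec n" and x: "x\<^sub>0 \<in> carrier_vec n" and C: "0 < C\<^sub>1" "C\<^sub>1 < C\<^sub>2"
    and lower: "\<And>v. v \<in> carrier_vec n \<Longrightarrow> C\<^sub>1 * ((P *\<^sub>v v) \<bullet> v) \<le> g v v"
    and upper: "\<And>v. v \<in> carrier_vec n \<Longrightarrow> g v v \<le> C\<^sub>2 * ((P *\<^sub>v v) \<bullet> v)"
    and q: "q = sqrt (sqrt (1 - C\<^sub>1 / C\<^sub>2))"
  shows "minres_residual P A b x\<^sub>0 k \<le> 1 / q * q ^ k * inv_norm P (b - A *\<^sub>v x\<^sub>0)"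
proof -
  let ?r = "b - A *\<^sub>v x\<^sub>0"
  define \<rho> where "\<rho> k = sqrt (nrm (?r - A *\<^sub>v corr ?r k))" for k
  have r: "?r \<in> carrier_vec n" using b x by simp
  have "C\<^sub>1 / C\<^sub>2 < 1" "C\<^sub>1 / C\<^sub>2 > 0" using C by auto
  then have \<theta>: "0 < 1 - C\<^sub>1 / C\<^sub>2" "1 - C\<^sub>1 / C\<^sub>2 < 1" by auto
  then have q0: "0 < q" "q < 1" "q\<^sup>2 = sqrt (1 - C\<^sub>1 / C\<^sub>2)" using q by auto
  have zero: "?r - A *\<^sub>v 0\<^sub>v n = ?r" using r A by (intro eq_vecI) auto
  have "0\<^sub>v n \<in> kry ?r 1" using lin_closed_kry[OF r] unfolding lin_closed_def by blast
  from nrm_corr_le[OF r this] have "\<rho> 1 \<le> \<rho> 0"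
    unfolding \<rho>_def by (simp add: zero)
  have two: "\<rho> (Suc (Suc k)) \<le> q\<^sup>2 * \<rho> k" for k
    using nrm_corr_two_steps[OF r C(1) _ lower upper, of k] C
    unfolding \<rho>_def q0(3) real_sqrt_mult[symmetric] by (intro real_sqrt_le_mono) auto
  have "\<rho> k \<le> 1 / q * q ^ k * \<rho> 0 \<and> \<rho> (Suc k) \<le> 1 / q * q ^ Suc k * \<rho> 0"
  proof (induction k)
    case 0
    have "0 \<le> \<rho> 0" using r by (simp add: \<rho>_def zero nrm_nonneg)
    then have "\<rho> 0 \<le> \<rho> 0 / q" using q0 by (simp add: le_divide_eq mult_left_le)
    then show ?case using \<open>\<rho> 1 \<le> \<rho> 0\<close> q0 by simp
  next
    case (Suc k)
    have "\<rho> (Suc (Suc k)) \<le> q\<^sup>2 * \<rho> k" by (rule two)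
    also have "\<dots> \<le> q\<^sup>2 * (1 / q * q ^ k * \<rho> 0)" using Suc by (intro mult_left_mono) auto
    also have "\<dots> = 1 / q * q ^ Suc (Suc k) * \<rho> 0" by (simp add: power2_eq_square)
    finally show ?case using Suc by simp
  qed
  then show ?thesis
    unfolding minres_residual_eq[OF b x] \<rho>_def by (simp add: zero inv_norm_def nrm_def)
qed

lemma P_form_g: "v \<in> carrier_vec n \<Longrightarrow> (P *\<^sub>v B v) \<bullet> w = (A *\<^sub>v v) \<bullet> w"
  unfolding B_def by (simp add: P_Pi)

text \<open>An inf-sup argument without square roots: the P-form of B v - c v' is nonnegative, and
  expanding it turns the bound on (A v, v') into one on \<open>g v v\<close>, which is the P-form of
  \<open>B v\<close>.\<close>

lemma g_lower:
  assumes v: "v \<in> carrier_vec n" and v': "v' \<in> carrier_vec n" and c: "0 < c"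
    and eq: "(P *\<^sub>v v') \<bullet> v' = (P *\<^sub>v v) \<bullet> v" and le: "c * ((P *\<^sub>v v) \<bullet> v) \<le> (A *\<^sub>v v) \<bullet> v'"
  shows "c\<^sup>2 * ((P *\<^sub>v v) \<bullet> v) \<le> g v v"
proof -
  let ?X = "(P *\<^sub>v v) \<bullet> v"
  have sym: "(P *\<^sub>v v') \<bullet> B v = (P *\<^sub>v B v) \<bullet> v'"
    using symmetric_mult_mat_vec_scalar_prod[OF P symP v', of "B v"] v v'
    by (simp add: comm_scalar_prod[of _ n])
  have "0 \<le> (P *\<^sub>v (B v - c \<cdot>\<^sub>v v')) \<bullet> (B v - c \<cdot>\<^sub>v v')"
    using v v' by (intro P_form_nonneg) auto
  also have "\<dots> = (P *\<^sub>v B v) \<bullet> B v - 2 * c * ((P *\<^sub>v B v) \<bullet> v') + c\<^sup>2 * ((P *\<^sub>v v') \<bullet> v')"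
    using v v' P
    by (simp add: mult_minus_distrib_mat_vec mult_mat_vec minus_scalar_prod_distrib[of _ n]
        scalar_prod_minus_distrib[of _ n] smult_scalar_prod_distrib[of _ n]
        scalar_prod_smult_distrib[of _ n] sym power2_eq_square algebra_simps)
  also have "(P *\<^sub>v B v) \<bullet> B v = g v v"
    using v by (simp add: P_form_g g_def)
  finally have "2 * c * ((A *\<^sub>v v) \<bullet> v') \<le> g v v + c\<^sup>2 * ?X"
    using v by (simp add: P_form_g eq)
  moreover have "2 * c * (c * ?X) \<le> 2 * c * ((A *\<^sub>v v) \<bullet> v')"
    using c le by (intro mult_left_mono) auto
  ultimately show ?thesis by (simp add: power2_eq_square)
qed

text \<open>Testing with s times \<open>B v\<close> makes the left side a multiple of
  \<open>g v v\<close>. With s = 1 / (2 C), half of that multiple absorbs the quadratic term on the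
  right, which leads to the factor 4 C^2.\<close>

lemma g_upper:
  assumes v: "v \<in> carrier_vec n" and C: "0 < C"
    and le: "\<And>v'. v' \<in> carrier_vec n \<Longrightarrow> (A *\<^sub>v v) \<bullet> v' \<le> C * ((P *\<^sub>v v) \<bullet> v + (P *\<^sub>v v') \<bullet> v')"
  shows "g v v \<le> 4 * C\<^sup>2 * ((P *\<^sub>v v) \<bullet> v)"
proof -
  let ?X = "(P *\<^sub>v v) \<bullet> v"
  define s where "s = 1 / (2 * C)"
  have "s * g v v = (A *\<^sub>v v) \<bullet> (s \<cdot>\<^sub>v B v)"
    unfolding g_def using v by (simp add: scalar_prod_smult_distrib[of _ n])
  also have "\<dots> \<le> C * (?X + (P *\<^sub>v (s \<cdot>\<^sub>v B v)) \<bullet> (s \<cdot>\<^sub>v B v))"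
    using v by (intro le) simp
  also have "(P *\<^sub>v (s \<cdot>\<^sub>v B v)) \<bullet> (s \<cdot>\<^sub>v B v) = s\<^sup>2 * g v v"
    using v P by (simp add: mult_mat_vec P_form_g g_def power2_eq_square
        smult_scalar_prod_distrib[of _ n] scalar_prod_smult_distrib[of _ n])
  finally have "s * g v v \<le> C * ?X + C * s\<^sup>2 * g v v" by (simp add: algebra_simps)
  also have "C * s\<^sup>2 * g v v = s * g v v / 2" using C by (simp add: s_def power2_eq_square)
  finally have "s * g v v / 2 \<le> C * ?X" by simp
  then show ?thesis using C by (simp add: s_def field_simps power2_eq_square)
qed

end

section \<open>Operation count of one iteration and of the whole method\<close>

lemma gets_step: "gets I V\<^sub>0 k V \<Longrightarrow> gets I V l W \<Longrightarrow> gets I V\<^sub>0 (k + l) (V \<union> W)"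
  by (rule gets_trans[OF _ gets_keep])

context preconditioned_system
begin

context
  fixes I :: "'i set" and V :: "('i \<Rightarrow> real) set"
  assumes zero: "(\<lambda>i. 0) \<in> V" and one: "(\<lambda>i. 1) \<in> V"
    and entries: "\<And>l k. l < n \<Longrightarrow> k < n \<Longrightarrow> A $$ (l, k) \<noteq> 0 \<Longrightarrow> (\<lambda>i. A $$ (l, k)) \<in> V"
    and diag: "\<And>l k. l < n \<Longrightarrow> k < n \<Longrightarrow> l \<noteq> k \<Longrightarrow> P $$ (l, k) = 0"
    and diag_nz: "\<And>l. l < n \<Longrightarrow> P $$ (l, l) \<noteq> 0"
    and diag_entries: "\<And>l. l < n \<Longrightarrow> (\<lambda>i. P $$ (l, l)) \<in> V"
begin

lemma gets_A:
  assumes "V \<subseteq> U" "comps n X \<subseteq> U" "\<And>i. i \<in> I \<Longrightarrow> X i \<in> carrier_vec n"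
  shows "gets I U (2 * nnz A) (comps n (\<lambda>i. A *\<^sub>v X i))"
  by (rule gets_mult_mat_vec[OF A]) (use assms zero entries in auto)

lemma Pi_index:
  assumes r: "r \<in> carrier_vec n" and j: "j < n"
  shows "(inv_mat P *\<^sub>v r) $ j = r $ j / P $$ (j, j)"
proof -
  let ?y = "inv_mat P *\<^sub>v r"
  have y: "dim_vec ?y = n" using Pi(1) by simp
  have "r $ j = (P *\<^sub>v ?y) $ j" using P_Pi[OF r] by simp
  also have "\<dots> = (\<Sum>k<n. P $$ (j, k) * ?y $ k)"
    using P j y by (simp add: scalar_prod_def atLeast0LessThan)
  also have "\<dots> = (\<Sum>k\<in>{j}. P $$ (j, k) * ?y $ k)"
    using j diag by (intro sum.mono_neutral_right) auto
  finally show ?thesis using diag_nz[OF j] by simp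
qed

lemma gets_Pi:
  assumes "V \<subseteq> U" "comps n X \<subseteq> U" "\<And>i. i \<in> I \<Longrightarrow> X i \<in> carrier_vec n"
  shows "gets I U (n * 1) (comps n (\<lambda>i. inv_mat P *\<^sub>v X i))"
proof (rule gets_comps)
  fix j assume j: "j < n"
  have "gets I U 1 {\<lambda>i. (\<lambda>i. X i $ j) i / (\<lambda>i. P $$ (j, j)) i}"
    by (rule gets_divide) (use comps_subsetD[OF assms(2) j] diag_entries diag_nz j assms(1) in auto)
  then show "gets I U 1 {\<lambda>i. (inv_mat P *\<^sub>v X i) $ j}"
    by (rule gets_cong_single) (use Pi_index assms(3) j in auto)
qed

text \<open>Three products with \<open>A\<close> cost 6 \<open>nnz A\<close>, two diagonal solves
  2n, five scalar products 10n, three vector updates 6n, and three safe divisions 9. The images of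
  the previous direction are recomputed instead of being carried along.\<close>

lemma gets_orthodir_step:
  assumes U: "V \<subseteq> U" "comps n R \<subseteq> U" "comps n X \<subseteq> U" "comps n p \<subseteq> U" "comps n pp \<subseteq> U"
    and car: "\<And>i. i \<in> I \<Longrightarrow> R i \<in> carrier_vec n" "\<And>i. i \<in> I \<Longrightarrow> X i \<in> carrier_vec n"
      "\<And>i. i \<in> I \<Longrightarrow> p i \<in> carrier_vec n" "\<And>i. i \<in> I \<Longrightarrow> pp i \<in> carrier_vec n"
  shows "gets I U (6 * nnz A + 18 * n + 9)
    (comps n (\<lambda>i. X i + step_length P A (R i) (p i) \<cdot>\<^sub>v p i) \<union> comps n (\<lambda>i. next_dir P A (p i) (pp i)))"
proof -
  define w s t w' s' where "w = (\<lambda>i. A *\<^sub>v p i)" and "s = (\<lambda>i. inv_mat P *\<^sub>v w i)"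
    and "t = (\<lambda>i. A *\<^sub>v s i)" and "w' = (\<lambda>i. A *\<^sub>v pp i)" and "s' = (\<lambda>i. inv_mat P *\<^sub>v w' i)"
  define \<delta> \<delta>' \<mu> \<nu> \<eta> where "\<delta> = (\<lambda>i. w i \<bullet> s i)" and "\<delta>' = (\<lambda>i. w' i \<bullet> s' i)"
    and "\<mu> = (\<lambda>i. t i \<bullet> s i)" and "\<nu> = (\<lambda>i. t i \<bullet> s' i)" and "\<eta> = (\<lambda>i. R i \<bullet> s i)"
  define a b c where "a = (\<lambda>i. \<mu> i / \<delta> i)" and "b = (\<lambda>i. \<nu> i / \<delta>' i)" and "c = (\<lambda>i. \<eta> i / \<delta> i)"
  define h where "h = (\<lambda>i. s i - a i \<cdot>\<^sub>v p i)"
  have [simp]: "w i \<in> carrier_vec n" "s i \<in> carrier_vec n" "t i \<in> carrier_vec n"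
    "w' i \<in> carrier_vec n" "s' i \<in> carrier_vec n" "h i \<in> carrier_vec n" if "i \<in> I" for i
    using car that by (simp_all add: w_def s_def t_def w'_def s'_def h_def)
  \<comment> \<open>The denominators are values of \<open>g\<close> on the diagonal, which supplies
    the sign condition of the safe division.\<close>
  have \<delta>: "0 \<le> \<delta> i" if "i \<in> I" for i
    using g_nonneg[OF car(3)[OF that]] by (simp add: \<delta>_def g_def B_def w_def s_def)
  have \<delta>': "0 \<le> \<delta>' i" if "i \<in> I" for i
    using g_nonneg[OF car(4)[OF that]] by (simp add: \<delta>'_def g_def B_def w'_def s'_def)
  have z: "(\<lambda>i. 0) \<in> U" "(\<lambda>i. 1) \<in> U" using U(1) zero one by auto
  note sub = le_supI1 Un_upper2 order_refl U
  have 0: "gets I U 0 U" by (rule gets_refl) simp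
  have 1: "gets I U (0 + 2 * nnz A) (U \<union> comps n w)"
    unfolding w_def by (rule gets_step[OF 0 gets_A]) (use car U in auto)
  define U1 where "U1 = U \<union> comps n w"
  have 2: "gets I U (0 + 2 * nnz A + n * 1) (U1 \<union> comps n s)"
    unfolding s_def by (rule gets_step[OF 1[folded U1_def] gets_Pi]) (use U in \<open>auto simp: U1_def\<close>)
  define U2 where "U2 = U1 \<union> comps n s"
  have 3: "gets I U (0 + 2 * nnz A + n * 1 + 2 * nnz A) (U2 \<union> comps n t)"
    unfolding t_def by (rule gets_step[OF 2[folded U2_def] gets_A]) (use U in \<open>auto simp: U2_def U1_def\<close>)
  define U3 where "U3 = U2 \<union> comps n t"
  have 4: "gets I U (0 + 2 * nnz A + n * 1 + 2 * nnz A + 2 * nnz A) (U3 \<union> comps n w')"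
    unfolding w'_def by (rule gets_step[OF 3[folded U3_def] gets_A]) (use car U in \<open>auto simp: U3_def U2_def U1_def\<close>)
  define U4 where "U4 = U3 \<union> comps n w'"
  have 5: "gets I U (0 + 2 * nnz A + n * 1 + 2 * nnz A + 2 * nnz A + n * 1) (U4 \<union> comps n s')"
    unfolding s'_def by (rule gets_step[OF 4[folded U4_def] gets_Pi])
      (use U in \<open>auto simp: U4_def U3_def U2_def U1_def\<close>)
  define U5 where "U5 = U4 \<union> comps n s'"
  have 5: "gets I U (6 * nnz A + 2 * n) U5"
    using 5 unfolding U5_def by (rule gets_mono) auto
  have U5: "U \<subseteq> U5" "comps n w \<subseteq> U5" "comps n s \<subseteq> U5" "comps n t \<subseteq> U5" "comps n w' \<subseteq> U5" "comps n s' \<subseteq> U5"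
    by (auto simp: U5_def U4_def U3_def U2_def U1_def)
  have z5: "(\<lambda>i. 0) \<in> U5" using z U5 by auto
  have dots: "gets I U5 (2 * n) {\<delta>}" "gets I U5 (2 * n) {\<delta>'}" "gets I U5 (2 * n) {\<mu>}"
    "gets I U5 (2 * n) {\<nu>}" "gets I U5 (2 * n) {\<eta>}"
    unfolding \<delta>_def \<delta>'_def \<mu>_def \<nu>_def \<eta>_def
    by (rule gets_scalar_prod, use z5 U5 U in auto)+
  have "gets I U5 (2 * n + 2 * n + 2 * n + 2 * n + 2 * n) ({\<delta>} \<union> {\<delta>'} \<union> {\<mu>} \<union> {\<nu>} \<union> {\<eta>})"
    by (intro gets_Un dots)
  from gets_step[OF 5 this] have 6: "gets I U (6 * nnz A + 12 * n) (U5 \<union> {\<delta>, \<delta>', \<mu>, \<nu>, \<eta>})"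
    by (rule gets_mono) auto
  define U6 where "U6 = U5 \<union> {\<delta>, \<delta>', \<mu>, \<nu>, \<eta>}"
  have z6: "(\<lambda>i. 0) \<in> U6" "(\<lambda>i. 1) \<in> U6" using z U5 by (auto simp: U6_def)
  have mem: "\<delta> \<in> U6" "\<delta>' \<in> U6" "\<mu> \<in> U6" "\<nu> \<in> U6" "\<eta> \<in> U6" by (auto simp: U6_def)
  have "gets I U6 3 {a}" "gets I U6 3 {b}" "gets I U6 3 {c}"
    unfolding a_def b_def c_def
    by (rule gets_safe_divide[OF mem(3,1) z6 \<delta>] gets_safe_divide[OF mem(4,2) z6 \<delta>']
        gets_safe_divide[OF mem(5,1) z6 \<delta>], assumption)+
  then have "gets I U6 (3 + 3 + 3) ({a} \<union> {b} \<union> {c})"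
    by (intro gets_Un)
  from gets_step[OF 6[folded U6_def] this] have 7: "gets I U (6 * nnz A + 12 * n + 9) (U6 \<union> {a, b, c})"
    by (rule gets_mono) auto
  define U7 where "U7 = U6 \<union> {a, b, c}"
  have U7: "U \<subseteq> U7" "comps n s \<subseteq> U7" "a \<in> U7" "b \<in> U7" "c \<in> U7"
    using U5 by (auto simp: U7_def U6_def)
  have h: "gets I U7 (n * 2) (comps n h)"
    unfolding h_def by (rule gets_diff_smult) (use U7 U car in auto)
  have "gets I U7 (n * 2) (comps n (\<lambda>i. X i + c i \<cdot>\<^sub>v p i))"
    by (rule gets_add_smult) (use U7 U car in auto)
  from gets_step[OF gets_step[OF 7[folded U7_def] this] gets_mono[OF h]]
  have 8: "gets I U (6 * nnz A + 12 * n + 9 + n * 2 + n * 2)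
     (U7 \<union> comps n (\<lambda>i. X i + c i \<cdot>\<^sub>v p i) \<union> comps n h)" (is "gets I U ?k ?U8") by blast
  have "gets I ?U8 (n * 2) (comps n (\<lambda>i. h i - b i \<cdot>\<^sub>v pp i))"
    by (rule gets_diff_smult) (use U7 U car in auto)
  from gets_step[OF 8 this]
  show ?thesis
  proof (rule gets_mono)
    show "comps n (\<lambda>i. X i + step_length P A (R i) (p i) \<cdot>\<^sub>v p i) \<union> comps n (\<lambda>i. next_dir P A (p i) (pp i))
      \<subseteq> ?U8 \<union> comps n (\<lambda>i. h i - b i \<cdot>\<^sub>v pp i)"
      by (auto simp: step_length_def next_dir_def Let_def h_def a_def b_def c_def \<delta>_def \<delta>'_def
          \<mu>_def \<nu>_def \<eta>_def w_def s_def t_def w'_def s'_def)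
  qed auto
qed

text \<open>The invariant \<open>F\<close> keeps the initial residual, all iterates so far and the
  last two directions. Forming the residual and the first direction costs no more than one regular
  step, hence the factor \<open>k + 1\<close>.\<close>

lemma gets_minres:
  assumes b: "comps n b \<subseteq> V" "\<And>i. i \<in> I \<Longrightarrow> b i \<in> carrier_vec n"
    and x: "comps n x\<^sub>0 \<subseteq> V" "\<And>i. i \<in> I \<Longrightarrow> x\<^sub>0 i \<in> carrier_vec n"
  shows "gets I V ((k + 1) * (6 * nnz A + 18 * n + 9))
    (\<Union>m\<le>k. comps n (\<lambda>i. minres P A (b i) (x\<^sub>0 i) m))"
proof -
  let ?c = "6 * nnz A + 18 * n + 9"
  define R where "R = (\<lambda>i. b i - A *\<^sub>v x\<^sub>0 i)"
  define X where "X m = (\<lambda>i. orthodir P A (b i) (x\<^sub>0 i) m)" for m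
  define D E where "D m = (\<lambda>i. d (R i) m)" and "E m = (\<lambda>i. e (R i) m)" for m
  define F where "F m = V \<union> comps n R \<union> (\<Union>j\<le>m. comps n (X j)) \<union> comps n (D m) \<union> comps n (E m)" for m
  have R: "R i \<in> carrier_vec n" if "i \<in> I" for i using b x that by (simp add: R_def)
  have X: "X m i \<in> carrier_vec n" if "i \<in> I" for i m
    using b x that by (simp add: X_def orthodir_eq)
  have main: "gets I V ((k + 1) * ?c) (F k)"
  proof (induction k)
    case 0
    have 1: "gets I V (0 + 2 * nnz A) (V \<union> comps n (\<lambda>i. A *\<^sub>v x\<^sub>0 i))"
      by (rule gets_step[OF gets_refl gets_A]) (use x in auto)
    define V1 where "V1 = V \<union> comps n (\<lambda>i. A *\<^sub>v x\<^sub>0 i)"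
    have "gets I V1 (n * 1) (comps n R)"
    proof (rule gets_comps)
      fix j assume j: "j < n"
      have "gets I V1 1 {\<lambda>i. (\<lambda>i. b i $ j) i - (\<lambda>i. (A *\<^sub>v x\<^sub>0 i) $ j) i}"
        by (rule gets_diff)
          (use comps_subsetD[OF b(1) j] comps_subsetD[OF order_refl j, of "\<lambda>i. A *\<^sub>v x\<^sub>0 i"]
            in \<open>auto simp: V1_def\<close>)
      then show "gets I V1 1 {\<lambda>i. R i $ j}"
        by (rule gets_cong_single) (use b A j in \<open>auto simp: R_def\<close>)
    qed
    from gets_step[OF 1[folded V1_def] this]
    have 2: "gets I V (0 + 2 * nnz A + n * 1) (V1 \<union> comps n R)" .
    have "gets I (V1 \<union> comps n R) (n * 1) (comps n (\<lambda>i. inv_mat P *\<^sub>v R i))"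
      by (rule gets_Pi) (use R in \<open>auto simp: V1_def\<close>)
    from gets_step[OF 2 this]
    have "gets I V (0 + 2 * nnz A + n * 1 + n * 1) (V1 \<union> comps n R \<union> comps n (\<lambda>i. inv_mat P *\<^sub>v R i))" .
    then have "gets I V ?c (V1 \<union> comps n R \<union> comps n (\<lambda>i. inv_mat P *\<^sub>v R i))"
      by (rule gets_mono) auto
    then have "gets I V ?c (F 0)"
    proof (rule gets_cong)
      fix f assume "f \<in> F 0"
      then consider "f \<in> V \<union> comps n R \<union> comps n (X 0) \<union> comps n (D 0)" | "f \<in> comps n (E 0)"
        unfolding F_def by auto
      then show "\<exists>h\<in>V1 \<union> comps n R \<union> comps n (\<lambda>i. inv_mat P *\<^sub>v R i). \<forall>i\<in>I. f i = h i"
      proof cases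
        case 1
        moreover have "comps n (X 0) \<subseteq> V" using x by (simp add: X_def)
        moreover have "D 0 = (\<lambda>i. inv_mat P *\<^sub>v R i)" by (simp add: D_def d_0)
        ultimately have "f \<in> V1 \<union> comps n R \<union> comps n (\<lambda>i. inv_mat P *\<^sub>v R i)" by (auto simp: V1_def)
        then show ?thesis by blast
      next
        case 2
        \<comment> \<open>The zero vector that precedes the first direction is never written; each
          of its components is represented by the stored constant 0.\<close>
        then have "\<forall>i\<in>I. f i = 0" using R by (auto simp: comps_def E_def e_0)
        then show ?thesis using zero by (intro bexI[of _ "\<lambda>i. 0"]) (auto simp: V1_def)
      qed
    qed
    then show ?case by simp
  next
    case (Suc k)
    have "gets I (F k) ?c (comps n (\<lambda>i. X k i + step_length P A (R i) (D k i) \<cdot>\<^sub>v D k i)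
        \<union> comps n (\<lambda>i. next_dir P A (D k i) (E k i)))"
      by (rule gets_orthodir_step) (use R X in \<open>auto simp: F_def D_def E_def\<close>)
    from gets_step[OF Suc this]
    show ?case
    proof (rule gets_mono)
      have "(\<lambda>i. X k i + step_length P A (R i) (D k i) \<cdot>\<^sub>v D k i) = X (Suc k)"
        by (simp add: X_def D_def d_def R_def Let_def)
      moreover have "(\<lambda>i. next_dir P A (D k i) (E k i)) = D (Suc k)" "E (Suc k) = D k"
        by (simp_all add: D_def E_def d_def e_def)
      ultimately show "F (Suc k) \<subseteq> F k \<union> (comps n (\<lambda>i. X k i + step_length P A (R i) (D k i) \<cdot>\<^sub>v D k i)
        \<union> comps n (\<lambda>i. next_dir P A (D k i) (E k i)))"
        by (auto simp: F_def atMost_Suc)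
    qed auto
  qed
  then show ?thesis
  proof (rule gets_cong)
    fix f assume "f \<in> (\<Union>m\<le>k. comps n (\<lambda>i. minres P A (b i) (x\<^sub>0 i) m))"
    then obtain m j where mj: "m \<le> k" "j < n" "f = (\<lambda>i. minres P A (b i) (x\<^sub>0 i) m $ j)"
      by (auto simp: comps_def)
    then have "\<forall>i\<in>I. f i = X m i $ j" using b x by (simp add: X_def minres_eq_orthodir)
    moreover have "(\<lambda>i. X m i $ j) \<in> F k"
      using comps_subsetD[OF order_refl mj(2), of "X m"] mj(1) by (auto simp: F_def)
    ultimately show "\<exists>h\<in>F k. \<forall>i\<in>I. f i = h i" by (intro bexI[of _ "\<lambda>i. X m i $ j"]) auto
  qed
qed

end

end

section \<open>Affine functions on simplices and integration over a mesh\<close>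

lemma absolutely_integrable_on_bounded:
  fixes f :: "'a::euclidean_space \<Rightarrow> real"
  assumes "bounded T" "T \<in> sets lebesgue" "continuous_on UNIV f"
  shows "f absolutely_integrable_on T"
proof -
  obtain a where "T \<subseteq> cbox (-a) a" using bounded_subset_cbox_symmetric[OF assms(1)] by blast
  moreover have "f absolutely_integrable_on cbox (-a) a"
    by (rule absolutely_integrable_continuous) (rule continuous_on_subset[OF assms(3)], simp)
  ultimately show ?thesis
    using assms(2) set_integrable_subset by blast
qed

lemma compact_sets_lebesgue: "compact T \<Longrightarrow> T \<in> sets lebesgue"
  by (simp add: lmeasurable_compact fmeasurableD)

lemma affine_square_integrable:
  fixes T :: "'a::euclidean_space set"
  assumes "compact T"
  shows "(\<lambda>y. (inner a y + b)\<^sup>2) absolutely_integrable_on T"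
  using assms by (intro absolutely_integrable_on_bounded compact_imp_bounded compact_sets_lebesgue continuous_intros)

text \<open>On the copy of \<open>T\<close> shrunk towards the maximum point, the modulus is at
  least 3/4 - 1/4 of its maximum. Squaring gives the factor 1/4, and the volume of the copy gives
  (1/4)^d. The constant is independent of the shape of \<open>T\<close>, so no reference cell
  appears.\<close>

lemma integral_affine_square_ge:
  fixes T :: "'a::euclidean_space set"
  assumes T: "compact T" "convex T" and x: "x \<in> T"
  shows "(1 / 4) ^ DIM('a) / 4 * measure lebesgue T * (inner a x + b)\<^sup>2
    \<le> integral T (\<lambda>y. (inner a y + b)\<^sup>2)"
proof -
  define v where "v y = inner a y + b" for y
  have "continuous_on T (\<lambda>y. \<bar>v y\<bar>)" unfolding v_def by (intro continuous_intros)
  then obtain x\<^sub>0 where x0: "x\<^sub>0 \<in> T" and max: "\<And>y. y \<in> T \<Longrightarrow> \<bar>v y\<bar> \<le> \<bar>v x\<^sub>0\<bar>"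
    using continuous_attains_sup[OF T(1)] x by blast
  define S where "S = (\<lambda>y. (1/4) *\<^sub>R y + (3/4) *\<^sub>R x\<^sub>0) ` T"
  have S: "S \<subseteq> T"
    unfolding S_def using convexD[OF T(2) _ x0, of _ "1/4" "3/4"] by auto
  have cS: "compact S"
    unfolding S_def by (intro compact_continuous_image T continuous_intros)
  have mS: "measure lebesgue S = (1 / 4) ^ DIM('a) * measure lebesgue T"
    unfolding S_def using measure_lebesgue_affine[of "1/4" "(3/4) *\<^sub>R x\<^sub>0" T] by simp
  have low: "(v x\<^sub>0)\<^sup>2 / 4 \<le> (v z)\<^sup>2" if z: "z \<in> S" for z
  proof -
    obtain y where y: "y \<in> T" "z = (1/4) *\<^sub>R y + (3/4) *\<^sub>R x\<^sub>0" using z by (auto simp: S_def)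
    have "v z = v y / 4 + 3 / 4 * v x\<^sub>0"
      unfolding v_def y by (simp add: inner_add_right field_simps)
    then have "\<bar>v x\<^sub>0\<bar> / 2 \<le> \<bar>v z\<bar>" using max[OF y(1)] by linarith
    then have "(\<bar>v x\<^sub>0\<bar> / 2)\<^sup>2 \<le> \<bar>v z\<bar>\<^sup>2" by (intro power_mono) auto
    then show ?thesis by (simp add: power_divide)
  qed
  have "(1 / 4) ^ DIM('a) / 4 * measure lebesgue T * (v x)\<^sup>2 \<le> measure lebesgue S * ((v x\<^sub>0)\<^sup>2 / 4)"
    unfolding mS using power_mono[OF max[OF x], of 2] by (simp add: mult_left_mono)
  also have "\<dots> = integral S (\<lambda>y. (v x\<^sub>0)\<^sup>2 / 4)"
    using cS integral_mult_left[of S "\<lambda>_. 1" "(v x\<^sub>0)\<^sup>2 / 4"]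
    by (simp add: lmeasurable_compact lmeasure_integral del: integral_mult_left)
  also have "\<dots> \<le> integral S (\<lambda>y. (v y)\<^sup>2)"
  proof (rule integral_le)
    show "(\<lambda>y. (v x\<^sub>0)\<^sup>2 / 4) integrable_on S"
      using cS by (intro integrable_on_const lmeasurable_compact)
    show "(\<lambda>y. (v y)\<^sup>2) integrable_on S"
      unfolding v_def using affine_square_integrable[OF cS] by (rule set_lebesgue_integral_eq_integral)
  qed (use low in auto)
  also have "\<dots> \<le> integral T (\<lambda>y. (v y)\<^sup>2)"
    using affine_square_integrable[OF cS] affine_square_integrable[OF T(1)]
    by (intro integral_subset_le S) (auto simp: v_def set_lebesgue_integral_eq_integral)
  finally show ?thesis unfolding v_def .
qed

text \<open>At the two antipodal points z + y and z - y of the ball, with y pointing along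
  \<open>a\<close>, the values differ by 2 |a| r, and each is at most s in modulus.\<close>

lemma affine_slope_bound:
  assumes "cball z r \<subseteq> T" "0 \<le> r" and le: "\<And>x. x \<in> T \<Longrightarrow> \<bar>inner a x + b\<bar> \<le> s"
  shows "norm a * r \<le> s"
proof (cases "a = 0")
  case True
  have "z \<in> T" using assms(1,2) by auto
  then have "0 \<le> s" using le[of z] by linarith
  then show ?thesis using True by simp
next
  case False
  let ?y = "(r / norm a) *\<^sub>R a"
  have "norm ?y = r" using False assms(2) by simp
  then have "z + ?y \<in> T" "z - ?y \<in> T" using assms(1) by (auto simp: dist_norm)
  then have "\<bar>inner a (z + ?y) + b\<bar> \<le> s" "\<bar>inner a (z - ?y) + b\<bar> \<le> s" using le by auto
  moreover have "inner a ?y = norm a * r"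
    using False by (simp add: power2_norm_eq_inner[symmetric] power2_eq_square)
  ultimately show ?thesis unfolding inner_add_right inner_diff_right by linarith
qed

text \<open>Points just below the graph do not belong to the closure, so a boundary point cannot be
  interior to it.\<close>

lemma lipschitz_domain_interior_closure:
  assumes "lipschitz_domain \<Omega>"
  shows "interior (closure \<Omega>) \<subseteq> \<Omega>"
proof
  fix x assume x: "x \<in> interior (closure \<Omega>)"
  show "x \<in> \<Omega>"
  proof (rule ccontr)
    assume nx: "x \<notin> \<Omega>"
    have op: "open \<Omega>" using assms by (simp add: lipschitz_domain_def)
    have "x \<in> frontier \<Omega>"
      using x nx op interior_subset[of "closure \<Omega>"] by (auto simp: frontier_def interior_open)
    then obtain r e g L where r: "r > 0" and e: "norm e = 1" and g: "L-lipschitz_on {z. inner z e = 0} g"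
      and graph: "\<And>y. y \<in> ball x r \<Longrightarrow> y \<in> \<Omega> \<longleftrightarrow> g (y - inner y e *\<^sub>R e) < inner y e"
      using assms unfolding lipschitz_domain_def by blast
    obtain \<delta> where \<delta>: "\<delta> > 0" "ball x \<delta> \<subseteq> closure \<Omega>"
      using x mem_interior by blast
    have ee: "inner e e = 1" using e by (simp add: norm_eq_1)
    define t where "t = min r \<delta> / 2"
    define y where "y = x - t *\<^sub>R e"
    have t: "0 < t" "t < r" "t < \<delta>" using r \<delta>(1) by (auto simp: t_def)
    have d: "dist x y = t" using t e by (simp add: y_def dist_norm)
    \<comment> \<open>\<open>F\<close> is positive exactly below the graph, an open condition. It
      holds at y, so a neighbourhood of y misses the domain, although y lies in its closure.\<close>
    define F where "F z = g (z - inner z e *\<^sub>R e) - inner z e" for z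
    have "continuous_on UNIV (\<lambda>z. g (z - inner z e *\<^sub>R e))"
    proof (rule continuous_on_compose2[OF lipschitz_on_continuous_on[OF g]])
      show "continuous_on UNIV (\<lambda>z. z - inner z e *\<^sub>R e)" by (intro continuous_intros)
      show "range (\<lambda>z. z - inner z e *\<^sub>R e) \<subseteq> {z. inner z e = 0}"
        by (auto simp: inner_diff_left ee)
    qed
    then have "continuous_on UNIV F" unfolding F_def by (intro continuous_intros)
    then have opF: "open {z. 0 < F z}" by (intro open_Collect_less continuous_intros)
    have "\<not> g (x - inner x e *\<^sub>R e) < inner x e" using graph[of x] nx r by simp
    moreover have ye: "inner y e = inner x e - t"
      by (simp add: y_def inner_diff_left ee)
    moreover have "y - inner y e *\<^sub>R e = x - inner x e *\<^sub>R e"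
      unfolding ye by (simp add: y_def scaleR_diff_left)
    ultimately have "0 < F y" using t(1) by (simp add: F_def)
    then have "y \<in> ball x r \<inter> {z. 0 < F z}" using d t by simp
    moreover have "open (ball x r \<inter> {z. 0 < F z})" using opF by auto
    moreover have "y \<in> closure \<Omega>" using \<delta> d t by auto
    ultimately obtain z where "z \<in> \<Omega>" "z \<in> ball x r" "0 < F z"
      using open_Int_closure_eq_empty[of "ball x r \<inter> {z. 0 < F z}" \<Omega>] by blast
    then show False using graph[of z] by (simp add: F_def)
  qed
qed

text \<open>The cell interiors exhaust the domain up to frontiers of convex sets, which are null
  sets. Requiring agreement with \<open>G T\<close> only in the interior is what admits gradients,
  which jump across faces.\<close>

lemma integral_piecewise:
  fixes \<Omega> :: "'a::euclidean_space set" and g :: "'a \<Rightarrow> real"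
  assumes fin: "finite \<T>" and T: "\<And>T. T \<in> \<T> \<Longrightarrow> compact T \<and> convex T"
    and disj: "\<And>T T'. T \<in> \<T> \<Longrightarrow> T' \<in> \<T> \<Longrightarrow> T \<noteq> T' \<Longrightarrow> interior T \<inter> interior T' = {}"
    and sub: "\<And>T. T \<in> \<T> \<Longrightarrow> interior T \<subseteq> \<Omega>" and cov: "\<Omega> \<subseteq> \<Union>\<T>" and op: "open \<Omega>"
    and cont: "\<And>T. T \<in> \<T> \<Longrightarrow> continuous_on UNIV (G T)"
    and eq: "\<And>T x. T \<in> \<T> \<Longrightarrow> x \<in> interior T \<Longrightarrow> g x = G T x"
  shows "(LINT x|lebesgue_on \<Omega>. g x) = (\<Sum>T\<in>\<T>. integral T (G T))"
proof -
  let ?U = "\<Union>T\<in>\<T>. interior T"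
  have negfr: "negligible (frontier T)" if "T \<in> \<T>" for T
    using T[OF that] by (simp add: negligible_convex_frontier)
  have diff: "T - interior T \<subseteq> frontier T" if "T \<in> \<T>" for T
    using T[OF that] by (auto simp: frontier_def compact_imp_closed)
  have neg: "negligible (\<Omega> - ?U)"
  proof (rule negligible_subset)
    show "negligible (\<Union>T\<in>\<T>. frontier T)" using fin negfr by (intro negligible_Union) auto
    show "\<Omega> - ?U \<subseteq> (\<Union>T\<in>\<T>. frontier T)" using cov diff by blast
  qed
  have abs1: "g absolutely_integrable_on interior T" if "T \<in> \<T>" for T
  proof (rule absolutely_integrable_spike[where f = "G T" and S = "{}"])
    show "G T absolutely_integrable_on interior T"
      using T[OF that] cont[OF that]
      by (intro absolutely_integrable_on_bounded) (auto intro: bounded_interior compact_imp_bounded)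
  qed (use eq that in auto)
  have absU: "g absolutely_integrable_on (\<Union>T\<in>\<T>'. interior T)" if "\<T>' \<subseteq> \<T>" for \<T>'
    using finite_subset[OF that fin] that
  proof (induction \<T>')
    case (insert T \<T>')
    then show ?case using abs1 by (auto intro!: absolutely_integrable_Un)
  qed simp
  have hasT: "(g has_integral integral T (G T)) (interior T)" if "T \<in> \<T>" for T
  proof -
    have "integral (interior T) g = integral (interior T) (G T)"
      using eq that by (intro integral_cong) auto
    also have "\<dots> = integral T (G T)"
    proof (rule integral_spike_set)
      show "negligible {x \<in> interior T - T. G T x \<noteq> 0}" 
        by (rule negligible_subset[of "{}"]) (use interior_subset[of T] in auto)
      show "negligible {x \<in> T - interior T. G T x \<noteq> 0}"
        by (rule negligible_subset[OF negfr[OF that]]) (use diff[OF that] in auto)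
    qed
    finally show ?thesis
      using abs1[OF that] by (metis has_integral_integral set_lebesgue_integral_eq_integral(1))
  qed
  have hasU: "(g has_integral (\<Sum>T\<in>\<T>. integral T (G T))) ?U"
    using fin hasT disj by (intro has_integral_UN) (auto simp: pairwise_def)
  have U: "negligible {x \<in> ?U - \<Omega>. g x \<noteq> 0}" "negligible {x \<in> \<Omega> - ?U. g x \<noteq> 0}"
    using sub by (auto intro: negligible_subset[OF neg] simp: empty_def[symmetric] Diff_eq)
  have "g absolutely_integrable_on \<Omega>"
    by (rule absolutely_integrable_spike_set[OF absU[OF order_refl] U])
  then have "integrable (lebesgue_on \<Omega>) g"
    using op by (simp add: integrable_restrict_space set_integrable_def)
  then have "(LINT x|lebesgue_on \<Omega>. g x) = integral \<Omega> g"
    using op by (intro lebesgue_integral_eq_integral) auto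
  also have "\<dots> = integral ?U g"
    using U by (intro integral_spike_set)
  also have "\<dots> = (\<Sum>T\<in>\<T>. integral T (G T))"
    using hasU by (rule integral_unique)
  finally show ?thesis .
qed

section \<open>Geometry and cellwise estimates on one mesh\<close>

locale fe_discretisation =
  fixes \<Omega> :: "'a::euclidean_space set" and \<sigma> \<tau> :: real and m :: "'a fe_mesh"
  assumes lip: "lipschitz_domain \<Omega>" and \<sigma>: "\<sigma> > 0" and \<tau>: "\<tau> > 0" and mesh: "m \<in> fe_meshes \<Omega> \<sigma> \<tau>"
begin

abbreviation "N \<equiv> num_dofs m"
abbreviation "vol T \<equiv> measure lebesgue (T :: 'a set)"

lemma admissible: "triangulation (cells m)" "\<And>T. T \<in> cells m \<Longrightarrow> int DIM('a) simplex T"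
    "\<Union>(cells m) = closure \<Omega>"
  and regular: "shape_regular \<sigma> (cells m)" and uniform: "quasi_uniform \<tau> (cells m)"
  and basis: "nodal_basis \<Omega> (cells m) (nodes m) (hat m)"
  using mesh unfolding fe_meshes_def admissible_decomposition_def by auto

lemma open_domain: "open \<Omega>" and domain_nonempty: "\<Omega> \<noteq> {}"
  using lip by (auto simp: lipschitz_domain_def)

lemma finite_cells: "finite (cells m)"
  using admissible(1) by (simp add: triangulation_def)

lemma cells_nonempty: "cells m \<noteq> {}"
  using admissible(3) domain_nonempty closure_subset[of \<Omega>] by auto

lemma compact_cell: "T \<in> cells m \<Longrightarrow> compact T"
  and convex_cell: "T \<in> cells m \<Longrightarrow> convex T"
  using admissible(2) compact_simplex convex_simplex by blast+

lemma cell_extreme_points: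
  assumes "T \<in> cells m"
  shows "finite {x. x extreme_point_of T}" "card {x. x extreme_point_of T} = DIM('a) + 1"
    "T = convex hull {x. x extreme_point_of T}"
proof -
  obtain C where C: "\<not> affine_dependent C" "int (card C) = int DIM('a) + 1" "T = convex hull C"
    using admissible(2)[OF assms] unfolding simplex_def by blast
  have "{x. x extreme_point_of T} = C"
    using extreme_point_of_convex_hull_affine_independent[OF C(1)] C(3) by auto
  with C show "finite {x. x extreme_point_of T}" "card {x. x extreme_point_of T} = DIM('a) + 1"
    "T = convex hull {x. x extreme_point_of T}"
    by (auto simp: aff_independent_finite)
qed

lemma diameter_cell_pos:
  assumes "T \<in> cells m"
  shows "0 < diameter T"
proof -
  let ?E = "{x. x extreme_point_of T}"
  have "Suc 0 < card ?E" using cell_extreme_points(2)[OF assms] by simp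
  then obtain x y where "x \<in> ?E" "y \<in> ?E" "x \<noteq> y"
    by (metis card_le_Suc0_iff_eq cell_extreme_points(1)[OF assms] not_le)
  then have "x \<in> T" "y \<in> T" "0 < dist x y" by (auto simp: extreme_point_of_def)
  then show ?thesis
    using diameter_bounded_bound[OF compact_imp_bounded[OF compact_cell[OF assms]], of x y] by linarith
qed

lemma diameter_le_mesh_size: "T \<in> cells m \<Longrightarrow> diameter T \<le> mesh_size m"
  unfolding mesh_size_def using finite_cells by simp

lemma mesh_size_pos: "0 < mesh_size m"
  using cells_nonempty diameter_cell_pos diameter_le_mesh_size by (metis all_not_in_conv less_le_trans)

lemma mesh_size_le:
  assumes "T \<in> cells m"
  shows "mesh_size m \<le> \<tau> * diameter T"
proof -
  have "mesh_size m \<in> diameter ` cells m"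
    unfolding mesh_size_def using finite_cells cells_nonempty by (intro Max_in) auto
  then obtain T' where T': "T' \<in> cells m" "mesh_size m = diameter T'" by auto
  have "diameter T' \<le> \<tau> * diameter T" using uniform T'(1) assms unfolding quasi_uniform_def by blast
  then show ?thesis using T'(2) by simp
qed

lemma inscribed_ball:
  assumes "T \<in> cells m"
  obtains z where "cball z (diameter T / \<sigma>) \<subseteq> T"
  using regular assms unfolding shape_regular_def by blast

text \<open>A face that meets the interior of a convex set is the whole set. If the interiors met,
  the common face would equal both cells.\<close>

lemma interiors_disjoint:
  assumes "T \<in> cells m" "T' \<in> cells m" "T \<noteq> T'"
  shows "interior T \<inter> interior T' = {}"
proof (rule ccontr)
  assume ne: "interior T \<inter> interior T' \<noteq> {}"
  have "(T' \<inter> T) face_of T'" and f1: "(T \<inter> T') face_of T"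
    using admissible(1) assms unfolding triangulation_def by blast+
  then have f: "(T \<inter> T') face_of T" "(T \<inter> T') face_of T'" by (simp_all add: Int_commute)
  have "T \<inter> T' = T" "T \<inter> T' = T'"
    using face_of_disjoint_interior[OF f(1)] face_of_disjoint_interior[OF f(2)] ne interior_subset
    by blast+
  then show False using assms(3) by simp
qed

text \<open>The cells are only known to fill the closure. On a slit domain a cell interior could
  cross the boundary; the Lipschitz property excludes this.\<close>

lemma interior_cell_subset: "T \<in> cells m \<Longrightarrow> interior T \<subseteq> \<Omega>"
  using lipschitz_domain_interior_closure[OF lip] admissible(3) interior_mono[of T "closure \<Omega>"] by blast

lemma LINT_piecewise:
  fixes G :: "'a set \<Rightarrow> 'a \<Rightarrow> real"
  assumes "\<And>T. T \<in> cells m \<Longrightarrow> continuous_on UNIV (G T)"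
    and "\<And>T x. T \<in> cells m \<Longrightarrow> x \<in> interior T \<Longrightarrow> f x = G T x"
  shows "(LINT x|lebesgue_on \<Omega>. f x) = (\<Sum>T\<in>cells m. integral T (G T))"
proof (rule integral_piecewise[where G = G])
  show "\<Omega> \<subseteq> \<Union>(cells m)" using admissible(3) closure_subset by simp
qed (use assms finite_cells compact_cell convex_cell interiors_disjoint interior_cell_subset open_domain in auto)

lemma hat_p1: "k < N \<Longrightarrow> hat m k \<in> p1_space \<Omega> (cells m)"
  and hat_node: "k < N \<Longrightarrow> l < N \<Longrightarrow> hat m k (nodes m ! l) = (if k = l then 1 else 0)"
  and nodes_set: "set (nodes m) = vertices (cells m) \<inter> \<Omega>" and distinct_nodes: "distinct (nodes m)"
  using basis unfolding nodal_basis_def num_dofs_def by auto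

definition slope :: "'a set \<Rightarrow> nat \<Rightarrow> 'a" where
  "slope T k = (SOME a. \<exists>b. \<forall>x\<in>T. hat m k x = inner a x + b)"

definition offset :: "'a set \<Rightarrow> nat \<Rightarrow> real" where
  "offset T k = (SOME b. \<forall>x\<in>T. hat m k x = inner (slope T k) x + b)"

lemma hat_eq:
  assumes "k < N" "T \<in> cells m" "x \<in> T"
  shows "hat m k x = inner (slope T k) x + offset T k"
proof -
  have "\<exists>a b. \<forall>x\<in>T. hat m k x = inner a x + b"
    using hat_p1[OF assms(1)] assms(2) unfolding p1_space_def by blast
  then have "\<exists>b. \<forall>x\<in>T. hat m k x = inner (slope T k) x + b"
    unfolding slope_def by (rule someI_ex)
  then have "\<forall>x\<in>T. hat m k x = inner (slope T k) x + offset T k"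
    unfolding offset_def by (rule someI_ex)
  then show ?thesis using assms(3) by blast
qed

lemma grad_hat:
  assumes "k < N" "T \<in> cells m" "x \<in> interior T"
  shows "grad (hat m k) x = slope T k"
proof -
  have "((\<lambda>y. inner (slope T k) y + offset T k) has_derivative (\<lambda>h. inner (slope T k) h)) (at x)"
    by (auto intro!: derivative_eq_intros)
  moreover have "hat m k y = inner (slope T k) y + offset T k" if "y \<in> interior T" for y
    using hat_eq[OF assms(1,2)] that interior_subset by blast
  ultimately have "(hat m k has_derivative (\<lambda>h. inner (slope T k) h)) (at x)"
    using has_derivative_transform_within_open[of _ _ x UNIV "interior T" "hat m k"] assms(3) by simp
  then have G: "GDERIV (hat m k) x :> slope T k"
    by (simp add: gderiv_def inner_commute)
  show ?thesis
    unfolding grad_def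
  proof (rule the_equality)
    show "GDERIV (hat m k) x :> slope T k" by (rule G)
    fix D assume "GDERIV (hat m k) x :> D"
    then have "(\<lambda>h. inner h D) = (\<lambda>h. inner h (slope T k))"
      using G unfolding gderiv_def by (rule has_derivative_unique)
    then have "inner h D = inner h (slope T k)" for h by (rule fun_cong)
    then show "D = slope T k" using vector_eq_ldot by blast
  qed
qed

lemma mass_entry:
  assumes "l < N" "k < N"
  shows "mass_matrix \<Omega> m $$ (l, k) = (\<Sum>T\<in>cells m. integral T
    (\<lambda>x. (inner (slope T k) x + offset T k) * (inner (slope T l) x + offset T l)))"
proof -
  have "mass_matrix \<Omega> m $$ (l, k) = (LINT x|lebesgue_on \<Omega>. hat m k x * hat m l x)"
    using assms by (simp add: mass_matrix_def)
  also have "\<dots> = (\<Sum>T\<in>cells m. integral T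
    (\<lambda>x. (inner (slope T k) x + offset T k) * (inner (slope T l) x + offset T l)))"
    by (rule LINT_piecewise)
      (use hat_eq[OF assms(1) _ subsetD[OF interior_subset]] hat_eq[OF assms(2) _ subsetD[OF interior_subset]]
        in \<open>auto intro!: continuous_intros\<close>)
  finally show ?thesis .
qed

lemma stiffness_entry:
  assumes "l < N" "k < N"
  shows "stiffness_matrix \<Omega> m $$ (l, k) = (\<Sum>T\<in>cells m. vol T * inner (slope T k) (slope T l))"
proof -
  have "stiffness_matrix \<Omega> m $$ (l, k) =
      (LINT x|lebesgue_on \<Omega>. inner (grad (hat m k) x) (grad (hat m l) x))"
    using assms by (simp add: stiffness_matrix_def)
  also have "\<dots> = (\<Sum>T\<in>cells m. integral T (\<lambda>x. inner (slope T k) (slope T l)))"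
    by (rule LINT_piecewise) (use grad_hat assms in auto)
  also have "\<dots> = (\<Sum>T\<in>cells m. vol T * inner (slope T k) (slope T l))"
  proof (rule sum.cong[OF refl])
    fix T assume "T \<in> cells m"
    then show "integral T (\<lambda>x. inner (slope T k) (slope T l)) = vol T * inner (slope T k) (slope T l)"
      using integral_mult_left[of T "\<lambda>_. 1" "inner (slope T k) (slope T l)"] compact_cell
      by (simp add: lmeasurable_compact lmeasure_integral del: integral_mult_left)
  qed
  finally show ?thesis .
qed

text \<open>\<open>loc T c\<close> is the finite element function with coefficients c on
  \<open>T\<close>, continued affinely to the whole space so that half-space arguments need no
  restriction. \<open>local_dofs\<close> omits boundary vertices, where the function vanishes.
  Coefficients are plain functions, which allows unit coefficients without forming vectors.\<close>

definition "local_slope T c = (\<Sum>k<N. c k *\<^sub>R slope T k)"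
definition "local_offset T c = (\<Sum>k<N. c k * offset T k)"
definition "loc T c x = inner (local_slope T c) x + local_offset T c"
definition "local_dofs T = {k. k < N \<and> (nodes m ! k) extreme_point_of T}"
definition "nodal_sum T (c :: nat \<Rightarrow> real) = (\<Sum>k\<in>local_dofs T. (c k)\<^sup>2)"

lemma loc_sum: "loc T c x = (\<Sum>k<N. c k * (inner (slope T k) x + offset T k))"
  by (simp add: loc_def local_slope_def local_offset_def inner_sum_left sum.distrib algebra_simps)

lemma loc_eq: "T \<in> cells m \<Longrightarrow> x \<in> T \<Longrightarrow> loc T c x = (\<Sum>k<N. c k * hat m k x)"
  by (simp add: loc_sum hat_eq)

lemma finite_local_dofs: "finite (local_dofs T)"
  by (simp add: local_dofs_def)

lemma nodal_sum_nonneg: "0 \<le> nodal_sum T c"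
  by (simp add: nodal_sum_def sum_nonneg)

lemma card_local_dofs:
  assumes "T \<in> cells m"
  shows "card (local_dofs T) \<le> DIM('a) + 1"
proof -
  have "inj_on ((!) (nodes m)) (local_dofs T)"
    using distinct_nodes by (auto simp: inj_on_def local_dofs_def num_dofs_def nth_eq_iff_index_eq)
  then have "card (local_dofs T) = card ((!) (nodes m) ` local_dofs T)"
    by (simp add: card_image)
  also have "\<dots> \<le> card {x. x extreme_point_of T}"
    by (rule card_mono[OF cell_extreme_points(1)[OF assms]]) (auto simp: local_dofs_def)
  finally show ?thesis using cell_extreme_points(2)[OF assms] by simp
qed

lemma loc_node:
  assumes "T \<in> cells m" "k \<in> local_dofs T"
  shows "loc T c (nodes m ! k) = c k"
proof -
  have k: "k < N" "nodes m ! k \<in> T" using assms(2) by (auto simp: local_dofs_def extreme_point_of_def)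
  have "loc T c (nodes m ! k) = (\<Sum>l<N. c l * (if l = k then 1 else 0))"
    using k by (simp add: loc_eq[OF assms(1)] hat_node)
  also have "\<dots> = c k" using k(1) by (simp add: if_distrib cong: if_cong)
  finally show ?thesis .
qed

text \<open>The slab between two levels of an affine function is convex, so checking the vertices
  suffices. At a node the value is a single coefficient, at a boundary vertex it is 0.\<close>

lemma abs_loc_le:
  assumes T: "T \<in> cells m" and x: "x \<in> T"
  shows "\<bar>loc T c x\<bar> \<le> sqrt (nodal_sum T c)"
proof -
  let ?s = "sqrt (nodal_sum T c)" and ?E = "{x. x extreme_point_of T}"
  let ?W = "{y. loc T c y \<le> ?s} \<inter> {y. - ?s \<le> loc T c y}"
  have "convex ?W"
  proof -
    have "?W = {y. inner (local_slope T c) y \<le> ?s - local_offset T c} \<inter> {y. inner (local_slope T c) y \<ge> - ?s - local_offset T c}"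
      by (auto simp: loc_def)
    then show ?thesis by (simp add: convex_Int convex_halfspace_le convex_halfspace_ge)
  qed
  moreover have "?E \<subseteq> ?W"
  proof
    fix y assume "y \<in> ?E"
    then have y: "y extreme_point_of T" "y \<in> T" by (auto simp: extreme_point_of_def)
    have "\<bar>loc T c y\<bar> \<le> ?s"
    proof (cases "y \<in> \<Omega>")
      case True
      then have "y \<in> set (nodes m)" using y T unfolding nodes_set vertices_def by auto
      then obtain k where k: "k < N" "y = nodes m ! k" by (auto simp: in_set_conv_nth num_dofs_def)
      then have kl: "k \<in> local_dofs T" using y by (simp add: local_dofs_def)
      have "(c k)\<^sup>2 \<le> nodal_sum T c"
        unfolding nodal_sum_def by (rule member_le_sum[OF kl]) (auto simp: finite_local_dofs)
      then show ?thesis using loc_node[OF T kl, of c] k(2) by (simp add: real_le_rsqrt abs_le_square_iff)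
    next
      case False
      have "y \<in> closure \<Omega>" using y(2) T admissible(3) by blast
      then have "y \<in> frontier \<Omega>" using False open_domain by (simp add: frontier_def interior_open)
      then have "hat m k y = 0" if "k < N" for k using hat_p1[OF that] unfolding p1_space_def by blast
      then have "loc T c y = 0" using loc_eq[OF T y(2)] by simp
      then show ?thesis using nodal_sum_nonneg by simp
    qed
    then show "y \<in> ?W" by auto
  qed
  ultimately have "convex hull ?E \<subseteq> ?W" by (rule hull_minimal[rotated])
  then show ?thesis using x cell_extreme_points(3)[OF T] by (auto simp: abs_le_iff)
qed

lemma loc_square_le: "T \<in> cells m \<Longrightarrow> x \<in> T \<Longrightarrow> (loc T c x)\<^sup>2 \<le> nodal_sum T c"
  using abs_loc_le[of T x c] nodal_sum_nonneg[of T c] by (metis abs_ge_zero power2_abs power_mono real_sqrt_pow2)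

text \<open>The inverse inequality on one cell: the inscribed ball bounds the slope in terms of
  diameter over sigma, and quasi-uniformity replaces the diameter by h at the price of tau.\<close>

lemma slope_bound:
  assumes T: "T \<in> cells m"
  shows "(mesh_size m)\<^sup>2 * (norm (local_slope T c))\<^sup>2 \<le> (\<sigma> * \<tau>)\<^sup>2 * nodal_sum T c"
proof -
  let ?n = "norm (local_slope T c)" and ?s = "sqrt (nodal_sum T c)"
  obtain z where z: "cball z (diameter T / \<sigma>) \<subseteq> T" using inscribed_ball[OF T] .
  have "?n * (diameter T / \<sigma>) \<le> ?s"
    using affine_slope_bound[OF z, of "local_slope T c" "local_offset T c" ?s] abs_loc_le[OF T, of _ c]
      diameter_cell_pos[OF T] \<sigma> by (simp add: loc_def)
  then have "diameter T * ?n \<le> \<sigma> * ?s" using \<sigma> by (simp add: field_simps)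
  then have "\<tau> * (diameter T * ?n) \<le> \<tau> * (\<sigma> * ?s)" using \<tau> by simp
  moreover have "mesh_size m * ?n \<le> \<tau> * diameter T * ?n"
    using mesh_size_le[OF T] by (intro mult_right_mono) auto
  ultimately have "mesh_size m * ?n \<le> \<sigma> * \<tau> * ?s" by (simp add: mult_ac)
  then have "(mesh_size m * ?n)\<^sup>2 \<le> (\<sigma> * \<tau> * ?s)\<^sup>2"
    using mesh_size_pos by (intro power_mono) auto
  then show ?thesis using nodal_sum_nonneg by (simp add: power_mult_distrib)
qed

end

lemma quadratic_form_sum:
  assumes A: "A \<in> carrier_mat n n" and c: "c \<in> carrier_vec n"
    and entry: "\<And>l k. l < n \<Longrightarrow> k < n \<Longrightarrow> A $$ (l, k) = (\<Sum>T\<in>\<T>. F T l k)"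
  shows "(A *\<^sub>v c) \<bullet> c = (\<Sum>T\<in>\<T>. \<Sum>l<n. \<Sum>k<n. F T l k * c $ k * c $ l :: real)"
proof -
  have "(A *\<^sub>v c) \<bullet> c = (\<Sum>l<n. (\<Sum>k<n. A $$ (l, k) * c $ k) * c $ l)"
    using A c by (auto simp: scalar_prod_def atLeast0LessThan intro!: sum.cong)
  also have "\<dots> = (\<Sum>l<n. \<Sum>k<n. \<Sum>T\<in>\<T>. F T l k * c $ k * c $ l)"
    by (simp add: entry sum_distrib_right)
  also have "\<dots> = (\<Sum>l<n. \<Sum>T\<in>\<T>. \<Sum>k<n. F T l k * c $ k * c $ l)"
    by (intro sum.cong refl sum.swap)
  also have "\<dots> = (\<Sum>T\<in>\<T>. \<Sum>l<n. \<Sum>k<n. F T l k * c $ k * c $ l)"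
    by (rule sum.swap)
  finally show ?thesis .
qed

section \<open>Global mass and stiffness forms, and sparsity\<close>

context fe_discretisation
begin

lemma mass_carrier: "mass_matrix \<Omega> m \<in> carrier_mat N N"
  and stiffness_carrier: "stiffness_matrix \<Omega> m \<in> carrier_mat N N"
  by (simp_all add: mass_matrix_def stiffness_matrix_def)

lemma mass_symmetric: "transpose_mat (mass_matrix \<Omega> m) = mass_matrix \<Omega> m"
  and stiffness_symmetric: "transpose_mat (stiffness_matrix \<Omega> m) = stiffness_matrix \<Omega> m"
  by (auto simp: mass_matrix_def stiffness_matrix_def mult.commute inner_commute intro!: eq_matI)

lemma mass_form:
  assumes c: "c \<in> carrier_vec N"
  shows "(mass_matrix \<Omega> m *\<^sub>v c) \<bullet> c = (\<Sum>T\<in>cells m. integral T (\<lambda>x. (loc T (($) c) x)\<^sup>2))"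
proof -
  let ?\<psi> = "\<lambda>T k x. inner (slope T k) x + offset T k"
  have "(mass_matrix \<Omega> m *\<^sub>v c) \<bullet> c =
      (\<Sum>T\<in>cells m. \<Sum>l<N. \<Sum>k<N. integral T (\<lambda>x. ?\<psi> T k x * ?\<psi> T l x) * c $ k * c $ l)"
    by (rule quadratic_form_sum[OF mass_carrier c mass_entry])
  also have "\<dots> = (\<Sum>T\<in>cells m. integral T (\<lambda>x. (loc T (($) c) x)\<^sup>2))"
  proof (rule sum.cong[OF refl])
    fix T assume "T \<in> cells m"
    then have T: "compact T" by (rule compact_cell)
    have int: "(\<lambda>x. ?\<psi> T k x * ?\<psi> T l x * c $ k * c $ l) integrable_on T" for k l
      using T by (intro set_lebesgue_integral_eq_integral(1) absolutely_integrable_on_bounded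
          compact_imp_bounded compact_sets_lebesgue continuous_intros)
    have "(\<Sum>l<N. \<Sum>k<N. integral T (\<lambda>x. ?\<psi> T k x * ?\<psi> T l x) * c $ k * c $ l)
        = (\<Sum>l<N. \<Sum>k<N. integral T (\<lambda>x. ?\<psi> T k x * ?\<psi> T l x * c $ k * c $ l))"
      by simp
    also have "\<dots> = integral T (\<lambda>x. \<Sum>l<N. \<Sum>k<N. ?\<psi> T k x * ?\<psi> T l x * c $ k * c $ l)"
      by (subst integral_sum; (subst integral_sum)?) (auto intro!: integrable_sum int)
    also have "(\<lambda>x. \<Sum>l<N. \<Sum>k<N. ?\<psi> T k x * ?\<psi> T l x * c $ k * c $ l) = (\<lambda>x. (loc T (($) c) x)\<^sup>2)"
    proof
      fix x
      show "(\<Sum>l<N. \<Sum>k<N. ?\<psi> T k x * ?\<psi> T l x * c $ k * c $ l) = (loc T (($) c) x)\<^sup>2"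
        unfolding loc_sum power2_eq_square sum_product by (intro sum.cong refl) (simp add: mult_ac)
    qed
    finally show "(\<Sum>l<N. \<Sum>k<N. integral T (\<lambda>x. ?\<psi> T k x * ?\<psi> T l x) * c $ k * c $ l)
        = integral T (\<lambda>x. (loc T (($) c) x)\<^sup>2)" .
  qed
  finally show ?thesis .
qed

lemma stiffness_form:
  assumes c: "c \<in> carrier_vec N"
  shows "(stiffness_matrix \<Omega> m *\<^sub>v c) \<bullet> c = (\<Sum>T\<in>cells m. vol T * (norm (local_slope T (($) c)))\<^sup>2)"
proof -
  have "(stiffness_matrix \<Omega> m *\<^sub>v c) \<bullet> c =
      (\<Sum>T\<in>cells m. \<Sum>l<N. \<Sum>k<N. vol T * inner (slope T k) (slope T l) * c $ k * c $ l)"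
    by (rule quadratic_form_sum[OF stiffness_carrier c stiffness_entry])
  also have "\<dots> = (\<Sum>T\<in>cells m. vol T * (norm (local_slope T (($) c)))\<^sup>2)"
    unfolding power2_norm_eq_inner local_slope_def inner_sum_left inner_sum_right sum_distrib_left
    by (intro sum.cong refl) (simp add: inner_commute mult_ac)
  finally show ?thesis .
qed

text \<open>The constant of \<open>integral_affine_square_ge\<close> divided by the number of
  vertices of a cell, because that bound at a single point is summed over the local nodes.\<close>

definition "\<kappa> = (1 / 4) ^ DIM('a) / 4 / (DIM('a) + 1)"

lemma \<kappa>_pos: "0 < \<kappa>"
  by (simp add: \<kappa>_def)

lemma cell_mass_le:
  assumes T: "T \<in> cells m"
  shows "integral T (\<lambda>x. (loc T c x)\<^sup>2) \<le> vol T * nodal_sum T c"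
proof -
  have cT: "compact T" by (rule compact_cell[OF T])
  have "integral T (\<lambda>x. (loc T c x)\<^sup>2) \<le> integral T (\<lambda>x. nodal_sum T c)"
  proof (rule integral_le)
    show "(\<lambda>x. (loc T c x)\<^sup>2) integrable_on T"
      unfolding loc_def using affine_square_integrable[OF cT] by (rule set_lebesgue_integral_eq_integral)
    show "(\<lambda>x. nodal_sum T c) integrable_on T"
      using cT by (intro integrable_on_const lmeasurable_compact)
  qed (rule loc_square_le[OF T])
  also have "\<dots> = vol T * nodal_sum T c"
    using integral_mult_left[of T "\<lambda>_. 1" "nodal_sum T c"] cT
    by (simp add: lmeasurable_compact lmeasure_integral del: integral_mult_left)
  finally show ?thesis .
qed

lemma cell_mass_ge:
  assumes T: "T \<in> cells m"
  shows "\<kappa> * (vol T * nodal_sum T c) \<le> integral T (\<lambda>x. (loc T c x)\<^sup>2)"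
proof -
  let ?J = "integral T (\<lambda>x. (loc T c x)\<^sup>2)" and ?a = "(1 / 4) ^ DIM('a) / 4 * vol T"
  have J: "0 \<le> ?J" by (rule integral_nonneg)
      (auto simp: loc_def intro: set_lebesgue_integral_eq_integral affine_square_integrable compact_cell[OF T])
  have "?a * (c k)\<^sup>2 \<le> ?J" if "k \<in> local_dofs T" for k
    using integral_affine_square_ge[OF compact_cell[OF T] convex_cell[OF T], of "nodes m ! k" "local_slope T c" "local_offset T c"]
      loc_node[OF T that, of c] that
    by (auto simp: loc_def local_dofs_def extreme_point_of_def)
  then have "(\<Sum>k\<in>local_dofs T. ?a * (c k)\<^sup>2) \<le> card (local_dofs T) * ?J"
    using sum_bounded_above[of "local_dofs T" "\<lambda>k. ?a * (c k)\<^sup>2" ?J] by simp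
  also have "\<dots> \<le> (DIM('a) + 1) * ?J"
    using card_local_dofs[OF T] J by (intro mult_right_mono) (simp_all only: of_nat_le_iff of_nat_mono)
  finally have J': "?a * nodal_sum T c \<le> (DIM('a) + 1) * ?J"
    by (simp add: nodal_sum_def sum_distrib_left)
  have div: "x / D \<le> y" if "x \<le> D * y" "0 < D" for x y D :: real
    using that by (simp add: divide_le_eq mult.commute)
  have "?a * nodal_sum T c / (DIM('a) + 1) \<le> ?J"
    by (rule div[OF J']) simp
  moreover have "\<kappa> * (vol T * nodal_sum T c) = ?a * nodal_sum T c / (DIM('a) + 1)"
    by (simp add: \<kappa>_def)
  ultimately show ?thesis by simp
qed

text \<open>Coefficients of one basis function. Applied to them, the cell estimates yield the
  diagonal of the mass matrix and also the sparsity pattern.\<close>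

definition "unit_dof k = (\<lambda>j::nat. if j = k then 1 else 0 :: real)"

lemma local_slope_unit: "k < N \<Longrightarrow> local_slope T (unit_dof k) = slope T k"
  by (simp add: local_slope_def unit_dof_def if_distrib[of "\<lambda>a. a *\<^sub>R _"] cong: if_cong)

lemma loc_unit: "k < N \<Longrightarrow> loc T (unit_dof k) x = inner (slope T k) x + offset T k"
  by (simp add: loc_sum unit_dof_def if_distrib[of "\<lambda>a. a * _"] cong: if_cong)

lemma nodal_sum_unit: "nodal_sum T (unit_dof k) = (if k \<in> local_dofs T then 1 else 0)"
  using finite_local_dofs by (simp add: nodal_sum_def unit_dof_def if_distrib[of "\<lambda>a. a\<^sup>2"] cong: if_cong)

text \<open>By \<open>nodal_sum_unit\<close> this is the total volume of the cells that have node
  \<open>k\<close> as a vertex. The diagonal form with these weights mediates between the mass form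
  and diag(M).\<close>

definition "W k = (\<Sum>T\<in>cells m. vol T * nodal_sum T (unit_dof k))"

lemma mass_diag_bounds:
  assumes "k < N"
  shows "\<kappa> * W k \<le> mass_matrix \<Omega> m $$ (k, k)" "mass_matrix \<Omega> m $$ (k, k) \<le> W k"
proof -
  have M: "mass_matrix \<Omega> m $$ (k, k) = (\<Sum>T\<in>cells m. integral T (\<lambda>x. (loc T (unit_dof k) x)\<^sup>2))"
    using mass_entry[OF assms assms] by (simp add: loc_unit[OF assms] power2_eq_square)
  show "\<kappa> * W k \<le> mass_matrix \<Omega> m $$ (k, k)"
    unfolding M W_def sum_distrib_left by (intro sum_mono cell_mass_ge)
  show "mass_matrix \<Omega> m $$ (k, k) \<le> W k"
    unfolding M W_def by (intro sum_mono cell_mass_le)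
qed

lemma W_sum: "(\<Sum>T\<in>cells m. vol T * nodal_sum T c) = (\<Sum>k<N. W k * (c k)\<^sup>2)"
proof -
  have "nodal_sum T c = (\<Sum>k<N. nodal_sum T (unit_dof k) * (c k)\<^sup>2)" for T
  proof -
    have "(\<Sum>k<N. nodal_sum T (unit_dof k) * (c k)\<^sup>2) = (\<Sum>k\<in>local_dofs T. nodal_sum T (unit_dof k) * (c k)\<^sup>2)"
      by (rule sum.mono_neutral_right) (auto simp: nodal_sum_unit local_dofs_def)
    also have "\<dots> = nodal_sum T c"
      unfolding nodal_sum_def[of T c] by (rule sum.cong) (simp_all add: nodal_sum_unit)
    finally show ?thesis by simp
  qed
  then have "(\<Sum>T\<in>cells m. vol T * nodal_sum T c)
      = (\<Sum>T\<in>cells m. \<Sum>k<N. vol T * nodal_sum T (unit_dof k) * (c k)\<^sup>2)"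
    by (simp add: sum_distrib_left mult.assoc)
  also have "\<dots> = (\<Sum>k<N. \<Sum>T\<in>cells m. vol T * nodal_sum T (unit_dof k) * (c k)\<^sup>2)"
    by (rule sum.swap)
  finally show ?thesis by (simp add: W_def sum_distrib_right)
qed

lemma vol_cell_ge:
  assumes T: "T \<in> cells m"
  shows "unit_ball_vol DIM('a) * (mesh_size m / (\<tau> * \<sigma>)) ^ DIM('a) \<le> vol T"
proof -
  obtain z where z: "cball z (diameter T / \<sigma>) \<subseteq> T" using inscribed_ball[OF T] .
  have "mesh_size m / (\<tau> * \<sigma>) \<le> diameter T / \<sigma>"
    using mesh_size_le[OF T] \<sigma> \<tau> by (simp add: field_simps)
  then have "unit_ball_vol DIM('a) * (mesh_size m / (\<tau> * \<sigma>)) ^ DIM('a)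
      \<le> unit_ball_vol DIM('a) * (diameter T / \<sigma>) ^ DIM('a)"
    using mesh_size_pos \<sigma> \<tau> by (intro mult_left_mono power_mono) auto
  also have "\<dots> = vol (cball z (diameter T / \<sigma>))"
    using diameter_cell_pos[OF T] \<sigma> by (simp add: content_cball)
  also have "\<dots> \<le> vol T"
    using z compact_cell[OF T] by (intro measure_mono_fmeasurable) (auto simp: lmeasurable_compact)
  finally show ?thesis .
qed

lemma vol_cell_pos:
  assumes "T \<in> cells m"
  shows "0 < vol T"
proof -
  have "0 < unit_ball_vol DIM('a) * (mesh_size m / (\<tau> * \<sigma>)) ^ DIM('a)"
    using mesh_size_pos \<sigma> \<tau> by simp
  then show ?thesis using vol_cell_ge[OF assms] by linarith
qed

lemma W_pos:
  assumes "k < N"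
  shows "0 < W k"
proof -
  have "nodes m ! k \<in> vertices (cells m)" using assms nodes_set by (auto simp: num_dofs_def)
  then obtain T where T: "T \<in> cells m" "k \<in> local_dofs T"
    using assms by (auto simp: vertices_def local_dofs_def)
  have "0 < vol T * nodal_sum T (unit_dof k)" using T vol_cell_pos by (simp add: nodal_sum_unit)
  also have "\<dots> \<le> W k"
    unfolding W_def by (rule member_le_sum[OF T(1)]) (auto simp: finite_cells nodal_sum_nonneg)
  finally show ?thesis .
qed

lemma mass_diag_pos: "k < N \<Longrightarrow> 0 < mass_matrix \<Omega> m $$ (k, k)"
  using mass_diag_bounds(1) W_pos \<kappa>_pos by (metis less_le_trans mult_pos_pos)

definition "diag_form c = (\<Sum>k<N. mass_matrix \<Omega> m $$ (k, k) * (c $ k)\<^sup>2)"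

lemma W_diag_form:
  shows "diag_form c \<le> (\<Sum>k<N. W k * (c $ k)\<^sup>2)" "\<kappa> * (\<Sum>k<N. W k * (c $ k)\<^sup>2) \<le> diag_form c"
  unfolding diag_form_def sum_distrib_left mult.assoc[symmetric]
  by (intro sum_mono mult_right_mono mass_diag_bounds; simp)+

text \<open>Both inequalities pass through the weights \<open>W\<close>: in each, one of the two
  comparisons costs the factor kappa and the other nothing.\<close>

lemma mass_form_bounds:
  assumes c: "c \<in> carrier_vec N"
  shows "\<kappa> * diag_form c \<le> (mass_matrix \<Omega> m *\<^sub>v c) \<bullet> c"
    "(mass_matrix \<Omega> m *\<^sub>v c) \<bullet> c \<le> diag_form c / \<kappa>"
proof -
  have "\<kappa> * (\<Sum>k<N. W k * (c $ k)\<^sup>2) \<le> (mass_matrix \<Omega> m *\<^sub>v c) \<bullet> c"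
    unfolding mass_form[OF c] W_sum[symmetric] sum_distrib_left by (intro sum_mono cell_mass_ge)
  then show "\<kappa> * diag_form c \<le> (mass_matrix \<Omega> m *\<^sub>v c) \<bullet> c"
    using W_diag_form(1)[of c] \<kappa>_pos by (meson less_imp_le mult_left_mono order_trans)
  have "(mass_matrix \<Omega> m *\<^sub>v c) \<bullet> c \<le> (\<Sum>k<N. W k * (c $ k)\<^sup>2)"
    unfolding mass_form[OF c] W_sum[symmetric] by (intro sum_mono cell_mass_le)
  then show "(mass_matrix \<Omega> m *\<^sub>v c) \<bullet> c \<le> diag_form c / \<kappa>"
    using W_diag_form(2)[of c] \<kappa>_pos by (simp add: field_simps) (smt (verit) mult_left_mono)
qed

lemma stiffness_form_nonneg: "c \<in> carrier_vec N \<Longrightarrow> 0 \<le> (stiffness_matrix \<Omega> m *\<^sub>v c) \<bullet> c"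
  unfolding stiffness_form by (intro sum_nonneg) simp

lemma stiffness_form_le:
  assumes c: "c \<in> carrier_vec N"
  shows "(mesh_size m)\<^sup>2 * ((stiffness_matrix \<Omega> m *\<^sub>v c) \<bullet> c) \<le> (\<sigma> * \<tau>)\<^sup>2 / \<kappa> * diag_form c"
proof -
  have "(mesh_size m)\<^sup>2 * ((stiffness_matrix \<Omega> m *\<^sub>v c) \<bullet> c)
      = (\<Sum>T\<in>cells m. vol T * ((mesh_size m)\<^sup>2 * (norm (local_slope T (($) c)))\<^sup>2))"
    unfolding stiffness_form[OF c] sum_distrib_left by (simp add: mult_ac)
  also have "\<dots> \<le> (\<Sum>T\<in>cells m. vol T * ((\<sigma> * \<tau>)\<^sup>2 * nodal_sum T (($) c)))"
    by (intro sum_mono mult_left_mono slope_bound) auto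
  also have "\<dots> = (\<sigma> * \<tau>)\<^sup>2 * (\<Sum>k<N. W k * (c $ k)\<^sup>2)"
    unfolding W_sum[symmetric] sum_distrib_left by (simp add: mult_ac)
  also have "\<dots> \<le> (\<sigma> * \<tau>)\<^sup>2 * (diag_form c / \<kappa>)"
    using W_diag_form(2)[of c] \<kappa>_pos by (intro mult_left_mono) (auto simp: field_simps)
  finally show ?thesis by simp
qed

text \<open>The cells at a node have disjoint interiors, lie in a ball of radius \<open>h\<close> and each contain
  a ball of radius \<open>h / (\<tau> \<sigma>)\<close>.\<close>

lemma card_cells_at_node:
  assumes l: "l < N"
  shows "real (card {T \<in> cells m. l \<in> local_dofs T}) \<le> (\<tau> * \<sigma>) ^ DIM('a)"
proof -
  let ?S = "{T \<in> cells m. l \<in> local_dofs T}" and ?b = "unit_ball_vol DIM('a)" and ?h = "mesh_size m"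
  have fin: "finite ?S" using finite_cells by simp
  have neg: "negligible (T \<inter> T')" if "T \<in> cells m" "T' \<in> cells m" "T \<noteq> T'" for T T'
  proof (rule negligible_subset)
    show "negligible (frontier T \<union> frontier T')"
      using that convex_cell by (simp add: negligible_convex_frontier)
    show "T \<inter> T' \<subseteq> frontier T \<union> frontier T'"
      using interiors_disjoint[OF that] compact_cell that
      by (auto simp: frontier_def closure_closed compact_imp_closed)
  qed
  have "card ?S * (?b * (?h / (\<tau> * \<sigma>)) ^ DIM('a)) \<le> (\<Sum>T\<in>?S. vol T)"
    using sum_bounded_below[of ?S "?b * (?h / (\<tau> * \<sigma>)) ^ DIM('a)" vol] vol_cell_ge by simp
  also have "\<dots> = vol (\<Union>?S)"
    using fin neg compact_cell
    by (intro measure_negligible_finite_Union[symmetric]) (auto simp: pairwise_def lmeasurable_compact)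
  also have "\<dots> \<le> vol (cball (nodes m ! l) ?h)"
  proof (rule measure_mono_fmeasurable)
    show "\<Union>?S \<subseteq> cball (nodes m ! l) ?h"
    proof
      fix x assume "x \<in> \<Union>?S"
      then obtain T where T: "T \<in> cells m" "l \<in> local_dofs T" "x \<in> T" by auto
      then have "nodes m ! l \<in> T" by (auto simp: local_dofs_def extreme_point_of_def)
      then have "dist (nodes m ! l) x \<le> diameter T"
        using diameter_bounded_bound[OF compact_imp_bounded[OF compact_cell[OF T(1)]]] T(3) by blast
      then show "x \<in> cball (nodes m ! l) ?h" using diameter_le_mesh_size[OF T(1)] by simp
    qed
    show "\<Union>?S \<in> sets lebesgue"
      using fin compact_cell by (intro sets.finite_Union) (auto simp: compact_sets_lebesgue)
  qed (simp add: lmeasurable_compact)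
  also have "\<dots> = ?b * ?h ^ DIM('a)"
    using mesh_size_pos by (simp add: content_cball)
  finally have "card ?S * (?b * ?h ^ DIM('a)) \<le> (\<tau> * \<sigma>) ^ DIM('a) * (?b * ?h ^ DIM('a))"
    using \<sigma> \<tau> by (simp add: power_divide field_simps)
  moreover have "0 < ?b * ?h ^ DIM('a)" using mesh_size_pos by (simp add: unit_ball_vol_pos)
  ultimately show ?thesis by (simp add: mult_le_cancel_right)
qed

text \<open>On such a cell the coefficients of the basis function have nodal sum zero, so the upper
  estimates for slope and value force both to vanish.\<close>

lemma hat_vanishes:
  assumes "k < N" "T \<in> cells m" "k \<notin> local_dofs T"
  shows "slope T k = 0" "x \<in> T \<Longrightarrow> inner (slope T k) x + offset T k = 0"
proof -
  have n: "nodal_sum T (unit_dof k) = 0" using assms(3) by (simp add: nodal_sum_unit)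
  have "(mesh_size m)\<^sup>2 * (norm (slope T k))\<^sup>2 \<le> 0"
    using slope_bound[OF assms(2), of "unit_dof k"] n by (simp add: local_slope_unit[OF assms(1)])
  then show "slope T k = 0" using mesh_size_pos by (simp add: mult_le_0_iff)
  show "inner (slope T k) x + offset T k = 0" if "x \<in> T"
    using loc_square_le[OF assms(2) that, of "unit_dof k"] n by (simp add: loc_unit[OF assms(1)])
qed

text \<open>An entry can be nonzero only if nodes l and k share a cell. There are at most (tau
  sigma)^d cells at node l, each with at most d + 1 nodes.\<close>

lemma sparse_row:
  assumes l: "l < N"
  shows "real (card {k. k < N \<and> (mass_matrix \<Omega> m $$ (l, k) \<noteq> 0 \<or> stiffness_matrix \<Omega> m $$ (l, k) \<noteq> 0)})
    \<le> (\<tau> * \<sigma>) ^ DIM('a) * (DIM('a) + 1)"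
proof -
  let ?S = "{T \<in> cells m. l \<in> local_dofs T}"
  have fin: "finite ?S" using finite_cells by simp
  have "{k. k < N \<and> (mass_matrix \<Omega> m $$ (l, k) \<noteq> 0 \<or> stiffness_matrix \<Omega> m $$ (l, k) \<noteq> 0)}
      \<subseteq> (\<Union>T\<in>?S. local_dofs T)"
  proof (rule subsetI, rule ccontr)
    fix k assume k: "k \<in> {k. k < N \<and> (mass_matrix \<Omega> m $$ (l, k) \<noteq> 0 \<or> stiffness_matrix \<Omega> m $$ (l, k) \<noteq> 0)}"
      and "k \<notin> (\<Union>T\<in>?S. local_dofs T)"
    then have kN: "k < N" and sep: "\<And>T. T \<in> cells m \<Longrightarrow> l \<notin> local_dofs T \<or> k \<notin> local_dofs T"
      by auto
    have "integral T (\<lambda>x. (inner (slope T k) x + offset T k) * (inner (slope T l) x + offset T l)) = 0"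
      if "T \<in> cells m" for T
    proof -
      have "integral T (\<lambda>x. (inner (slope T k) x + offset T k) * (inner (slope T l) x + offset T l))
          = integral T (\<lambda>x. 0)"
        using sep[OF that] hat_vanishes(2)[OF kN that] hat_vanishes(2)[OF l that]
        by (intro integral_cong) auto
      then show ?thesis by simp
    qed
    then have "mass_matrix \<Omega> m $$ (l, k) = 0" by (simp add: mass_entry[OF l kN])
    moreover have "stiffness_matrix \<Omega> m $$ (l, k) = 0"
      unfolding stiffness_entry[OF l kN]
      using sep hat_vanishes(1)[OF kN] hat_vanishes(1)[OF l] by (intro sum.neutral) fastforce
    ultimately show False using k by simp
  qed
  then have "card {k. k < N \<and> (mass_matrix \<Omega> m $$ (l, k) \<noteq> 0 \<or> stiffness_matrix \<Omega> m $$ (l, k) \<noteq> 0)}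
      \<le> card (\<Union>T\<in>?S. local_dofs T)"
    using fin finite_local_dofs by (intro card_mono) auto
  also have "\<dots> \<le> (\<Sum>T\<in>?S. card (local_dofs T))"
    using fin by (rule card_UN_le)
  also have "\<dots> \<le> (\<Sum>T\<in>?S. DIM('a) + 1)"
    by (intro sum_mono card_local_dofs) auto
  also have "\<dots> = card ?S * (DIM('a) + 1)" by simp
  finally have "real (card {k. k < N \<and> (mass_matrix \<Omega> m $$ (l, k) \<noteq> 0 \<or> stiffness_matrix \<Omega> m $$ (l, k) \<noteq> 0)})
      \<le> real (card ?S * (DIM('a) + 1))" by (simp only: of_nat_le_iff)
  then have "real (card {k. k < N \<and> (mass_matrix \<Omega> m $$ (l, k) \<noteq> 0 \<or> stiffness_matrix \<Omega> m $$ (l, k) \<noteq> 0)})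
      \<le> real (card ?S) * (DIM('a) + 1)" by (simp only: of_nat_mult)
  also have "\<dots> \<le> (\<tau> * \<sigma>) ^ DIM('a) * (DIM('a) + 1)"
    by (rule mult_right_mono[OF card_cells_at_node[OF l]]) simp
  finally show ?thesis .
qed

end

section \<open>The discrete optimality system\<close>

lemma smult_mult_mat_vec:
  "A \<in> carrier_mat nr nc \<Longrightarrow> x \<in> carrier_vec nc \<Longrightarrow> (c \<cdot>\<^sub>m A) *\<^sub>v x = c \<cdot>\<^sub>v (A *\<^sub>v (x :: real vec))"
  by (intro eq_vecI) (auto simp: scalar_prod_def sum_distrib_left mult.assoc)

lemma zero_mat_mult_vec: "0\<^sub>m n n *\<^sub>v v = (0\<^sub>v n :: real vec)" if "v \<in> carrier_vec n"
  using that by (intro eq_vecI) auto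

lemma four_block_form:
  assumes "A \<in> carrier_mat n n" "B \<in> carrier_mat n n" "C \<in> carrier_mat n n" "D \<in> carrier_mat n n"
    and "u \<in> carrier_vec n" "p \<in> carrier_vec n" "v \<in> carrier_vec n" "q \<in> carrier_vec n"
  shows "(four_block_mat A B C D *\<^sub>v (u @\<^sub>v p)) \<bullet> (v @\<^sub>v q) =
    (A *\<^sub>v u) \<bullet> v + (B *\<^sub>v p) \<bullet> v + (C *\<^sub>v u) \<bullet> q + (D *\<^sub>v p) \<bullet> (q :: real vec)"
proof -
  have c: "A *\<^sub>v u \<in> carrier_vec n" "B *\<^sub>v p \<in> carrier_vec n" "C *\<^sub>v u \<in> carrier_vec n" "D *\<^sub>v p \<in> carrier_vec n"
    using assms by simp_all
  then show ?thesis
    using assms by (simp add: four_block_mat_mult_vec[of _ n n _ n _ n] scalar_prod_append[of _ n _ n]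
        add_scalar_prod_distrib[of _ n])
qed

lemma append_vecE:
  assumes "x \<in> carrier_vec (n + n)"
  obtains u p where "u \<in> carrier_vec n" "p \<in> carrier_vec n" "x = u @\<^sub>v p"
  using vec_first_last_append[OF assms] by (metis vec_first_carrier vec_last_carrier)

text \<open>Nonnegativity of the form at u - v / a and at u + v / a gives the two signs of a
  weighted Young inequality. The weight matters because the two block components live on different
  scales in h.\<close>

lemma psd_young:
  fixes S :: "real mat"
  assumes S: "S \<in> carrier_mat n n" "transpose_mat S = S"
    and psd: "\<And>w. w \<in> carrier_vec n \<Longrightarrow> 0 \<le> (S *\<^sub>v w) \<bullet> w"
    and u: "u \<in> carrier_vec n" and v: "v \<in> carrier_vec n" and a: "0 < a"
  shows "2 * \<bar>(S *\<^sub>v u) \<bullet> v\<bar> \<le> a * ((S *\<^sub>v u) \<bullet> u) + (S *\<^sub>v v) \<bullet> v / a"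
proof -
  have *: "0 \<le> (S *\<^sub>v u) \<bullet> u - 2 * t * ((S *\<^sub>v u) \<bullet> v) + t\<^sup>2 * ((S *\<^sub>v v) \<bullet> v)" for t
  proof -
    have sym: "(S *\<^sub>v v) \<bullet> u = (S *\<^sub>v u) \<bullet> v"
      using symmetric_mult_mat_vec_scalar_prod[OF S v u] u v S by (simp add: comm_scalar_prod[of _ n])
    have "0 \<le> (S *\<^sub>v (u - t \<cdot>\<^sub>v v)) \<bullet> (u - t \<cdot>\<^sub>v v)" using u v by (intro psd) simp
    also have "\<dots> = (S *\<^sub>v u) \<bullet> u - 2 * t * ((S *\<^sub>v u) \<bullet> v) + t\<^sup>2 * ((S *\<^sub>v v) \<bullet> v)"
      using u v S(1)
      by (simp add: mult_minus_distrib_mat_vec mult_mat_vec minus_scalar_prod_distrib[of _ n]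
          scalar_prod_minus_distrib[of _ n] smult_scalar_prod_distrib[of _ n]
          scalar_prod_smult_distrib[of _ n] sym power2_eq_square algebra_simps)
    finally show ?thesis .
  qed
  let ?x = "(S *\<^sub>v u) \<bullet> u" and ?y = "(S *\<^sub>v u) \<bullet> v" and ?z = "(S *\<^sub>v v) \<bullet> v"
  have "0 \<le> a * (?x - 2 * (1 / a) * ?y + (1 / a)\<^sup>2 * ?z)" using *[of "1 / a"] a by simp
  also have "\<dots> = a * ?x - 2 * ?y + ?z / a"
    using a by (simp add: field_simps power2_eq_square)
  finally have 1: "2 * ?y \<le> a * ?x + ?z / a" by simp
  have "0 \<le> a * (?x - 2 * (- 1 / a) * ?y + (- 1 / a)\<^sup>2 * ?z)" using *[of "- 1 / a"] a by simp
  also have "\<dots> = a * ?x + 2 * ?y + ?z / a"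
    using a by (simp add: field_simps power2_eq_square)
  finally have "- (2 * ?y) \<le> a * ?x + ?z / a" by simp
  with 1 show ?thesis by (simp add: abs_if)
qed

text \<open>The mesh enters the linear algebra only through these scaled bounds and the number \<open>s\<close> of
  nonzero entries per row.\<close>

locale discrete_system =
  fixes N :: nat and M K :: "real mat" and h \<kappa> C :: real and s :: nat
  assumes M: "M \<in> carrier_mat N N" "transpose_mat M = M"
    and K: "K \<in> carrier_mat N N" "transpose_mat K = K"
    and h: "0 < h" and \<kappa>: "0 < \<kappa>" "\<kappa> \<le> C"
    and M_diag: "\<And>k. k < N \<Longrightarrow> 0 < M $$ (k, k)"
    and M_lower: "\<And>v. v \<in> carrier_vec N \<Longrightarrow> \<kappa> * (\<Sum>k<N. M $$ (k, k) * (v $ k)\<^sup>2) \<le> (M *\<^sub>v v) \<bullet> v"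
    and M_upper: "\<And>v. v \<in> carrier_vec N \<Longrightarrow> (M *\<^sub>v v) \<bullet> v \<le> C * (\<Sum>k<N. M $$ (k, k) * (v $ k)\<^sup>2)"
    and K_lower: "\<And>v. v \<in> carrier_vec N \<Longrightarrow> 0 \<le> (K *\<^sub>v v) \<bullet> v"
    and K_upper: "\<And>v. v \<in> carrier_vec N \<Longrightarrow> h\<^sup>2 * ((K *\<^sub>v v) \<bullet> v) \<le> C * (\<Sum>k<N. M $$ (k, k) * (v $ k)\<^sup>2)"
    and sparse: "\<And>l. l < N \<Longrightarrow> card {k. k < N \<and> (M $$ (l, k) \<noteq> 0 \<or> K $$ (l, k) \<noteq> 0)} \<le> s"
begin

abbreviation "P \<equiv> diag_precond h M"
abbreviation "Q \<equiv> precond (h ^ 4) M K"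
abbreviation "A \<equiv> system_matrix (h ^ 4) M K"
definition "D v = (\<Sum>k<N. M $$ (k, k) * (v $ k)\<^sup>2)"

lemmas bounds = M_lower[folded D_def] M_upper[folded D_def] K_upper[folded D_def]

lemma C: "0 < C"
  using \<kappa> by linarith

lemma D_nonneg: "0 \<le> D v"
  unfolding D_def using M_diag by (intro sum_nonneg mult_nonneg_nonneg) (auto simp: less_imp_le)

lemma D_eq_0:
  assumes "v \<in> carrier_vec N" "D v = 0"
  shows "v = 0\<^sub>v N"
proof (rule eq_vecI)
  fix i assume "i < dim_vec (0\<^sub>v N :: real vec)"
  then have i: "i < N" by simp
  have "\<forall>k\<in>{..<N}. M $$ (k, k) * (v $ k)\<^sup>2 = 0"
    using assms(2) M_diag unfolding D_def
    by (subst sum_nonneg_eq_0_iff[symmetric]) (auto simp: less_imp_le)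
  then have "M $$ (i, i) * (v $ i)\<^sup>2 = 0" using i by blast
  then show "v $ i = 0\<^sub>v N $ i" using i M_diag[OF i] by simp
qed (use assms in simp)

lemma diag_carrier: "diag_part M \<in> carrier_mat N N"
  using M by (simp add: diag_part_def)

lemma diag_part_form: "v \<in> carrier_vec N \<Longrightarrow> (diag_part M *\<^sub>v v) \<bullet> v = D v"
proof -
  assume v: "v \<in> carrier_vec N"
  have "(diag_part M *\<^sub>v v) $ k = M $$ (k, k) * v $ k" if "k < N" for k
  proof -
    have "(diag_part M *\<^sub>v v) $ k = (\<Sum>j<N. (if k = j then M $$ (j, j) else 0) * v $ j)"
      using that v M by (simp add: diag_part_def mat_diag_def scalar_prod_def atLeast0LessThan)
    also have "\<dots> = M $$ (k, k) * v $ k"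
      using that by (simp add: if_distrib[of "\<lambda>a. a * _"] cong: if_cong)
    finally show ?thesis .
  qed
  then show ?thesis
    using v diag_carrier by (simp add: scalar_prod_def D_def atLeast0LessThan power2_eq_square mult_ac)
qed

lemma P_block: "P = four_block_mat (diag_part M) (0\<^sub>m N N) (0\<^sub>m N N) ((1 / h ^ 4) \<cdot>\<^sub>m diag_part M)"
  using diag_carrier by (simp add: diag_precond_def block_diag_def)

lemma Q_block: "Q = four_block_mat (M + h\<^sup>2 \<cdot>\<^sub>m K) (0\<^sub>m N N) (0\<^sub>m N N) ((1 / h ^ 4) \<cdot>\<^sub>m (M + h\<^sup>2 \<cdot>\<^sub>m K))"
proof -
  have "sqrt (h ^ 4) = h\<^sup>2"
    using real_sqrt_abs[of "h\<^sup>2"] by simp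
  then show ?thesis using M K by (simp add: precond_def block_diag_def)
qed

lemma P_carrier: "P \<in> carrier_mat (N + N) (N + N)"
  and Q_carrier: "Q \<in> carrier_mat (N + N) (N + N)"
  and A_carrier: "A \<in> carrier_mat (N + N) (N + N)"
  using diag_carrier M K by (auto simp: P_block Q_block system_matrix_def simp del: One_nat_def)

lemma P_form:
  assumes "u \<in> carrier_vec N" "p \<in> carrier_vec N"
  shows "(P *\<^sub>v (u @\<^sub>v p)) \<bullet> (u @\<^sub>v p) = D u + D p / h ^ 4"
  unfolding P_block using assms diag_carrier
  by (subst four_block_form[of _ N]) (auto simp: smult_mult_mat_vec smult_scalar_prod_distrib[of _ N] diag_part_form
      zero_mat_mult_vec)

lemma Q_form:
  assumes "u \<in> carrier_vec N" "p \<in> carrier_vec N"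
  shows "(Q *\<^sub>v (u @\<^sub>v p)) \<bullet> (u @\<^sub>v p) =
    ((M *\<^sub>v u) \<bullet> u + h\<^sup>2 * ((K *\<^sub>v u) \<bullet> u)) + ((M *\<^sub>v p) \<bullet> p + h\<^sup>2 * ((K *\<^sub>v p) \<bullet> p)) / h ^ 4"
proof -
  let ?E = "M + h\<^sup>2 \<cdot>\<^sub>m K"
  have E: "?E \<in> carrier_mat N N" using M K by simp
  have form: "(?E *\<^sub>v v) \<bullet> v = (M *\<^sub>v v) \<bullet> v + h\<^sup>2 * ((K *\<^sub>v v) \<bullet> v)" if "v \<in> carrier_vec N" for v
    using that M K by (simp add: add_mult_distrib_mat_vec[of _ N N] smult_mult_mat_vec[of _ N N]
        add_scalar_prod_distrib[of _ N] smult_scalar_prod_distrib[of _ N])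
  show ?thesis
    unfolding Q_block using assms E
    by (subst four_block_form[of _ N]) (auto simp: smult_mult_mat_vec[OF E] smult_scalar_prod_distrib[of _ N] form
        zero_mat_mult_vec)
qed

lemma A_form:
  assumes "u \<in> carrier_vec N" "p \<in> carrier_vec N" "v \<in> carrier_vec N" "q \<in> carrier_vec N"
  shows "(A *\<^sub>v (u @\<^sub>v p)) \<bullet> (v @\<^sub>v q) =
    (M *\<^sub>v u) \<bullet> v + (K *\<^sub>v p) \<bullet> v + (K *\<^sub>v u) \<bullet> q - ((M *\<^sub>v p) \<bullet> q) / h ^ 4"
  unfolding system_matrix_def using assms M K
  by (subst four_block_form[of _ N]) (auto simp: smult_mult_mat_vec[of _ N N] smult_scalar_prod_distrib[of _ N])

lemma diag_part_sym: "transpose_mat (diag_part M) = diag_part M"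
  by (auto simp: diag_part_def mat_diag_def intro!: eq_matI)

lemma smult_transpose: "transpose_mat (c \<cdot>\<^sub>m X) = c \<cdot>\<^sub>m transpose_mat (X :: real mat)"
  by (intro eq_matI) auto

lemma block_sym:
  assumes "X \<in> carrier_mat N N" "Y \<in> carrier_mat N N" "Z \<in> carrier_mat N N"
    "transpose_mat X = X" "transpose_mat Y = Y" "transpose_mat Z = Z"
  shows "transpose_mat (four_block_mat X Y Y Z) = four_block_mat X Y Y Z"
  using assms by (simp add: transpose_four_block_mat[of _ N N _ N _ N])

lemma E_sym: "transpose_mat (M + h\<^sup>2 \<cdot>\<^sub>m K) = M + h\<^sup>2 \<cdot>\<^sub>m K"
  using M K by (simp add: transpose_add[of _ N N] smult_transpose)

lemma P_sym: "transpose_mat P = P"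
  unfolding P_block using diag_carrier by (intro block_sym) (auto simp: diag_part_sym smult_transpose)

lemma Q_sym: "transpose_mat Q = Q"
  unfolding Q_block using M K by (intro block_sym) (auto simp: E_sym smult_transpose)

lemma A_sym: "transpose_mat A = A"
  unfolding system_matrix_def using M K by (intro block_sym) (auto simp: smult_transpose)

lemma P_form_pos:
  assumes "x \<in> carrier_vec (N + N)" "x \<noteq> 0\<^sub>v (N + N)"
  shows "0 < (P *\<^sub>v x) \<bullet> x"
proof -
  obtain u p where up: "u \<in> carrier_vec N" "p \<in> carrier_vec N" "x = u @\<^sub>v p"
    using append_vecE[OF assms(1)] .
  have "D u \<noteq> 0 \<or> D p \<noteq> 0"
  proof (rule ccontr)
    assume "\<not> (D u \<noteq> 0 \<or> D p \<noteq> 0)"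
    then have "u = 0\<^sub>v N" "p = 0\<^sub>v N" using D_eq_0 up by auto
    then have "x = 0\<^sub>v (N + N)" unfolding up(3) by (intro eq_vecI) auto
    then show False using assms(2) by simp
  qed
  then have "0 < D u + D p / h ^ 4"
    using D_nonneg[of u] D_nonneg[of p] h
    by (metis add_nonneg_pos add_pos_nonneg divide_nonneg_pos divide_pos_pos less_eq_real_def zero_less_power)
  then show ?thesis unfolding up(3) P_form[OF up(1,2)] .
qed

text \<open>From below the stiffness part is dropped; from above the mass part and the scaled
  stiffness part contribute C each.\<close>

lemma Q_bounds:
  assumes "x \<in> carrier_vec (N + N)"
  shows "\<kappa> * ((P *\<^sub>v x) \<bullet> x) \<le> (Q *\<^sub>v x) \<bullet> x" "(Q *\<^sub>v x) \<bullet> x \<le> 2 * C * ((P *\<^sub>v x) \<bullet> x)"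
proof -
  obtain u p where up: "u \<in> carrier_vec N" "p \<in> carrier_vec N" "x = u @\<^sub>v p"
    using append_vecE[OF assms] .
  let ?E = "\<lambda>v. (M *\<^sub>v v) \<bullet> v + h\<^sup>2 * ((K *\<^sub>v v) \<bullet> v)"
  have lo: "\<kappa> * D v \<le> ?E v" and hi: "?E v \<le> 2 * C * D v" if "v \<in> carrier_vec N" for v
    using bounds[OF that] mult_nonneg_nonneg[OF zero_le_power2[of h] K_lower[OF that]] by simp_all
  have "\<kappa> * D p / h ^ 4 \<le> ?E p / h ^ 4" "?E p / h ^ 4 \<le> 2 * C * D p / h ^ 4"
    using lo[OF up(2)] hi[OF up(2)] h by (auto intro: divide_right_mono)
  then show "\<kappa> * ((P *\<^sub>v x) \<bullet> x) \<le> (Q *\<^sub>v x) \<bullet> x" "(Q *\<^sub>v x) \<bullet> x \<le> 2 * C * ((P *\<^sub>v x) \<bullet> x)"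
    using lo[OF up(1)] hi[OF up(1)] unfolding up(3) P_form[OF up(1,2)] Q_form[OF up(1,2)]
    by (simp_all add: distrib_left)
qed

lemma P_spd: "spd_mat P"
  using P_carrier P_sym P_form_pos unfolding spd_mat_def by auto

lemma Q_spd: "spd_mat Q"
proof -
  have "0 < (Q *\<^sub>v x) \<bullet> x" if "x \<in> carrier_vec (N + N)" "x \<noteq> 0\<^sub>v (N + N)" for x
    using P_form_pos[OF that] Q_bounds(1)[OF that(1)] \<kappa>(1) by (meson less_le_trans mult_pos_pos)
  then show ?thesis using Q_carrier Q_sym unfolding spd_mat_def by auto
qed

text \<open>Flipping the sign of p cancels the two K terms by symmetry and makes the negative mass
  block positive, while the form of \<open>P\<close> does not see the sign.\<close>

lemma A_test:
  assumes "x \<in> carrier_vec (N + N)"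
  shows "\<exists>x'\<in>carrier_vec (N + N). (P *\<^sub>v x') \<bullet> x' = (P *\<^sub>v x) \<bullet> x \<and> \<kappa> * ((P *\<^sub>v x) \<bullet> x) \<le> (A *\<^sub>v x) \<bullet> x'"
proof -
  obtain u p where up: "u \<in> carrier_vec N" "p \<in> carrier_vec N" "x = u @\<^sub>v p"
    using append_vecE[OF assms] .
  let ?p = "(-1) \<cdot>\<^sub>v p"
  have p': "?p \<in> carrier_vec N" using up by simp
  have D': "D ?p = D p" using up by (simp add: D_def)
  have K': "(K *\<^sub>v u) \<bullet> p = (K *\<^sub>v p) \<bullet> u"
    using symmetric_mult_mat_vec_scalar_prod[OF K up(1,2)] up K by (simp add: comm_scalar_prod[of _ N])
  have "(A *\<^sub>v x) \<bullet> (u @\<^sub>v ?p) = (M *\<^sub>v u) \<bullet> u + (M *\<^sub>v p) \<bullet> p / h ^ 4"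
    unfolding up(3) A_form[OF up(1,2,1) p'] using up M K K' by (simp add: scalar_prod_smult_distrib[of _ N])
  moreover have "\<kappa> * D p / h ^ 4 \<le> (M *\<^sub>v p) \<bullet> p / h ^ 4"
    using bounds(1)[OF up(2)] h by (intro divide_right_mono) auto
  ultimately have "\<kappa> * (D u + D p / h ^ 4) \<le> (A *\<^sub>v x) \<bullet> (u @\<^sub>v ?p)"
    using bounds(1)[OF up(1)] by (simp add: distrib_left)
  then show ?thesis
    using up p' by (intro bexI[of _ "u @\<^sub>v ?p"]) (simp_all add: P_form D')
qed

lemma A_upper:
  assumes "x \<in> carrier_vec (N + N)" "y \<in> carrier_vec (N + N)"
  shows "(A *\<^sub>v x) \<bullet> y \<le> C * ((P *\<^sub>v x) \<bullet> x + (P *\<^sub>v y) \<bullet> y)"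
proof -
  obtain u p where up: "u \<in> carrier_vec N" "p \<in> carrier_vec N" "x = u @\<^sub>v p"
    using append_vecE[OF assms(1)] .
  obtain v q where vq: "v \<in> carrier_vec N" "q \<in> carrier_vec N" "y = v @\<^sub>v q"
    using append_vecE[OF assms(2)] .
  have Mpsd: "0 \<le> (M *\<^sub>v w) \<bullet> w" if "w \<in> carrier_vec N" for w
    using bounds(1)[OF that] D_nonneg[of w] \<kappa> by (meson less_imp_le mult_nonneg_nonneg order_trans)
  have MM: "2 * \<bar>(M *\<^sub>v a) \<bullet> b\<bar> \<le> C * D a + C * D b" if "a \<in> carrier_vec N" "b \<in> carrier_vec N" for a b
    using psd_young[OF M Mpsd that, of 1] bounds(2)[OF that(1)] bounds(2)[OF that(2)] by simp
  have KD: "(K *\<^sub>v a) \<bullet> a / h\<^sup>2 \<le> C * D a / h ^ 4" if "a \<in> carrier_vec N" for a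
  proof -
    have "(K *\<^sub>v a) \<bullet> a / h\<^sup>2 = h\<^sup>2 * ((K *\<^sub>v a) \<bullet> a) / h ^ 4"
      using h by (simp add: power4_eq_xxxx power2_eq_square)
    also have "h\<^sup>2 * ((K *\<^sub>v a) \<bullet> a) / h ^ 4 \<le> C * D a / h ^ 4"
      using bounds(3)[OF that] h by (intro divide_right_mono) auto
    finally show ?thesis .
  qed
  \<comment> \<open>Weight 1 / h^2 for the term with p and weight h^2 for the term with u: either
    way the second components p and q receive h^-2 K, which is at most C h^-4 diag(M), and the first
    components receive h^2 K, as the form of \<open>P\<close> demands.\<close>
  have K1: "2 * \<bar>(K *\<^sub>v p) \<bullet> v\<bar> \<le> C * (D p / h ^ 4) + C * D v"
    using psd_young[OF K K_lower up(2) vq(1), of "1 / h\<^sup>2"] h KD[OF up(2)] bounds(3)[OF vq(1)]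
    by (simp add: mult.commute)
  have K2: "2 * \<bar>(K *\<^sub>v u) \<bullet> q\<bar> \<le> C * D u + C * (D q / h ^ 4)"
    using psd_young[OF K K_lower up(1) vq(2), of "h\<^sup>2"] h KD[OF vq(2)] bounds(3)[OF up(1)] by simp
  have M2: "2 * \<bar>(M *\<^sub>v p) \<bullet> q / h ^ 4\<bar> \<le> C * (D p / h ^ 4) + C * (D q / h ^ 4)"
    using divide_right_mono[OF MM[OF up(2) vq(2)], of "h ^ 4"] h by (simp add: abs_divide add_divide_distrib)
  have "(A *\<^sub>v x) \<bullet> y \<le> C * (D u + D p / h ^ 4) + C * (D v + D q / h ^ 4)"
    unfolding up(3) vq(3) A_form[OF up(1,2) vq(1,2)]
      distrib_left
    using MM[OF up(1) vq(1)] K1 K2 M2 abs_ge_self[of "(M *\<^sub>v u) \<bullet> v"] abs_ge_self[of "(K *\<^sub>v p) \<bullet> v"]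
      abs_ge_self[of "(K *\<^sub>v u) \<bullet> q"] abs_ge_minus_self[of "(M *\<^sub>v p) \<bullet> q / h ^ 4"]
    by linarith
  then show ?thesis unfolding up(3) vq(3) P_form[OF up(1,2)] P_form[OF vq(1,2)] by (simp add: distrib_left)
qed

sublocale preconditioned_system "N + N" P A
proof
  fix v assume v: "v \<in> carrier_vec (N + N)" "A *\<^sub>v v = 0\<^sub>v (N + N)"
  then obtain v' where v': "v' \<in> carrier_vec (N + N)" "\<kappa> * ((P *\<^sub>v v) \<bullet> v) \<le> (A *\<^sub>v v) \<bullet> v'"
    using A_test by blast
  then have "(P *\<^sub>v v) \<bullet> v \<le> 0" using v \<kappa> by (simp add: mult_le_0_iff)
  then show "v = 0\<^sub>v (N + N)" using P_form_pos[OF v(1)] by force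
qed (rule P_carrier P_spd A_carrier A_sym)+

lemma convergence:
  assumes "f \<in> carrier_vec N" "x\<^sub>0 \<in> carrier_vec (2 * N)" "q = sqrt (sqrt (1 - \<kappa>\<^sup>2 / (4 * C\<^sup>2)))"
  shows "minres_residual P A (system_rhs f) x\<^sub>0 k \<le> 1 / q * q ^ k * inv_norm P (system_rhs f - A *\<^sub>v x\<^sub>0)"
proof (rule minres_residual_le[where C\<^sub>1 = "\<kappa>\<^sup>2" and C\<^sub>2 = "4 * C\<^sup>2"])
  show "system_rhs f \<in> carrier_vec (N + N)" using assms by (simp add: system_rhs_def)
  show "x\<^sub>0 \<in> carrier_vec (N + N)" using assms by (simp add: mult_2)
  have "\<kappa>\<^sup>2 \<le> C\<^sup>2" using \<kappa> by (intro power_mono) auto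
  then show "\<kappa>\<^sup>2 < 4 * C\<^sup>2" using C by (smt (verit) zero_less_power)
  show "\<kappa>\<^sup>2 * ((P *\<^sub>v v) \<bullet> v) \<le> g v v" if "v \<in> carrier_vec (N + N)" for v
    using A_test[OF that] g_lower[OF that _ \<kappa>(1)] by blast
  show "g v v \<le> 4 * C\<^sup>2 * ((P *\<^sub>v v) \<bullet> v)" if "v \<in> carrier_vec (N + N)" for v
    using g_upper[OF that C] A_upper[OF that] by blast
qed (use \<kappa> assms in auto)

text \<open>Each half of a row of the block matrix is supported on the joint pattern of
  \<open>M\<close> and \<open>K\<close> in the corresponding row, which gives 2s nonzeros in each of
  2N rows.\<close>

lemma nnz_A: "nnz A \<le> 4 * N * s"
proof -
  define R where "R l = {k. k < N \<and> (M $$ (l, k) \<noteq> 0 \<or> K $$ (l, k) \<noteq> 0)}" for l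
  have "card {k. k < N + N \<and> A $$ (l, k) \<noteq> 0} \<le> 2 * s" if l: "l < N + N" for l
  proof -
    define l' where "l' = (if l < N then l else l - N)"
    have l': "l' < N" using l by (auto simp: l'_def)
    have "{k. k < N + N \<and> A $$ (l, k) \<noteq> 0} \<subseteq> R l' \<union> (+) N ` R l'"
    proof
      fix k assume "k \<in> {k. k < N + N \<and> A $$ (l, k) \<noteq> 0}"
      then have k: "k < N + N" "A $$ (l, k) \<noteq> 0" by auto
      show "k \<in> R l' \<union> (+) N ` R l'"
      proof (cases "k < N")
        case True
        then show ?thesis using k l M K by (auto simp: system_matrix_def R_def l'_def split: if_splits)
      next
        case False
        then have "k - N \<in> R l'"
          using k l M K by (auto simp: system_matrix_def R_def l'_def split: if_splits)
        then have "N + (k - N) \<in> (+) N ` R l'" by blast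
        then show ?thesis using False by simp
      qed
    qed
    then have "card {k. k < N + N \<and> A $$ (l, k) \<noteq> 0} \<le> card (R l' \<union> (+) N ` R l')"
      by (intro card_mono) (auto simp: R_def)
    also have "\<dots> \<le> card (R l') + card ((+) N ` R l')" by (rule card_Un_le)
    also have "\<dots> \<le> card (R l') + card (R l')" by (intro add_left_mono card_image_le) (auto simp: R_def)
    also have "\<dots> \<le> 2 * s" using sparse[OF l'] by (simp add: R_def)
    finally show ?thesis .
  qed
  then have "(\<Sum>l<N + N. card {k. k < N + N \<and> A $$ (l, k) \<noteq> 0}) \<le> (N + N) * (2 * s)"
    using sum_bounded_above[of "{..<N + N}" _ "2 * s"] by simp
  also have "(N + N) * (2 * s) = 4 * N * s" by simp
  finally show ?thesis
    using A_carrier by (simp add: nnz_def)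
qed

end

section \<open>A straight-line program for the discrete system\<close>

lemma slp_init:
  assumes inp: "\<And>i. i \<in> I \<Longrightarrow> inp i = pre @ list_of_vec (F i) @ list_of_vec (X i)"
    and F: "\<And>i. i \<in> I \<Longrightarrow> F i \<in> carrier_vec a" and X: "\<And>i. i \<in> I \<Longrightarrow> X i \<in> carrier_vec b"
  shows "slp I inp 0 ((\<lambda>e i. e) ` set pre \<union> comps a F \<union> comps b X)"
  unfolding slp_def
proof (rule exI[of _ "[]"], rule exI[of _ "length pre + a + b"], rule exI[of _ inp], intro conjI ballI)
  fix i assume i: "i \<in> I"
  show "run (inp i) [] = Some (inp i)" by simp
  show "length (inp i) = length pre + a + b"
    using inp[OF i] carrier_vecD[OF F[OF i]] carrier_vecD[OF X[OF i]] by simp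
next
  fix v assume "v \<in> (\<lambda>e i. e) ` set pre \<union> comps a F \<union> comps b X"
  then consider e where "e \<in> set pre" "v = (\<lambda>i. e)" | j where "j < a" "v = (\<lambda>i. F i $ j)"
    | j where "j < b" "v = (\<lambda>i. X i $ j)"
    by (auto simp: comps_def)
  then show "\<exists>p<length pre + a + b. \<forall>i\<in>I. inp i ! p = v i"
  proof cases
    case 1
    then obtain p where "p < length pre" "pre ! p = e" by (auto simp: in_set_conv_nth)
    then show ?thesis using 1 inp by (intro exI[of _ p]) (auto simp: nth_append)
  next
    case 2
    have "inp i ! (length pre + j) = F i $ j" if "i \<in> I" for i
      using 2 inp[OF that] carrier_vecD[OF F[OF that]] by (simp add: nth_append list_of_vec_index)
    then show ?thesis using 2 by (intro exI[of _ "length pre + j"]) auto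
  next
    case 3
    have "inp i ! (length pre + a + j) = X i $ j" if "i \<in> I" for i
      using 3 inp[OF that] carrier_vecD[OF F[OF that]] carrier_vecD[OF X[OF that]]
      by (simp add: nth_append list_of_vec_index)
    then show ?thesis using 3 by (intro exI[of _ "length pre + a + j"]) auto
  qed
qed simp

lemma mat_entry_in_list:
  "l < dim_row X \<Longrightarrow> k < dim_col X \<Longrightarrow> X $$ (l, k) \<in> set (concat (mat_to_list X))"
  by (auto simp: mat_to_list_def intro!: bexI[of _ l])

context discrete_system
begin

text \<open>The blocks \<open>M\<close> and \<open>K\<close> are input and cost nothing. Six
  operations produce the scalars, at most N s the nonzero entries of the negative block, and N the
  second half of the diagonal of \<open>P\<close>.\<close>

lemma gets_matrix_entries:
  fixes I :: "'i set" and V :: "('i \<Rightarrow> real) set"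
  assumes V: "\<And>l k. l < N \<Longrightarrow> k < N \<Longrightarrow> (\<lambda>i. M $$ (l, k)) \<in> V"
    "\<And>l k. l < N \<Longrightarrow> k < N \<Longrightarrow> (\<lambda>i. K $$ (l, k)) \<in> V" "(\<lambda>i. h) \<in> V"
  shows "\<exists>V'. gets I V (6 + N * s + N) V' \<and> V \<subseteq> V' \<and> (\<lambda>i. 0) \<in> V' \<and> (\<lambda>i. 1) \<in> V' \<and>
    (\<forall>l<N + N. \<forall>k<N + N. A $$ (l, k) \<noteq> 0 \<longrightarrow> (\<lambda>i. A $$ (l, k)) \<in> V') \<and>
    (\<forall>l<N + N. (\<lambda>i. P $$ (l, l)) \<in> V')"
proof -
  let ?c = "\<lambda>(e :: real) (i :: 'i). e" and ?r = "1 / h ^ 4"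
  have 0: "gets I V 0 V" by (rule gets_refl) simp
  \<comment> \<open>The machine has no free constants: 0 is obtained as h - h and, below, 1 as h /
    h.\<close>
  have "gets I V 1 {?c 0}" by (rule gets_cong_single[OF gets_diff[OF V(3) V(3)]]) auto
  from gets_step[OF 0 this] have 1: "gets I V 1 (V \<union> {?c 0})" by simp
  have "gets I (V \<union> {?c 0}) 1 {?c 1}"
    by (rule gets_cong_single[OF gets_divide[of "?c h" _ "?c h"]]) (use V h in auto)
  from gets_step[OF 1 this] have 2: "gets I V 2 (V \<union> {?c 0, ?c 1})" (is "gets I V 2 ?V2")
    by (rule gets_mono) auto
  have "gets I ?V2 1 {?c (h\<^sup>2)}"
    by (rule gets_cong_single[OF gets_mult[of "?c h" _ "?c h"]]) (use V in \<open>auto simp: power2_eq_square\<close>)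
  from gets_step[OF 2 this] have 3: "gets I V 3 (V \<union> {?c 0, ?c 1, ?c (h\<^sup>2)})" (is "gets I V 3 ?V3")
    by (rule gets_mono) auto
  have "gets I ?V3 1 {?c (h ^ 4)}"
    by (rule gets_cong_single[OF gets_mult[of "?c (h\<^sup>2)" _ "?c (h\<^sup>2)"]]) (auto simp: power4_eq_xxxx power2_eq_square)
  from gets_step[OF 3 this] have 4: "gets I V 4 (V \<union> {?c 0, ?c 1, ?c (h\<^sup>2), ?c (h ^ 4)})" (is "gets I V 4 ?V4")
    by (rule gets_mono) auto
  have "gets I ?V4 1 {?c ?r}"
    by (rule gets_cong_single[OF gets_divide[of "?c 1" _ "?c (h ^ 4)"]]) (use h in auto)
  from gets_step[OF 4 this] have 5: "gets I V 5 (?V4 \<union> {?c ?r})" by simp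
  have "gets I (?V4 \<union> {?c ?r}) 1 {?c (- ?r)}"
    by (rule gets_cong_single[OF gets_diff[of "?c 0" _ "?c ?r"]]) auto
  from gets_step[OF 5 this] have 6: "gets I V 6 (?V4 \<union> {?c ?r} \<union> {?c (- ?r)})" by simp
  define V6 where "V6 = ?V4 \<union> {?c ?r} \<union> {?c (- ?r)}"
  define R where "R l = {k. k < N \<and> M $$ (l, k) \<noteq> 0}" for l
  have cardR: "card (R l) \<le> s" if "l < N" for l
  proof -
    have "card (R l) \<le> card {k. k < N \<and> (M $$ (l, k) \<noteq> 0 \<or> K $$ (l, k) \<noteq> 0)}"
      by (rule card_mono) (auto simp: R_def)
    then show ?thesis using sparse[OF that] by linarith
  qed
  define X where "X = (\<Union>l\<in>{..<N}. \<Union>k\<in>R l. {?c (- ?r * M $$ (l, k))})"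
  define Y where "Y = (\<Union>l\<in>{..<N}. {?c (?r * M $$ (l, l))})"
  have X: "gets I V6 (\<Sum>l<N. \<Sum>k\<in>R l. 1) X"
    unfolding X_def
  proof (rule gets_UN, simp, rule gets_UN)
    fix l k assume lk: "l \<in> {..<N}" "k \<in> R l"
    then have "?c (- ?r) \<in> V6" "?c (M $$ (l, k)) \<in> V6" using V by (auto simp: V6_def R_def)
    then show "gets I V6 1 {?c (- ?r * M $$ (l, k))}" by (rule gets_mult)
  qed (simp add: R_def)
  have "gets I V6 (\<Sum>l<N. 1) Y"
    unfolding Y_def
  proof (rule gets_UN)
    fix l assume lk: "l \<in> {..<N}"
    then have "?c ?r \<in> V6" "?c (M $$ (l, l)) \<in> V6" using V by (auto simp: V6_def)
    then show "gets I V6 1 {?c (?r * M $$ (l, l))}" by (rule gets_mult)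
  qed simp
  from gets_step[OF 6[folded V6_def] gets_Un[OF X this]]
  have "gets I V (6 + ((\<Sum>l<N. \<Sum>k\<in>R l. 1) + (\<Sum>l<N. 1))) (V6 \<union> (X \<union> Y))" .
  moreover have "(\<Sum>l<N. \<Sum>k\<in>R l. 1) \<le> N * s"
    using sum_bounded_above[of "{..<N}" "\<lambda>l. card (R l)" s] cardR by simp
  ultimately have main: "gets I V (6 + N * s + N) (V6 \<union> X \<union> Y)"
    by (elim gets_mono) auto
  have "?c (A $$ (l, k)) \<in> V6 \<union> X \<union> Y" if lk: "l < N + N" "k < N + N" and nz: "A $$ (l, k) \<noteq> 0" for l k
  proof -
    consider "l < N" "k < N" "A $$ (l, k) = M $$ (l, k)" | "l < N" "k - N < N" "A $$ (l, k) = K $$ (l, k - N)"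
      | "l - N < N" "k < N" "A $$ (l, k) = K $$ (l - N, k)"
      | "l - N < N" "k - N < N" "A $$ (l, k) = - ?r * M $$ (l - N, k - N)"
      using lk M K by (cases "l < N"; cases "k < N") (auto simp: system_matrix_def)
    then show ?thesis
    proof cases
      case 4
      then have "k - N \<in> R (l - N)" using nz by (auto simp: R_def)
      then have "?c (- ?r * M $$ (l - N, k - N)) \<in> X" unfolding X_def using 4 by blast
      then show ?thesis unfolding 4(3) by blast
    qed (use V in \<open>auto simp: V6_def\<close>)
  qed
  moreover have "?c (P $$ (l, l)) \<in> V6 \<union> X \<union> Y" if l: "l < N + N" for l
  proof (cases "l < N")
    case True
    then have "P $$ (l, l) = M $$ (l, l)" using M by (simp add: P_block diag_part_def mat_diag_def)
    then show ?thesis using V True by (simp add: V6_def)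
  next
    case False
    then have "P $$ (l, l) = ?r * M $$ (l - N, l - N)" using M l by (simp add: P_block diag_part_def mat_diag_def)
    moreover have "?c (?r * M $$ (l - N, l - N)) \<in> Y" unfolding Y_def using False l by (intro UN_I[of "l - N"]) auto
    ultimately show ?thesis by simp
  qed
  ultimately show ?thesis
    using main by (intro exI[of _ "V6 \<union> X \<union> Y"]) (auto simp: V6_def)
qed

lemma P_diagonal:
  assumes "l < N + N" "k < N + N"
  shows "l \<noteq> k \<Longrightarrow> P $$ (l, k) = 0" "P $$ (l, l) \<noteq> 0"
proof -
  show "P $$ (l, k) = 0" if "l \<noteq> k"
    using assms that M by (cases "l < N"; cases "k < N") (auto simp: P_block diag_part_def mat_diag_def)
  show "P $$ (l, l) \<noteq> 0"
  proof (cases "l < N")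
    case False
    then have "l - N < N" using assms by linarith
    then show ?thesis using False assms M h M_diag[of "l - N"] by (auto simp: P_block diag_part_def mat_diag_def)
  qed (use assms M M_diag[of l] in \<open>auto simp: P_block diag_part_def mat_diag_def\<close>)
qed

text \<open>In dimension 2N an iteration costs at most N (24 s + 45), and assembling the entries at
  most N (s + 7); N (24 s + 52) dominates both. The factor \<open>k + 2\<close> counts k steps, the
  initial block of \<open>gets_minres\<close> and the assembly.\<close>

lemma minres_program:
  "\<exists>prog outs. length prog \<le> (k + 2) * N * (24 * s + 52) \<and>
     (\<forall>f\<in>carrier_vec N. \<forall>x\<^sub>0\<in>carrier_vec (2 * N).
        computes prog outs (system_input h M K f x\<^sub>0) k (minres P A (system_rhs f) x\<^sub>0))"
proof -
  define I where "I = (carrier_vec N :: real vec set) \<times> (carrier_vec (N + N) :: real vec set)"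
  define inp where "inp = (\<lambda>i. system_input h M K (fst i) (snd i))"
  define b where "b = (\<lambda>i :: real vec \<times> real vec. system_rhs (fst i))"
  define X where "X m = (\<lambda>i. minres P A (b i) (snd i) m)" for m
  have b: "b i \<in> carrier_vec (N + N)" if "i \<in> I" for i
    using that by (auto simp: I_def b_def system_rhs_def)
  have X: "X m i \<in> carrier_vec (N + N)" if "i \<in> I" for i m
    using that b[OF that] by (auto simp: X_def I_def minres_eq_orthodir orthodir_eq)
  have "\<exists>V. slp I inp ((k + 2) * N * (24 * s + 52)) V \<and> (\<forall>m\<le>k. comps (N + N) (X m) \<subseteq> V)"
  proof (cases "N = 0")
    \<comment> \<open>Without unknowns the budget is 0, so the empty program has to do; the iterates
      then have no components. Otherwise additive constants are absorbed using N at least 1.\<close>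
    case True
    have "slp I inp 0 ((\<lambda>e i. e) ` set (concat (mat_to_list M) @ concat (mat_to_list K) @ [h])
        \<union> comps N fst \<union> comps (N + N) snd)"
      by (rule slp_init) (auto simp: I_def inp_def system_input_def)
    then show ?thesis using True by (auto simp: comps_def)
  next
    case False
    define V where "V = (\<lambda>e (i :: real vec \<times> real vec). e) ` set (concat (mat_to_list M) @ concat (mat_to_list K) @ [h])
        \<union> comps N fst \<union> comps (N + N) snd"
    have V: "slp I inp 0 V"
      unfolding V_def by (rule slp_init) (auto simp: I_def inp_def system_input_def)
    have ent: "(\<lambda>i. M $$ (l, k)) \<in> V" "(\<lambda>i. K $$ (l, k)) \<in> V" if "l < N" "k < N" for l k
      using that M K mat_entry_in_list[of l M k] mat_entry_in_list[of l K k] by (auto simp: V_def)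
    have "(\<lambda>i. h) \<in> V" by (auto simp: V_def)
    with gets_matrix_entries[of V I] ent obtain V' where V': "gets I V (6 + N * s + N) V'" "V \<subseteq> V'" "(\<lambda>i. 0) \<in> V'" "(\<lambda>i. 1) \<in> V'"
      "\<And>l k. l < N + N \<Longrightarrow> k < N + N \<Longrightarrow> A $$ (l, k) \<noteq> 0 \<Longrightarrow> (\<lambda>i. A $$ (l, k)) \<in> V'"
      "\<And>l. l < N + N \<Longrightarrow> (\<lambda>i. P $$ (l, l)) \<in> V'"
      by blast
    define V'' where "V'' = V' \<union> comps (N + N) b"
    \<comment> \<open>The right-hand side is \<open>f\<close> padded with zeros; both
      \<open>f\<close> and the constant 0 are already in memory, so it is free.\<close>
    have "gets I V' 0 (comps (N + N) b)"
    proof (rule gets_cong[OF gets_refl[OF order_refl]])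
      fix w assume "w \<in> comps (N + N) b"
      then obtain j where j: "j < N + N" "w = (\<lambda>i. b i $ j)" by (auto simp: comps_def)
      show "\<exists>w'\<in>V'. \<forall>i\<in>I. w i = w' i"
      proof (cases "j < N")
        case True
        have "(\<lambda>i. fst i $ j) \<in> V" unfolding V_def using comps_subsetD[OF order_refl True, of fst] by blast
        then show ?thesis using V'(2) j True
          by (intro bexI[of _ "\<lambda>i. fst i $ j"]) (auto simp: b_def system_rhs_def I_def)
      next
        case False
        then show ?thesis using V'(3) j
          by (intro bexI[of _ "\<lambda>i. 0"]) (auto simp: b_def system_rhs_def I_def)
      qed
    qed
    from gets_step[OF V'(1) this] have 1: "gets I V (6 + N * s + N) V''" by (simp add: V''_def)
    have "gets I V'' ((k + 1) * (6 * nnz A + 18 * (N + N) + 9))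
        (\<Union>m\<le>k. comps (N + N) (\<lambda>i. minres P A (b i) (snd i) m))"
    proof (rule gets_minres)
      show "comps (N + N) snd \<subseteq> V''" using V'(2) by (auto simp: V''_def V_def)
    qed (use V' b P_diagonal in \<open>auto simp: V''_def I_def\<close>)
    from gets_trans[OF 1 this] have "gets I V (6 + N * s + N + (k + 1) * (6 * nnz A + 18 * (N + N) + 9))
        (\<Union>m\<le>k. comps (N + N) (X m))" by (simp add: X_def)
    then have slp: "slp I inp (0 + (6 + N * s + N + (k + 1) * (6 * nnz A + 18 * (N + N) + 9)))
        (V \<union> (\<Union>m\<le>k. comps (N + N) (X m)))"
      using V unfolding gets_def by blast
    have c: "6 + N * s + N \<le> N * (24 * s + 52)"
    proof -
      have "1 \<le> N" using False by simp
      then have "6 + N * s + N \<le> N * 6 + N * s + N * 1" by linarith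
      also have "\<dots> = N * (s + 7)" by (simp add: algebra_simps)
      also have "\<dots> \<le> N * (24 * s + 52)" by (intro mult_left_mono) auto
      finally show ?thesis .
    qed
    have "6 * nnz A + 18 * (N + N) + 9 \<le> 6 * (4 * N * s) + 18 * (N + N) + 9 * N"
      using nnz_A False by (intro add_mono mult_left_mono) auto
    also have "\<dots> = N * (24 * s + 45)" by (simp add: algebra_simps)
    also have "\<dots> \<le> N * (24 * s + 52)" by (intro mult_left_mono) auto
    finally have d: "(k + 1) * (6 * nnz A + 18 * (N + N) + 9) \<le> (k + 1) * (N * (24 * s + 52))"
      by (rule mult_left_mono) simp
    have "6 + N * s + N + (k + 1) * (6 * nnz A + 18 * (N + N) + 9) \<le> N * (24 * s + 52) + (k + 1) * (N * (24 * s + 52))"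
      using c d by (rule add_mono)
    also have "\<dots> = (k + 2) * N * (24 * s + 52)" by (simp add: algebra_simps)
    finally show ?thesis
      using slp_mono[OF slp, of "(k + 2) * N * (24 * s + 52)", OF _ order_refl] by (auto intro!: exI)
  qed
  then obtain V where V: "slp I inp ((k + 2) * N * (24 * s + 52)) V"
    "\<And>m. m \<le> k \<Longrightarrow> comps (N + N) (X m) \<subseteq> V"
    by blast
  have "\<exists>prog outs. length prog \<le> (k + 2) * N * (24 * s + 52) \<and>
      (\<forall>i\<in>I. computes prog outs (inp i) k (\<lambda>m. X m i))"
    using V X by (rule computesI)
  then obtain prog outs where
    po: "length prog \<le> (k + 2) * N * (24 * s + 52)" "\<forall>i\<in>I. computes prog outs (inp i) k (\<lambda>m. X m i)"
    by blast
  have "computes prog outs (system_input h M K f x\<^sub>0) k (minres P A (system_rhs f) x\<^sub>0)"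
    if "f \<in> carrier_vec N" "x\<^sub>0 \<in> carrier_vec (2 * N)" for f x\<^sub>0
    using bspec[OF po(2), of "(f, x\<^sub>0)"] that by (simp add: I_def inp_def X_def b_def mult_2)
  with po(1) show ?thesis by blast
qed

end

section \<open>Mesh-independent constants and the final estimate\<close>

lemma mass_constant_le_1: "(1 / 4 :: real) ^ d / 4 / (d + 1) \<le> 1"
proof -
  have "(1 / 4 :: real) ^ d \<le> 1" by (rule power_le_one) auto
  then show ?thesis by (simp add: divide_le_eq del: power_one_over)
qed

text \<open>The equations in the hypotheses show that the constants depend only on the dimension,
  sigma and tau, and hence serve all meshes at once. The maximum in \<open>C\<close> covers the mass
  bound, with factor 1, and the inverse inequality, with factor (sigma tau)^2.\<close>

lemma (in fe_discretisation) discrete_system_mesh: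
  assumes "\<kappa>\<^sub>0 = (1 / 4) ^ DIM('a) / 4 / (DIM('a) + 1)" and "C = max 1 ((\<sigma> * \<tau>)\<^sup>2) / \<kappa>\<^sub>0"
    and "s = nat \<lfloor>(\<tau> * \<sigma>) ^ DIM('a) * (DIM('a) + 1)\<rfloor>"
  shows "discrete_system (num_dofs m) (mass_matrix \<Omega> m) (stiffness_matrix \<Omega> m) (mesh_size m) \<kappa>\<^sub>0 C s"
proof -
  have k: "\<kappa>\<^sub>0 = \<kappa>" using assms(1) by (simp add: \<kappa>_def)
  have "\<kappa> \<le> 1"
    unfolding k[symmetric] assms(1) by (rule mass_constant_le_1)
  then have "\<kappa> \<le> 1 / \<kappa>" using \<kappa>_pos by (simp add: le_divide_eq mult_le_one)
  also have "\<dots> \<le> C" unfolding assms(2) k using \<kappa>_pos by (intro divide_right_mono) auto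
  finally have \<kappa>C: "\<kappa> \<le> C" .
  have C: "a * diag_form v / \<kappa> \<le> C * diag_form v" if "a \<le> max 1 ((\<sigma> * \<tau>)\<^sup>2)" for a v
  proof -
    have "0 \<le> diag_form v" unfolding diag_form_def
      using mass_diag_pos by (intro sum_nonneg mult_nonneg_nonneg) (auto simp: less_imp_le)
    then have "a * diag_form v / \<kappa> \<le> max 1 ((\<sigma> * \<tau>)\<^sup>2) * diag_form v / \<kappa>"
      using \<kappa>_pos that by (intro divide_right_mono mult_right_mono) auto
    then show ?thesis by (simp add: assms(2) k)
  qed
  show ?thesis
  proof
    fix v :: "real vec" assume v: "v \<in> carrier_vec N"
    show "\<kappa>\<^sub>0 * (\<Sum>k<N. mass_matrix \<Omega> m $$ (k, k) * (v $ k)\<^sup>2) \<le> (mass_matrix \<Omega> m *\<^sub>v v) \<bullet> v"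
      using mass_form_bounds(1)[OF v] by (simp add: k diag_form_def)
    show "(mass_matrix \<Omega> m *\<^sub>v v) \<bullet> v \<le> C * (\<Sum>k<N. mass_matrix \<Omega> m $$ (k, k) * (v $ k)\<^sup>2)"
      using mass_form_bounds(2)[OF v] C[of 1 v] by (simp add: diag_form_def)
    show "(mesh_size m)\<^sup>2 * ((stiffness_matrix \<Omega> m *\<^sub>v v) \<bullet> v)
        \<le> C * (\<Sum>k<N. mass_matrix \<Omega> m $$ (k, k) * (v $ k)\<^sup>2)"
      using stiffness_form_le[OF v] C[of "(\<sigma> * \<tau>)\<^sup>2" v] by (simp add: diag_form_def)
  next
    fix l assume "l < N"
    from sparse_row[OF this]
    show "card {k. k < N \<and> (mass_matrix \<Omega> m $$ (l, k) \<noteq> 0 \<or> stiffness_matrix \<Omega> m $$ (l, k) \<noteq> 0)} \<le> s"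
      unfolding assms(3) by (rule le_nat_floor)
  qed (use mass_carrier stiffness_carrier mass_symmetric stiffness_symmetric mesh_size_pos \<kappa>_pos \<kappa>C k
      mass_diag_pos stiffness_form_nonneg in auto)
qed

theorem mainTheorem5:
  fixes \<Omega> :: "'a::euclidean_space set" and \<sigma> \<tau> :: real
  assumes "DIM('a) \<in> {1, 2, 3}"
    and "bounded \<Omega>" and "lipschitz_domain \<Omega>"
    and "\<sigma> > 0" and "\<tau> > 0"
  shows "spectrally_equivalent (fe_meshes \<Omega> \<sigma> \<tau>) (P_diag \<Omega>) (P_full \<Omega>) \<and>
    (\<exists>C q. C > 0 \<and> 0 < q \<and> q < 1 \<and>
       (\<forall>m\<in>fe_meshes \<Omega> \<sigma> \<tau>.
        \<forall>f\<in>carrier_vec (num_dofs m). \<forall>x\<^sub>0\<in>carrier_vec (2 * num_dofs m). \<forall>n.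
          minres_residual (P_diag \<Omega> m) (sys \<Omega> m) (system_rhs f) x\<^sub>0 n
          \<le> C * q ^ n * inv_norm (P_diag \<Omega> m) (system_rhs f - sys \<Omega> m *\<^sub>v x\<^sub>0))) \<and>
    (\<forall>\<epsilon>\<^sub>0. 0 < \<epsilon>\<^sub>0 \<and> \<epsilon>\<^sub>0 < 1 \<longrightarrow>
       (\<exists>C>0. \<forall>m\<in>fe_meshes \<Omega> \<sigma> \<tau>. \<forall>\<epsilon>. 0 < \<epsilon> \<and> \<epsilon> \<le> \<epsilon>\<^sub>0 \<longrightarrow>
         (\<exists>n prog outs.
            real (length prog) \<le> C * (real (num_dofs m) * ln (1 / \<epsilon>)) \<and>
            (\<forall>f\<in>carrier_vec (num_dofs m). \<forall>x\<^sub>0\<in>carrier_vec (2 * num_dofs m).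
               computes prog outs
                 (system_input (mesh_size m) (mass_matrix \<Omega> m) (stiffness_matrix \<Omega> m) f x\<^sub>0)
                 n (minres (P_diag \<Omega> m) (sys \<Omega> m) (system_rhs f) x\<^sub>0) \<and>
               minres_residual (P_diag \<Omega> m) (sys \<Omega> m) (system_rhs f) x\<^sub>0 n
               \<le> \<epsilon> * inv_norm (P_diag \<Omega> m) (system_rhs f - sys \<Omega> m *\<^sub>v x\<^sub>0)))))"
proof -
  define \<kappa> where "\<kappa> = (1 / 4) ^ DIM('a) / 4 / (DIM('a) + 1)"
  define C where "C = max 1 ((\<sigma> * \<tau>)\<^sup>2) / \<kappa>"
  define s where "s = nat \<lfloor>(\<tau> * \<sigma>) ^ DIM('a) * (DIM('a) + 1)\<rfloor>"
  define q where "q = sqrt (sqrt (1 - \<kappa>\<^sup>2 / (4 * C\<^sup>2)))"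
  let ?I = "fe_meshes \<Omega> \<sigma> \<tau>"
  let ?S = "\<lambda>m. discrete_system (num_dofs m) (mass_matrix \<Omega> m) (stiffness_matrix \<Omega> m) (mesh_size m) \<kappa> C s"
  have S: "?S m" if "m \<in> ?I" for m
  proof (rule fe_discretisation.discrete_system_mesh[OF _ \<kappa>_def C_def s_def])
    show "fe_discretisation \<Omega> \<sigma> \<tau> m" by unfold_locales (use assms that in auto)
  qed
  have \<kappa>: "0 < \<kappa>" "\<kappa> \<le> 1"
    unfolding \<kappa>_def by (simp, rule mass_constant_le_1)
  have "1 \<le> 1 / \<kappa>" using \<kappa> by simp
  also have "\<dots> \<le> C" unfolding C_def using \<kappa> by (intro divide_right_mono) auto
  finally have C: "1 \<le> C" .
  have \<kappa>2: "\<kappa>\<^sup>2 \<le> 1" using \<kappa> by (intro power_le_one) auto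
  have "1 \<le> C\<^sup>2" using C by simp
  then have "\<kappa>\<^sup>2 / (4 * C\<^sup>2) < 1" using \<kappa>2 by (simp add: divide_less_eq)
  moreover have "0 < \<kappa>\<^sup>2 / (4 * C\<^sup>2)" using \<kappa> C by (intro divide_pos_pos) auto
  ultimately have q: "0 < q" "q < 1" by (auto simp: q_def)

  have "spectrally_equivalent ?I (P_diag \<Omega>) (P_full \<Omega>)"
    unfolding spectrally_equivalent_def
  proof (rule conjI)
    show "\<forall>m\<in>?I. spd_mat (P_diag \<Omega> m) \<and> spd_mat (P_full \<Omega> m) \<and> dim_row (P_diag \<Omega> m) = dim_row (P_full \<Omega> m)"
    proof
      fix m assume m: "m \<in> ?I"
      interpret discrete_system "num_dofs m" "mass_matrix \<Omega> m" "stiffness_matrix \<Omega> m" "mesh_size m" \<kappa> C s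
        by (rule S[OF m])
      show "spd_mat (P_diag \<Omega> m) \<and> spd_mat (P_full \<Omega> m) \<and> dim_row (P_diag \<Omega> m) = dim_row (P_full \<Omega> m)"
        unfolding P_diag_def P_full_def using P_spd Q_spd P_carrier Q_carrier by simp
    qed
    show "\<exists>c\<^sub>1 c\<^sub>2. 0 < c\<^sub>1 \<and> c\<^sub>1 \<le> c\<^sub>2 \<and> (\<forall>m\<in>?I. \<forall>v\<in>carrier_vec (dim_row (P_full \<Omega> m)).
        c\<^sub>1 * ((P_full \<Omega> m *\<^sub>v v) \<bullet> v) \<le> (P_diag \<Omega> m *\<^sub>v v) \<bullet> v \<and>
        (P_diag \<Omega> m *\<^sub>v v) \<bullet> v \<le> c\<^sub>2 * ((P_full \<Omega> m *\<^sub>v v) \<bullet> v))"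
    \<comment> \<open>\<open>Q_bounds\<close> estimates the full preconditioner by the diagonal one;
      solving for the diagonal one inverts both constants.\<close>
    proof (rule exI[of _ "1 / (2 * C)"], rule exI[of _ "1 / \<kappa>"], intro conjI ballI)
      have "\<kappa> \<le> 2 * C" using \<kappa> C by linarith
      then show "1 / (2 * C) \<le> 1 / \<kappa>" using \<kappa> C by (intro divide_left_mono) auto
      fix m and v :: "real vec" assume m: "m \<in> ?I" and "v \<in> carrier_vec (dim_row (P_full \<Omega> m))"
      interpret discrete_system "num_dofs m" "mass_matrix \<Omega> m" "stiffness_matrix \<Omega> m" "mesh_size m" \<kappa> C s
        by (rule S[OF m])
      have "v \<in> carrier_vec (num_dofs m + num_dofs m)"
        using \<open>v \<in> carrier_vec (dim_row (P_full \<Omega> m))\<close> Q_carrier by (simp add: P_full_def)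
      note b = Q_bounds[OF this]
      show "1 / (2 * C) * ((P_full \<Omega> m *\<^sub>v v) \<bullet> v) \<le> (P_diag \<Omega> m *\<^sub>v v) \<bullet> v"
        unfolding P_diag_def P_full_def using b(2) \<open>1 \<le> C\<close> by (simp add: divide_le_eq mult_ac)
      show "(P_diag \<Omega> m *\<^sub>v v) \<bullet> v \<le> 1 / \<kappa> * ((P_full \<Omega> m *\<^sub>v v) \<bullet> v)"
        unfolding P_diag_def P_full_def using b(1) \<open>0 < \<kappa>\<close> by (simp add: le_divide_eq mult_ac)
    qed (use C in simp)
  qed

  moreover have conv: "minres_residual (P_diag \<Omega> m) (sys \<Omega> m) (system_rhs f) x\<^sub>0 n
      \<le> 1 / q * q ^ n * inv_norm (P_diag \<Omega> m) (system_rhs f - sys \<Omega> m *\<^sub>v x\<^sub>0)"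
    if "m \<in> ?I" "f \<in> carrier_vec (num_dofs m)" "x\<^sub>0 \<in> carrier_vec (2 * num_dofs m)" for m f x\<^sub>0 n
    unfolding P_diag_def sys_def
    by (rule discrete_system.convergence[OF S[OF that(1)] that(2,3) q_def])

  moreover have "\<exists>C'>0. \<forall>m\<in>?I. \<forall>\<epsilon>. 0 < \<epsilon> \<and> \<epsilon> \<le> \<epsilon>\<^sub>0 \<longrightarrow>
     (\<exists>n prog outs. real (length prog) \<le> C' * (real (num_dofs m) * ln (1 / \<epsilon>)) \<and>
        (\<forall>f\<in>carrier_vec (num_dofs m). \<forall>x\<^sub>0\<in>carrier_vec (2 * num_dofs m).
           computes prog outs
             (system_input (mesh_size m) (mass_matrix \<Omega> m) (stiffness_matrix \<Omega> m) f x\<^sub>0)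
             n (minres (P_diag \<Omega> m) (sys \<Omega> m) (system_rhs f) x\<^sub>0) \<and>
           minres_residual (P_diag \<Omega> m) (sys \<Omega> m) (system_rhs f) x\<^sub>0 n
           \<le> \<epsilon> * inv_norm (P_diag \<Omega> m) (system_rhs f - sys \<Omega> m *\<^sub>v x\<^sub>0)))"
    if \<epsilon>0: "0 < \<epsilon>\<^sub>0" "\<epsilon>\<^sub>0 < 1" for \<epsilon>\<^sub>0
  proof -
    define L where "L = ln (1 / \<epsilon>\<^sub>0)"
    define \<mu> where "\<mu> = ln (1 / q)"
    \<comment> \<open>At most 2 + \<open>\<Lambda> / \<mu>\<close> steps are taken and the program
      adds two blocks. Because \<open>\<Lambda>\<close> is at least \<open>L\<close>, the additive 4
      is at most (4 / L) \<open>\<Lambda>\<close>; this is where the fixed upper bound on the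
      accuracy enters.\<close>
    define C' where "C' = (4 / L + 1 / \<mu>) * (24 * real s + 52)"
    have L: "0 < L" using \<epsilon>0 by (simp add: L_def)
    have \<mu>: "0 < \<mu>" using q by (simp add: \<mu>_def)
    have "0 < 4 / L + 1 / \<mu>" using L \<mu> by (intro add_pos_pos) auto
    moreover have "0 < 24 * real s + 52" by (rule add_nonneg_pos) auto
    ultimately have C': "0 < C'" unfolding C'_def by (rule mult_pos_pos)
    have "\<exists>n prog outs. real (length prog) \<le> C' * (real (num_dofs m) * ln (1 / \<epsilon>)) \<and>
        (\<forall>f\<in>carrier_vec (num_dofs m). \<forall>x\<^sub>0\<in>carrier_vec (2 * num_dofs m).
           computes prog outs
             (system_input (mesh_size m) (mass_matrix \<Omega> m) (stiffness_matrix \<Omega> m) f x\<^sub>0)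
             n (minres (P_diag \<Omega> m) (sys \<Omega> m) (system_rhs f) x\<^sub>0) \<and>
           minres_residual (P_diag \<Omega> m) (sys \<Omega> m) (system_rhs f) x\<^sub>0 n
           \<le> \<epsilon> * inv_norm (P_diag \<Omega> m) (system_rhs f - sys \<Omega> m *\<^sub>v x\<^sub>0))"
      if m: "m \<in> ?I" and \<epsilon>: "0 < \<epsilon>" "\<epsilon> \<le> \<epsilon>\<^sub>0" for m \<epsilon>
    proof -
      interpret discrete_system "num_dofs m" "mass_matrix \<Omega> m" "stiffness_matrix \<Omega> m" "mesh_size m" \<kappa> C s
        by (rule S[OF m])
      define \<Lambda> where "\<Lambda> = ln (1 / \<epsilon>)"
      \<comment> \<open>The additional 1 compensates the prefactor \<open>1 / q\<close> of the
        convergence estimate: the target is \<open>q ^ n \<le> q * \<epsilon>\<close>.\<close>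
      define n where "n = nat \<lceil>1 + \<Lambda> / \<mu>\<rceil>"
      have \<Lambda>: "L \<le> \<Lambda>" unfolding L_def \<Lambda>_def using \<epsilon> \<epsilon>0 by (simp add: ln_div)
      then have "0 \<le> \<Lambda> / \<mu>" using L \<mu> by simp
      then have n: "1 + \<Lambda> / \<mu> \<le> real n" "real n \<le> 2 + \<Lambda> / \<mu>" unfolding n_def by linarith+
      have "real n * \<mu> \<ge> \<mu> + \<Lambda>"
        using mult_right_mono[OF n(1), of \<mu>] \<mu> by (simp add: distrib_right)
      then have "real n * ln q \<le> ln q + ln \<epsilon>"
        using q \<epsilon> by (simp add: \<mu>_def \<Lambda>_def ln_div)
      then have "ln (q ^ n) \<le> ln (q * \<epsilon>)"
        using q \<epsilon> by (simp add: ln_realpow ln_mult)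
      then have "q ^ n \<le> q * \<epsilon>" using q \<epsilon> by simp
      then have q\<epsilon>: "1 / q * q ^ n \<le> \<epsilon>" using q by (simp add: field_simps)
      have "4 \<le> 4 / L * \<Lambda>" using L \<Lambda> by (simp add: field_simps)
      then have "real n + 2 \<le> (4 / L + 1 / \<mu>) * \<Lambda>" using n(2) by (simp add: distrib_right)
      then have n2: "(real n + 2) * real (num_dofs m) * (24 * real s + 52)
          \<le> (4 / L + 1 / \<mu>) * \<Lambda> * real (num_dofs m) * (24 * real s + 52)"
        by (intro mult_right_mono) auto
      obtain prog outs where prog: "length prog \<le> (n + 2) * num_dofs m * (24 * s + 52)"
        and comp: "\<forall>f\<in>carrier_vec (num_dofs m). \<forall>x\<^sub>0\<in>carrier_vec (2 * num_dofs m).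
          computes prog outs (system_input (mesh_size m) (mass_matrix \<Omega> m) (stiffness_matrix \<Omega> m) f x\<^sub>0) n
            (minres (diag_precond (mesh_size m) (mass_matrix \<Omega> m))
              (system_matrix (mesh_size m ^ 4) (mass_matrix \<Omega> m) (stiffness_matrix \<Omega> m)) (system_rhs f) x\<^sub>0)"
        using minres_program[of n] by blast
      have "real (length prog) \<le> real ((n + 2) * num_dofs m * (24 * s + 52))"
        using prog by (simp only: of_nat_le_iff)
      also have "\<dots> = (real n + 2) * real (num_dofs m) * (24 * real s + 52)"
        by (simp only: of_nat_mult of_nat_add of_nat_numeral)
      also note n2
      also have "(4 / L + 1 / \<mu>) * \<Lambda> * real (num_dofs m) * (24 * real s + 52)
          = C' * (real (num_dofs m) * ln (1 / \<epsilon>))"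
        by (simp add: C'_def \<Lambda>_def mult_ac)
      finally have len: "real (length prog) \<le> C' * (real (num_dofs m) * ln (1 / \<epsilon>))" .
      have res: "minres_residual (P_diag \<Omega> m) (sys \<Omega> m) (system_rhs f) x\<^sub>0 n
           \<le> \<epsilon> * inv_norm (P_diag \<Omega> m) (system_rhs f - sys \<Omega> m *\<^sub>v x\<^sub>0)"
        if "f \<in> carrier_vec (num_dofs m)" "x\<^sub>0 \<in> carrier_vec (2 * num_dofs m)" for f x\<^sub>0
      proof -
        have "system_rhs f - sys \<Omega> m *\<^sub>v x\<^sub>0 \<in> carrier_vec (num_dofs m + num_dofs m)"
          using that A_carrier by (simp add: system_rhs_def sys_def mult_2)
        then have "0 \<le> inv_norm (P_diag \<Omega> m) (system_rhs f - sys \<Omega> m *\<^sub>v x\<^sub>0)"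
          using nrm_nonneg by (simp add: inv_norm_def nrm_def P_diag_def)
        then show ?thesis
          using conv[OF m that, of n] mult_right_mono[OF q\<epsilon>] by (meson order_trans)
      qed
      show ?thesis
        using len res comp unfolding P_diag_def sys_def by blast
    qed
    then show ?thesis using C' by blast
  qed
  ultimately show ?thesis
    using q by (intro conjI exI[of _ "1 / q"] exI[of _ q]) auto
qed

end
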